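(* Let $\Omega\subset\mathbb{R}^d$ be a smooth domain with boundary $\Gamma=\partial\Omega$, let $m\ge 2$ and $0<T<\infty$. Let $\phi:\mathbb{R}^m\to\mathbb{R}$ be a non-negative convex $C^1$ function with $\phi(0)=0$, let $b=\nabla\phi$ with $b(0)=0$, and let $B(z)=z\cdot b(z)-\phi(z)$. Assume that there is a constant $C>0$ such that $|b(z)|\le C(|z|+1)$ and $|b(z)|^2\le C(B(z)+1)$ for all $z\in\mathbb{R}^m$. Let the data $f,u_b,b_0$ of the evolution problem described in the context satisfy the assumptions listed there. Assume, moreover, that $\phi(z)=\Phi(|z|)$ for all $z\in\mathbb{R}^m$, for some convex and nondecreasing $C^1$ function $\Phi:\mathbb{R}^+\to\mathbb{R}^+$ such that $\Phi(0)=0=\min_{s\in\mathbb{R}^+}\Phi(s)$. Let $h>0$, $\overline{u}\in L^2(\Omega;\mathbb{R}^m)$, $w\in H^{1/2}(\Gamma;\mathbb{R}^m)$ and $g\in L^2(\Omega;\mathbb{R}^m)$. If $\overline{u}$ and $g$ are componentwise non-negative, then the minimizer $u$ of $$\mathcal{E}(u)=\int_\Omega\frac{\phi(u)-b(\overline{u})\cdot u}{h}\,dx+\frac12\int_\Omega|\nabla u|^2\,dx-\int_\Omega g\cdot u\,dx$$ over all $u\in H^1(\Omega;\mathbb{R}^m)$ with $u|_\Gamma=w$ is componentwise non-negative.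
   Context: $|\cdot|$ is the Euclidean norm on $\mathbb{R}^m$, $\mathbb{R}^+=[0,\infty)$, and $u|_\Gamma=w$ is understood in the trace sense. The minimizer $u$ is the solution of the variational problem: $u\in H^1(\Omega;\mathbb{R}^m)$, $u|_\Gamma=w$ and $$\int_\Omega\frac{b(u)-b(\overline{u})}{h}\cdot\xi\,dx+\int_\Omega\nabla u\cdot\nabla\xi\,dx=\int_\Omega g\cdot\xi\,dx\qquad\text{for all }\xi\in H^1_0(\Omega;\mathbb{R}^m).$$ This is one implicit time step, of size $h$, for the evolution problem $\partial_t b(u)-\Delta u=f$ in $(0,T)\times\Omega$, $u=u_b$ on $(0,T)\times\Gamma$, $b(u|_{t=0})=b_0$ in $\Omega$. The assumptions on its data are: $f\in L^2(0,T;H^{-1}(\Omega;\mathbb{R}^m))$; $b_0=b(u_0)$ for some measurable $u_0:\Omega\to\mathbb{R}^m$, with $\Psi(b_0)\in L^1(\Omega)$, where $\Psi(y)=\sup_{z\in\mathbb{R}^m}(z\cdot y-\phi(z))$ is the Legendre conjugate of $\phi$; and $u_b\in L^2(0,T;H^{1/2}(\Gamma;\mathbb{R}^m))$ has an extension to $\Omega$, still denoted $u_b$, with $u_b\in L^\infty(0,T;H^1(\Omega;\mathbb{R}^m))$ and $\partial_t u_b\in L^2(0,T;L^2(\Omega;\mathbb{R}^m))$.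
   Formalization: The boundary datum w is additionally assumed componentwise non-negative almost everywhere on Γ; without this the claim fails (φ=0, ū=g=0, w=(-1,…,-1) on a ball gives u=(-1,…,-1)), and it is necessary, since a non-negative u has a non-negative trace. *)

theory Defs
  imports "HOL-Analysis.Analysis"
begin

section \<open>Smooth functions and smooth domains\<close>

text \<open>Only used for open sets, on which the Frechet derivative is the usual total derivative.\<close>

primrec Ck_on :: "nat \<Rightarrow> ('a::euclidean_space \<Rightarrow> 'b::real_normed_vector) \<Rightarrow> 'a set \<Rightarrow> bool" where
  "Ck_on 0 f U \<longleftrightarrow> continuous_on U f"
| "Ck_on (Suc k) f U \<longleftrightarrow> (\<forall>x\<in>U. f differentiable (at x)) \<and>
     (\<forall>e\<in>Basis. Ck_on k (\<lambda>x. frechet_derivative f (at x) e) U)"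

definition Cinf_on :: "('a::euclidean_space \<Rightarrow> 'b::real_normed_vector) \<Rightarrow> 'a set \<Rightarrow> bool" where
  "Cinf_on f U \<longleftrightarrow> (\<forall>k. Ck_on k f U)"

text \<open>\<open>C\<^sub>c\<^sup>\<infinity>(\<Omega>)\<close>, its elements being extended by zero to the whole space.\<close>

definition test_functions :: "'a::euclidean_space set \<Rightarrow> ('a \<Rightarrow> 'b::real_normed_vector) set" where
  "test_functions \<Omega> =
     {\<psi>. Cinf_on \<psi> UNIV \<and> compact (closure {x. \<psi> x \<noteq> 0}) \<and> closure {x. \<psi> x \<noteq> 0} \<subseteq> \<Omega>}"

text \<open>The boundary is locally the zero set of a smooth function with nonvanishing gradient, and
  the domain lies on one side of it. Boundedness is not required.\<close>

definition smooth_domain :: "'a::euclidean_space set \<Rightarrow> bool" where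
  "smooth_domain \<Omega> \<longleftrightarrow> open \<Omega> \<and> connected \<Omega> \<and> \<Omega> \<noteq> {} \<and>
     (\<forall>x\<in>frontier \<Omega>. \<exists>U (\<rho> :: 'a \<Rightarrow> real). open U \<and> x \<in> U \<and> Cinf_on \<rho> U \<and>
        (\<forall>y\<in>U. frechet_derivative \<rho> (at y) \<noteq> (\<lambda>v. 0)) \<and>
        \<Omega> \<inter> U = {y \<in> U. \<rho> y < 0})"


section \<open>Surface measure\<close>

text \<open>\<open>k\<close>-dimensional Hausdorff measure, normalised to agree with \<open>k\<close>-dimensional Lebesgue
  measure. A nonempty set \<open>A\<close> is weighted with \<open>diameter A ^ k\<close>, so that \<open>k = 0\<close> gives counting
  measure. The outer measure is countably additive on the Borel sets (it is a metric outer
  measure), so the \<open>measure_of\<close> below does not degenerate to the zero measure.\<close>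

definition hausdorff_weight :: "nat \<Rightarrow> 'a::metric_space set \<Rightarrow> ennreal" where
  "hausdorff_weight k A =
     (if A = {} then 0 else ennreal (unit_ball_vol (real k) * (diameter A / 2) ^ k))"

definition hausdorff_outer :: "nat \<Rightarrow> 'a::metric_space set \<Rightarrow> ennreal" where
  "hausdorff_outer k A =
     (SUP \<delta>\<in>{0<..}. INF C\<in>{C :: nat \<Rightarrow> 'a set. A \<subseteq> (\<Union>n. C n) \<and>
                                   (\<forall>n. bounded (C n) \<and> diameter (C n) \<le> \<delta>)}.
        (\<Sum>n. hausdorff_weight k (C n)))"

definition hausdorff_measure :: "nat \<Rightarrow> 'a::metric_space measure" where
  "hausdorff_measure k = measure_of UNIV (sets borel) (hausdorff_outer k)"

definition surface_measure :: "'a::euclidean_space set \<Rightarrow> 'a measure" where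
  "surface_measure \<Gamma> = restrict_space (hausdorff_measure (DIM('a) - 1)) \<Gamma>"


section \<open>Sobolev spaces\<close>

text \<open>Elements of function spaces are represented by functions; equality almost everywhere is not
  divided out. Norms are given by their squares, with values in \<open>ennreal\<close>.\<close>

definition L2_sq :: "'a measure \<Rightarrow> ('a \<Rightarrow> 'b::euclidean_space) \<Rightarrow> ennreal" where
  "L2_sq M u = (\<integral>\<^sup>+x. ennreal ((norm (u x))\<^sup>2) \<partial>M)"

definition L2 :: "'a measure \<Rightarrow> ('a \<Rightarrow> 'b::euclidean_space) set" where
  "L2 M = {u \<in> borel_measurable M. L2_sq M u < \<infinity>}"

text \<open>The gradient of \<open>u\<close> is the matrix field whose \<open>i\<close>-th row is the gradient of the \<open>i\<close>-th
  component; the norm of the matrix type is the Frobenius norm.\<close>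

definition has_weak_gradient ::
  "(real^'d) set \<Rightarrow> (real^'d \<Rightarrow> real^'m) \<Rightarrow> (real^'d \<Rightarrow> real^'d^'m) \<Rightarrow> bool" where
  "has_weak_gradient \<Omega> u G \<longleftrightarrow>
     (\<forall>\<psi> \<in> (test_functions \<Omega> :: (real^'d \<Rightarrow> real) set). \<forall>i j.
        (LINT x|lebesgue_on \<Omega>. u x $ i * frechet_derivative \<psi> (at x) (axis j 1)) =
        - (LINT x|lebesgue_on \<Omega>. G x $ i $ j * \<psi> x))"

definition H1 :: "(real^'d) set \<Rightarrow> (real^'d \<Rightarrow> real^'m) set" where
  "H1 \<Omega> = {u \<in> L2 (lebesgue_on \<Omega>). \<exists>G\<in>L2 (lebesgue_on \<Omega>). has_weak_gradient \<Omega> u G}"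

text \<open>For \<open>u \<in> H1 \<Omega>\<close> the weak gradient is determined almost everywhere; a representative is
  chosen.\<close>

definition weak_grad :: "(real^'d) set \<Rightarrow> (real^'d \<Rightarrow> real^'m) \<Rightarrow> (real^'d \<Rightarrow> real^'d^'m)" where
  "weak_grad \<Omega> u = (SOME G. G \<in> L2 (lebesgue_on \<Omega>) \<and> has_weak_gradient \<Omega> u G)"

definition H1_sq :: "(real^'d) set \<Rightarrow> (real^'d \<Rightarrow> real^'m) \<Rightarrow> ennreal" where
  "H1_sq \<Omega> u = L2_sq (lebesgue_on \<Omega>) u + L2_sq (lebesgue_on \<Omega>) (weak_grad \<Omega> u)"

definition H10 :: "(real^'d) set \<Rightarrow> (real^'d \<Rightarrow> real^'m) set" where
  "H10 \<Omega> = {u \<in> H1 \<Omega>. \<exists>\<psi>. (\<forall>n::nat. \<psi> n \<in> test_functions \<Omega>) \<and>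
                             (\<lambda>n. H1_sq \<Omega> (\<psi> n - u)) \<longlonglongrightarrow> 0}"

definition Hminus1 :: "(real^'d) set \<Rightarrow> ((real^'d \<Rightarrow> real^'m) \<Rightarrow> real) set" where
  "Hminus1 \<Omega> = {F.
     (\<forall>\<xi>\<in>H10 \<Omega>. \<forall>\<eta>\<in>H10 \<Omega>. \<forall>a c. F (\<lambda>x. a *\<^sub>R \<xi> x + c *\<^sub>R \<eta> x) = a * F \<xi> + c * F \<eta>) \<and>
     (\<exists>K\<ge>0. \<forall>\<xi>\<in>H10 \<Omega>. ennreal ((F \<xi>)\<^sup>2) \<le> ennreal K * H1_sq \<Omega> \<xi>)}"

definition Hminus1_sq :: "(real^'d) set \<Rightarrow> ((real^'d \<Rightarrow> real^'m) \<Rightarrow> real) \<Rightarrow> ennreal" where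
  "Hminus1_sq \<Omega> F = (SUP \<xi>\<in>{\<xi> \<in> H10 \<Omega>. H1_sq \<Omega> \<xi> \<le> 1}. ennreal ((F \<xi>)\<^sup>2))"

text \<open>\<open>H\<^sup>1\<^sup>/\<^sup>2(\<Gamma>)\<close> with the Sobolev-Slobodeckij norm; the exponent \<open>(d - 1) + 2 \<cdot> 1/2\<close> equals \<open>d\<close>.\<close>

definition Hhalf_sq :: "(real^'d) set \<Rightarrow> (real^'d \<Rightarrow> real^'m) \<Rightarrow> ennreal" where
  "Hhalf_sq \<Gamma> w = L2_sq (surface_measure \<Gamma>) w +
     (\<integral>\<^sup>+x. (\<integral>\<^sup>+y. ennreal ((norm (w x - w y))\<^sup>2 / norm (x - y) ^ CARD('d))
        \<partial>surface_measure \<Gamma>) \<partial>surface_measure \<Gamma>)"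

definition Hhalf :: "(real^'d) set \<Rightarrow> (real^'d \<Rightarrow> real^'m) set" where
  "Hhalf \<Gamma> = {w \<in> borel_measurable (surface_measure \<Gamma>). Hhalf_sq \<Gamma> w < \<infinity>}"

text \<open>The trace is the continuous extension, from \<open>H\<^sup>1(\<Omega>)\<close> to \<open>L\<^sup>2(\<partial>\<Omega>)\<close>, of the restriction of
  functions that are \<open>C\<^sup>1\<close> up to the boundary.\<close>

definition has_trace :: "(real^'d) set \<Rightarrow> (real^'d \<Rightarrow> real^'m) \<Rightarrow> (real^'d \<Rightarrow> real^'m) \<Rightarrow> bool" where
  "has_trace \<Omega> u w \<longleftrightarrow> u \<in> H1 \<Omega> \<and> w \<in> L2 (surface_measure (frontier \<Omega>)) \<and>
     (\<exists>p. (\<forall>n::nat. Ck_on 1 (p n) UNIV \<and> p n \<in> H1 \<Omega>) \<and>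
          (\<lambda>n. H1_sq \<Omega> (p n - u)) \<longlonglongrightarrow> 0 \<and>
          (\<lambda>n. L2_sq (surface_measure (frontier \<Omega>)) (p n - w)) \<longlonglongrightarrow> 0)"


section \<open>Bochner spaces over the time interval\<close>

text \<open>The space \<open>X\<close> carries the norm whose square is \<open>N\<close>. Strong measurability is approximability
  by simple functions.\<close>

abbreviation time_measure :: "real \<Rightarrow> real measure" where
  "time_measure T \<equiv> lebesgue_on {0<..<T}"

definition strongly_measurable ::
  "('x::minus) set \<Rightarrow> ('x \<Rightarrow> ennreal) \<Rightarrow> real \<Rightarrow> (real \<Rightarrow> 'x) \<Rightarrow> bool" where
  "strongly_measurable X N T v \<longleftrightarrow>
     (AE t in time_measure T. v t \<in> X) \<and>
     (\<exists>s. (\<forall>n::nat. simple_function (time_measure T) (s n) \<and> (\<forall>t\<in>{0<..<T}. s n t \<in> X)) \<and>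
          (AE t in time_measure T. (\<lambda>n. N (s n t - v t)) \<longlonglongrightarrow> 0))"

definition bochner_L2 :: "('x::minus) set \<Rightarrow> ('x \<Rightarrow> ennreal) \<Rightarrow> real \<Rightarrow> (real \<Rightarrow> 'x) set" where
  "bochner_L2 X N T =
     {v. strongly_measurable X N T v \<and> (\<integral>\<^sup>+t. N (v t) \<partial>time_measure T) < \<infinity>}"

definition bochner_Linf :: "('x::minus) set \<Rightarrow> ('x \<Rightarrow> ennreal) \<Rightarrow> real \<Rightarrow> (real \<Rightarrow> 'x) set" where
  "bochner_Linf X N T =
     {v. strongly_measurable X N T v \<and> (\<exists>K::real. AE t in time_measure T. N (v t) \<le> ennreal K)}"

text \<open>\<open>v'\<close> is the distributional time derivative of \<open>v\<close>. The \<open>L\<^sup>2(\<Omega>)\<close>-valued integrals over time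
  are expressed by pairing them with the elements of \<open>L\<^sup>2(\<Omega>)\<close>.\<close>

definition has_time_derivative ::
  "(real^'d) set \<Rightarrow> real \<Rightarrow> (real \<Rightarrow> real^'d \<Rightarrow> real^'m) \<Rightarrow> (real \<Rightarrow> real^'d \<Rightarrow> real^'m) \<Rightarrow> bool" where
  "has_time_derivative \<Omega> T v v' \<longleftrightarrow>
     (\<forall>\<psi> \<in> (test_functions {0<..<T} :: (real \<Rightarrow> real) set). \<forall>\<xi> \<in> L2 (lebesgue_on \<Omega>).
        (LINT t|time_measure T. (LINT x|lebesgue_on \<Omega>. v t x \<bullet> \<xi> x) * deriv \<psi> t) =
        - (LINT t|time_measure T. (LINT x|lebesgue_on \<Omega>. v' t x \<bullet> \<xi> x) * \<psi> t))"


section \<open>The evolution problem and one time step\<close>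

definition legendre_conj :: "('v::real_inner \<Rightarrow> real) \<Rightarrow> 'v \<Rightarrow> ereal" where
  "legendre_conj \<phi> y = (SUP z. ereal (z \<bullet> y - \<phi> z))"

definition admissible_source ::
  "(real^'d) set \<Rightarrow> real \<Rightarrow> (real \<Rightarrow> (real^'d \<Rightarrow> real^'m) \<Rightarrow> real) \<Rightarrow> bool" where
  "admissible_source \<Omega> T f \<longleftrightarrow> f \<in> bochner_L2 (Hminus1 \<Omega>) (Hminus1_sq \<Omega>) T"

definition admissible_initial_data ::
  "(real^'d) set \<Rightarrow> (real^'m \<Rightarrow> real) \<Rightarrow> (real^'m \<Rightarrow> real^'m) \<Rightarrow> (real^'d \<Rightarrow> real^'m) \<Rightarrow> bool" where
  "admissible_initial_data \<Omega> \<phi> b b0 \<longleftrightarrow>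
     (\<exists>u0 \<in> borel_measurable (lebesgue_on \<Omega>). AE x in lebesgue_on \<Omega>. b0 x = b (u0 x)) \<and>
     (AE x in lebesgue_on \<Omega>. \<bar>legendre_conj \<phi> (b0 x)\<bar> \<noteq> \<infinity>) \<and>
     integrable (lebesgue_on \<Omega>) (\<lambda>x. real_of_ereal (legendre_conj \<phi> (b0 x)))"

definition admissible_boundary_data ::
  "(real^'d) set \<Rightarrow> real \<Rightarrow> (real \<Rightarrow> real^'d \<Rightarrow> real^'m) \<Rightarrow> bool" where
  "admissible_boundary_data \<Omega> T ub \<longleftrightarrow>
     ub \<in> bochner_L2 (Hhalf (frontier \<Omega>)) (Hhalf_sq (frontier \<Omega>)) T \<and>
     (\<exists>v v'. (AE t in time_measure T. has_trace \<Omega> (v t) (ub t)) \<and>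
        v \<in> bochner_Linf (H1 \<Omega>) (H1_sq \<Omega>) T \<and>
        v' \<in> bochner_L2 (L2 (lebesgue_on \<Omega>)) (L2_sq (lebesgue_on \<Omega>)) T \<and>
        has_time_derivative \<Omega> T v v')"

text \<open>Integral with values in the extended reals; it agrees with the Lebesgue integral for
  integrable functions, and is \<open>\<infinity>\<close> whenever the integral of the positive part is.\<close>

definition ext_integral :: "'a measure \<Rightarrow> ('a \<Rightarrow> real) \<Rightarrow> ereal" where
  "ext_integral M F =
     enn2ereal (\<integral>\<^sup>+x. ennreal (F x) \<partial>M) - enn2ereal (\<integral>\<^sup>+x. ennreal (- F x) \<partial>M)"

definition energy ::
  "(real^'d) set \<Rightarrow> (real^'m \<Rightarrow> real) \<Rightarrow> (real^'m \<Rightarrow> real^'m) \<Rightarrow> real \<Rightarrow>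
   (real^'d \<Rightarrow> real^'m) \<Rightarrow> (real^'d \<Rightarrow> real^'m) \<Rightarrow> (real^'d \<Rightarrow> real^'m) \<Rightarrow> ereal" where
  "energy \<Omega> \<phi> b h ubar g u =
     ext_integral (lebesgue_on \<Omega>) (\<lambda>x. (\<phi> (u x) - b (ubar x) \<bullet> u x) / h) +
     ereal (1 / 2 * (LINT x|lebesgue_on \<Omega>. (norm (weak_grad \<Omega> u x))\<^sup>2)) -
     ereal (LINT x|lebesgue_on \<Omega>. g x \<bullet> u x)"

text \<open>Under the growth condition on \<open>b\<close> the energy of every \<open>u \<in> H1 \<Omega>\<close> is finite if \<open>\<Omega>\<close> is
  bounded.\<close>

definition is_minimizer ::
  "(real^'d) set \<Rightarrow> (real^'m \<Rightarrow> real) \<Rightarrow> (real^'m \<Rightarrow> real^'m) \<Rightarrow> real \<Rightarrow>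
   (real^'d \<Rightarrow> real^'m) \<Rightarrow> (real^'d \<Rightarrow> real^'m) \<Rightarrow> (real^'d \<Rightarrow> real^'m) \<Rightarrow>
   (real^'d \<Rightarrow> real^'m) \<Rightarrow> bool" where
  "is_minimizer \<Omega> \<phi> b h ubar g w u \<longleftrightarrow>
     u \<in> H1 \<Omega> \<and> has_trace \<Omega> u w \<and> \<bar>energy \<Omega> \<phi> b h ubar g u\<bar> \<noteq> \<infinity> \<and>
     (\<forall>v\<in>H1 \<Omega>. has_trace \<Omega> v w \<longrightarrow> energy \<Omega> \<phi> b h ubar g u \<le> energy \<Omega> \<phi> b h ubar g v)"

definition ae_nonneg :: "'a measure \<Rightarrow> ('a \<Rightarrow> real^'m) \<Rightarrow> bool" where
  "ae_nonneg M u \<longleftrightarrow> (AE x in M. \<forall>i. 0 \<le> u x $ i)"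

end

theory Submission
  imports Defs
begin

text \<open>The competitor is the componentwise positive part \<open>u\<^sup>+\<close> of the minimizer \<open>u\<close>. It has the same
trace, because the boundary datum is nonnegative, and passing from \<open>u\<close> to \<open>u\<^sup>+\<close> increases no
term of the energy: \<open>\<bar>u\<^sup>+\<bar> \<le> \<bar>u\<bar>\<close> and \<open>\<Phi>\<close> is nondecreasing; \<open>b(ubar) = \<nabla>\<phi>(ubar)\<close> is
componentwise nonnegative where \<open>ubar\<close> is, since \<open>\<phi>\<close> increases there along the coordinate
directions (\<open>radial_gradient_nonneg\<close>); and \<open>\<nabla>u\<^sup>+\<close> arises from \<open>\<nabla>u\<close> by deleting the rows
where \<open>u\<close> is not positive. Minimality turns the last comparison into an equality, so
\<open>v = u\<^sup>+ - u\<close> has zero gradient. It also has zero trace, hence \<open>v = 0\<close> and \<open>u = u\<^sup>+ \<ge> 0\<close>.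

Traces are defined through functions that are \<open>C\<^sup>1\<close> on the whole space, so everything is done with
one sequence of \<open>C\<^sup>1\<close> functions \<open>p\<^sub>n\<close> converging to \<open>u\<close> in \<open>H\<^sup>1\<close> and to \<open>w\<close> on the
boundary. The lemma \<open>smooth_positive_part_approximation\<close> composes \<open>p\<^sub>n\<close> with
\<open>C\<^sup>1\<close> approximations of the positive part whose parameter tends to zero much more slowly than
\<open>p\<^sub>n - u\<close>. The resulting \<open>q\<^sub>n\<close> converge to \<open>u\<^sup>+\<close> in \<open>H\<^sup>1\<close> and to \<open>w\<^sup>+\<close> on the boundary,
which gives the chain rule for the positive part and its trace at once.

It remains to see that a limit \<open>v\<close> of \<open>C\<^sup>1\<close> functions whose gradients and boundary values tend to
zero vanishes. Both parts of this come from one estimate along segments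
(\<open>C1_moving_endpoint_estimate\<close>), which bounds the mass of a \<open>C\<^sup>1\<close> function on a set by its values
at displaced points and its gradient. With a constant displacement it shows that zeros of \<open>v\<close>
propagate from ball to ball, hence through the connected domain. With the time at which a segment
hits the boundary as displacement it shows that \<open>v\<close> vanishes near a boundary point. This uses
that the surface measure of a boundary patch dominates a multiple of the Lebesgue measure of the
points that are carried to the patch by a bounded displacement in a fixed coordinate direction
(\<open>hausdorff_outer_ge_shadow\<close>). If there is no boundary, the domain is the whole space,
and far translates of a ball carry arbitrarily little of the mass of \<open>v\<close>.

Two foundations are laid on the way: weak gradients are unique, so that the chosen representative
of the gradient may be computed, and the Hausdorff outer measure is countably additive on the Borel
sets.\<close>

section \<open>Test functions and uniqueness of the weak gradient\<close>

lemma Ck_on_const: "Ck_on k (\<lambda>x. c) U"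
proof (induction k arbitrary: c)
  case (Suc k)
  have "frechet_derivative (\<lambda>x. c) (at x) = (\<lambda>v. 0)" for x :: 'a
    by (rule frechet_derivative_at[symmetric]) (rule has_derivative_const)
  then show ?case using Suc by simp
qed simp

lemma Ck_on_SucD: "Ck_on (Suc k) f U \<Longrightarrow> Ck_on k f U"
proof (induction k arbitrary: f)
  case 0
  then show ?case
    by (auto intro!: continuous_at_imp_continuous_on differentiable_imp_continuous_within)
next
  case (Suc k)
  from Suc.prems show ?case unfolding Ck_on.simps(2)[of "Suc k"] Ck_on.simps(2)[of k f] using Suc.IH by blast
qed

lemma Ck_on_add:
  "Ck_on k f UNIV \<Longrightarrow> Ck_on k g UNIV \<Longrightarrow> Ck_on k (\<lambda>x. f x + g x) UNIV"
proof (induction k arbitrary: f g)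
  case 0 then show ?case by (auto intro: continuous_on_add)
next
  case (Suc k)
  have "frechet_derivative (\<lambda>x. f x + g x) (at x) = (\<lambda>e. frechet_derivative f (at x) e + frechet_derivative g (at x) e)" for x
    using Suc.prems by (intro frechet_derivative_at[symmetric] has_derivative_add) (auto simp: frechet_derivative_works[symmetric])
  then show ?case using Suc by auto
qed

lemma Ck_on_mult:
  fixes f g :: "'a::euclidean_space \<Rightarrow> real"
  shows "Ck_on k f UNIV \<Longrightarrow> Ck_on k g UNIV \<Longrightarrow> Ck_on k (\<lambda>x. f x * g x) UNIV"
proof (induction k arbitrary: f g)
  case 0 then show ?case by (auto intro: continuous_on_mult)
next
  case (Suc k)
  have "frechet_derivative (\<lambda>x. f x * g x) (at x) = (\<lambda>e. f x * frechet_derivative g (at x) e + frechet_derivative f (at x) e * g x)" for x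
    using Suc.prems by (intro frechet_derivative_at[symmetric] has_derivative_mult) (auto simp: frechet_derivative_works[symmetric])
  moreover have "Ck_on k f UNIV" "Ck_on k g UNIV" using Suc.prems Ck_on_SucD by blast+
  ultimately show ?case using Suc by (auto intro!: Ck_on_add)
qed

lemma Ck_on_prod:
  fixes f :: "'i \<Rightarrow> 'a::euclidean_space \<Rightarrow> real"
  assumes "finite I" "\<And>i. i \<in> I \<Longrightarrow> Ck_on k (f i) UNIV"
  shows "Ck_on k (\<lambda>x. \<Prod>i\<in>I. f i x) UNIV"
  using assms by (induction I) (auto intro: Ck_on_const Ck_on_mult)

text \<open>The linear span of the functions \<open>flat j\<close> is closed under differentiation, so that a single
induction shows that \<open>flat 0\<close>, the standard flat function, is smooth.\<close>

definition flat :: "nat \<Rightarrow> real \<Rightarrow> real" where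
  "flat j s = (if s \<le> 0 then 0 else exp (- 1 / s) / s ^ j)"

lemma flat_tendsto_0: "(flat j \<longlongrightarrow> 0) (at_right 0)"
proof -
  have "((\<lambda>s. (inverse s) ^ j / exp (inverse s)) \<longlongrightarrow> (0::real)) (at_right 0)"
    by (rule filterlim_compose[OF tendsto_power_div_exp_0 filterlim_inverse_at_top_right])
  moreover have "\<forall>\<^sub>F s in at_right 0. (inverse s) ^ j / exp (inverse s) = flat j s"
    by (rule eventually_at_right_less[THEN eventually_mono])
       (auto simp: flat_def exp_minus field_simps)
  ultimately show ?thesis by (rule Lim_transform_eventually)
qed

lemma flat_DERIV: "(flat j has_real_derivative flat (j + 2) s - real j * flat (j + 1) s) (at s)"
proof -
  consider "s > 0" | "s < 0" | "s = 0" by linarith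
  then show ?thesis
  proof cases
    case 1
    have "((\<lambda>s. exp (- 1 / s) / s ^ j) has_real_derivative flat (j + 2) s - real j * flat (j + 1) s) (at s)"
      using 1 by (auto intro!: derivative_eq_intros simp: flat_def field_simps power2_eq_square)
         (cases j; simp add: field_simps)
    then show ?thesis
      by (rule has_field_derivative_transform_within_open[where S="{0<..}"]) (use 1 in \<open>auto simp: flat_def\<close>)
  next
    case 2
    have "((\<lambda>s. 0) has_real_derivative flat (j + 2) s - real j * flat (j + 1) s) (at s)"
      using 2 by (auto simp: flat_def)
    then show ?thesis
      by (rule has_field_derivative_transform_within_open[where S="{..<0}"]) (use 2 in \<open>auto simp: flat_def\<close>)
  next
    case 3
    have "((\<lambda>h. flat j h / h) \<longlongrightarrow> 0) (at_right 0)"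
      by (rule Lim_transform_eventually[OF flat_tendsto_0[of "Suc j"]])
         (auto simp: eventually_at_filter flat_def)
    moreover have "((\<lambda>h. flat j h / h) \<longlongrightarrow> 0) (at_left 0)"
      by (rule Lim_transform_eventually[OF tendsto_const]) (auto simp: eventually_at_filter flat_def)
    ultimately have "((\<lambda>h. flat j h / h) \<longlongrightarrow> 0) (at 0)"
      by (simp add: filterlim_split_at)
    then show ?thesis by (simp add: 3 DERIV_def flat_def)
  qed
qed

text \<open>The derivative of \<open>flat j\<close> is a combination of \<open>flat (j + 1)\<close> and \<open>flat (j + 2)\<close>; hence the
induction on \<open>k\<close> runs for all \<open>j\<close> simultaneously.\<close>

lemma Ck_on_flat_affine:
  fixes c d :: real and i :: "'d::finite"
  shows "Ck_on k (\<lambda>x::real^'d. flat j (c * x $ i + d)) UNIV"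
proof (induction k arbitrary: j)
  case 0
  have "isCont (flat j) s" for s using flat_DERIV DERIV_isCont by blast
  then have "continuous_on UNIV (flat j)" by (simp add: continuous_at_imp_continuous_on)
  then show ?case by (auto intro!: continuous_on_compose2[of UNIV "flat j"] continuous_intros)
next
  case (Suc k)
  have D: "((\<lambda>x::real^'d. flat j (c * x $ i + d)) has_derivative
      (\<lambda>v. (flat (j + 2) (c * x $ i + d) + (- real j) * flat (j + 1) (c * x $ i + d)) * (c * v $ i))) (at x)" for x
  proof -
    have "((\<lambda>x::real^'d. c * x $ i + d) has_derivative (\<lambda>v. c * v $ i)) (at x)"
      by (auto intro!: derivative_eq_intros bounded_linear.has_derivative[OF bounded_linear_vec_nth])
    then show ?thesis
      using DERIV_compose_FDERIV[OF flat_DERIV] by (fastforce simp: algebra_simps)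
  qed
  show ?case
    unfolding Ck_on.simps frechet_derivative_at[OF D, symmetric]
    using D by (intro conjI ballI Ck_on_mult Ck_on_add Ck_on_const Suc) (auto simp only: differentiable_def)
qed

text \<open>The factor \<open>Suc n\<close> inside \<open>flat 0\<close> makes the bumps increase to the indicator of the open box,
because \<open>exp (- 1 / (n s))\<close> tends to \<open>1\<close> for every \<open>s > 0\<close>.\<close>

definition box_bump :: "nat \<Rightarrow> real^'d \<Rightarrow> real^'d \<Rightarrow> real^'d \<Rightarrow> real" where
  "box_bump n a b x = (\<Prod>i\<in>UNIV. flat 0 (real (Suc n) * (x $ i - a $ i)) * flat 0 (real (Suc n) * (b $ i - x $ i)))"

lemma box_bump_nonzero: "box_bump n a b x \<noteq> 0 \<longleftrightarrow> x \<in> box a b"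
  by (auto simp: box_bump_def flat_def mem_box_cart not_le zero_less_mult_iff mult_le_0_iff)

lemma flat_0_bounds: "0 \<le> flat 0 s" "flat 0 s \<le> 1"
  by (auto simp: flat_def)

lemma box_bump_bounds: "0 \<le> box_bump n a b x" "box_bump n a b x \<le> 1"
  unfolding box_bump_def
  by (auto intro!: prod_nonneg prod_le_1 mult_le_one mult_nonneg_nonneg flat_0_bounds)

lemma box_bump_tendsto: "(\<lambda>n. box_bump n a b x) \<longlonglongrightarrow> indicat_real (box a b) x"
proof (cases "x \<in> box a b")
  case True
  have lim: "(\<lambda>n. flat 0 (real (Suc n) * s)) \<longlonglongrightarrow> 1" if "0 < s" for s
  proof -
    have "(\<lambda>n. exp (- 1 / s * inverse (real (Suc n)))) \<longlonglongrightarrow> exp (- 1 / s * 0)"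
      by (intro tendsto_intros LIMSEQ_inverse_real_of_nat)
    moreover have "flat 0 (real (Suc n) * s) = exp (- 1 / s * inverse (real (Suc n)))" for n
      using mult_pos_pos[of "real (Suc n)" s] that
      by (simp add: flat_def not_le divide_inverse mult.commute del: of_nat_Suc)
    ultimately show ?thesis by simp
  qed
  have "(\<lambda>n. box_bump n a b x) \<longlonglongrightarrow> (\<Prod>i\<in>(UNIV::'a set). 1 * 1)"
    unfolding box_bump_def
    using True by (intro tendsto_prod tendsto_mult lim) (auto simp: mem_box_cart)
  then show ?thesis using True by simp
next
  case False
  then have "box_bump n a b x = 0" for n using box_bump_nonzero by blast
  then show ?thesis using False by simp
qed

lemma box_bump_test:
  assumes "cbox a b \<subseteq> \<Omega>"
  shows "box_bump n a b \<in> test_functions \<Omega>"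
proof -
  have cl: "closure {x. box_bump n a b x \<noteq> 0} \<subseteq> cbox a b"
    unfolding box_bump_nonzero using box_subset_cbox[of a b] by (intro closure_minimal) auto
  have "flat 0 (real (Suc n) * (x $ i - a $ i)) = flat 0 (real (Suc n) * x $ i + (- real (Suc n) * a $ i))"
   "flat 0 (real (Suc n) * (b $ i - x $ i)) = flat 0 ((- real (Suc n)) * x $ i + real (Suc n) * b $ i)" for i x
    by (simp_all add: algebra_simps)
  then have "Ck_on k (box_bump n a b) UNIV" for k
    unfolding box_bump_def by (auto intro!: Ck_on_prod Ck_on_mult Ck_on_flat_affine simp only: finite_class.finite_UNIV)
  then show ?thesis
    using cl assms bounded_subset[OF bounded_cbox cl]
    by (auto simp: test_functions_def Cinf_on_def compact_eq_bounded_closed)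
qed

text \<open>Open boxes form an intersection-stable generator of the Borel sets, so the vanishing of the
integral carries over from them to all Borel sets; the assumption on the total integral makes it
survive complements.\<close>

lemma integral_boxes_zero_imp_AE_zero:
  fixes g :: "'a::euclidean_space \<Rightarrow> real"
  assumes g: "integrable lborel g" and g0: "integral\<^sup>L lborel g = 0"
    and boxes: "\<And>a b. set_lebesgue_integral lborel (box a b) g = 0"
  shows "AE x in lborel. g x = 0"
proof (rule sigma_finite_measure.density_zero[OF lborel.sigma_finite_measure_axioms g])
  fix A :: "'a set" assume "A \<in> sets lborel"
  then have A: "A \<in> sigma_sets UNIV (range (\<lambda>(a, b). box a b))"
    by (simp add: borel_eq_box)
  have stable: "Int_stable (range (\<lambda>(a, b). box a b :: 'a set))"
    by (auto simp: Int_stable_def box_Int_box)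
  have subset_Pow: "range (\<lambda>(a, b). box a b :: 'a set) \<subseteq> Pow UNIV" by simp
  have meas: "X \<in> sets lborel" if "X \<in> sigma_sets UNIV (range (\<lambda>(a, b). box a b))" for X :: "'a set"
    using that by (simp add: borel_eq_box)
  have si: "set_integrable lborel X g" if "X \<in> sets lborel" for X
    unfolding set_integrable_def using that g by (intro integrable_mult_indicator) auto
  show "set_lebesgue_integral lborel A g = 0"
    using stable subset_Pow A
  proof (induction A rule: sigma_sets_induct_disjoint)
    case (basic A)
    then show ?case using boxes by auto
  next
    case (compl A)
    have "set_lebesgue_integral lborel (UNIV - A) g + set_lebesgue_integral lborel A g = set_lebesgue_integral lborel (UNIV - A \<union> A) g"
      using meas[OF compl.hyps] si by (intro set_integral_Un[symmetric]) auto
    then show ?case using compl g0 by (simp add: set_lebesgue_integral_def)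
  next
    case (union A)
    have Am: "A i \<in> sets lborel" for i using union(2) meas by blast
    have "set_lebesgue_integral lborel (\<Union>i. A i) g = (\<Sum>i. set_lebesgue_integral lborel (A i) g)"
      using union(1) Am by (intro lebesgue_integral_countable_add si) (auto simp: disjoint_family_on_def)
    then show ?case using union by simp
  qed (auto simp: set_lebesgue_integral_def)
qed

text \<open>Testing with bumps that increase to the indicator of a box shows that the integral of \<open>f\<close> over
every box inside \<open>\<Omega>\<close> vanishes. Since \<open>f\<close> is only locally integrable, the preceding lemma is
applied to its restrictions to boxes, countably many of which exhaust \<open>\<Omega>\<close>.\<close>

lemma fundamental_lemma_calculus_of_variations:
  fixes f :: "real^'d \<Rightarrow> real"
  assumes "open \<Omega>"
    and loc: "\<And>a b. cbox a b \<subseteq> \<Omega> \<Longrightarrow> set_integrable lebesgue (cbox a b) f"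
    and zero: "\<And>\<psi>. \<psi> \<in> test_functions \<Omega> \<Longrightarrow> (LINT x|lebesgue_on \<Omega>. f x * \<psi> x) = 0"
  shows "AE x in lebesgue_on \<Omega>. f x = 0"
proof -
  have \<Omega>m [measurable]: "\<Omega> \<in> sets lebesgue" using \<open>open \<Omega>\<close> by auto
  have box0: "(LINT x|lebesgue. indicator (box a b) x * f x) = 0" if ab: "cbox a b \<subseteq> \<Omega>" for a b
  proof -
    note ci = loc[OF ab, unfolded set_integrable_def]
    have supp: "box_bump n a b x = 0" if "x \<notin> cbox a b" for n x
      using that box_bump_nonzero[of n a b x] box_subset_cbox[of a b] by blast
    have eq: "(LINT x|lebesgue_on \<Omega>. f x * box_bump n a b x) = (LINT x|lebesgue. box_bump n a b x * (indicator (cbox a b) x *\<^sub>R f x))" for n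
      using ab supp by (subst integral_restrict_space) (auto intro!: Bochner_Integration.integral_cong simp: indicator_def)
    have bm: "box_bump n a b \<in> borel_measurable lebesgue" for n
    proof -
      have "Ck_on 0 (box_bump n a b) UNIV"
        using box_bump_test[OF order_refl, of n a b] by (simp only: test_functions_def Cinf_on_def mem_Collect_eq)
      then have "continuous_on UNIV (box_bump n a b)" by simp
      then show ?thesis by (intro measurable_completion) (simp add: borel_measurable_continuous_onI)
    qed
    have "(\<lambda>n. LINT x|lebesgue. box_bump n a b x * (indicator (cbox a b) x *\<^sub>R f x)) \<longlonglongrightarrow>
      (LINT x|lebesgue. indicator (box a b) x * (indicator (cbox a b) x *\<^sub>R f x))"
    proof (rule integral_dominated_convergence[where w="\<lambda>x. norm (indicator (cbox a b) x *\<^sub>R f x)"])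
      show "integrable lebesgue (\<lambda>x. norm (indicat_real (cbox a b) x *\<^sub>R f x))"
        using ci by (rule integrable_norm)
      show "AE x in lebesgue. (\<lambda>n. box_bump n a b x * (indicat_real (cbox a b) x *\<^sub>R f x)) \<longlonglongrightarrow> indicat_real (box a b) x * (indicat_real (cbox a b) x *\<^sub>R f x)"
        by (intro AE_I2 tendsto_mult box_bump_tendsto tendsto_const)
      show "AE x in lebesgue. norm (box_bump n a b x * (indicat_real (cbox a b) x *\<^sub>R f x)) \<le> norm (indicat_real (cbox a b) x *\<^sub>R f x)" for n
        using box_bump_bounds[of n a b] by (auto simp: abs_mult mult_left_le_one_le)
      show "(\<lambda>x. indicat_real (box a b) x * (indicat_real (cbox a b) x *\<^sub>R f x)) \<in> borel_measurable lebesgue"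
        by (intro borel_measurable_times borel_measurable_integrable[OF ci] borel_measurable_indicator) auto
      show "(\<lambda>x. box_bump n a b x * (indicat_real (cbox a b) x *\<^sub>R f x)) \<in> borel_measurable lebesgue" for n
        by (intro borel_measurable_times borel_measurable_integrable[OF ci] bm)
    qed
    moreover have "(LINT x|lebesgue. box_bump n a b x * (indicator (cbox a b) x *\<^sub>R f x)) = 0" for n
      using zero[OF box_bump_test[OF ab, of n]] eq by simp
    ultimately have "(LINT x|lebesgue. indicator (box a b) x * (indicator (cbox a b) x *\<^sub>R f x)) = 0"
      by (simp add: LIMSEQ_const_iff)
    moreover have "indicator (box a b) x * (indicator (cbox a b) x *\<^sub>R f x) = indicator (box a b) x * f x" for x
      using box_subset_cbox[of a b] by (auto simp: indicator_def)
    ultimately show ?thesis by (simp only:)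
  qed
  have cboxAE: "AE x in lebesgue. x \<in> cbox a b \<longrightarrow> f x = 0" if ab: "cbox a b \<subseteq> \<Omega>" for a b
  proof -
    define g where "g x = indicator (box a b) x * f x" for x
    have gi: "integrable lebesgue g"
    proof -
      have "set_integrable lebesgue (box a b) f"
        by (rule set_integrable_subset[OF loc[OF ab]]) (auto simp: box_subset_cbox)
      then show ?thesis by (simp add: set_integrable_def g_def[abs_def])
    qed
    obtain g' where g'm [measurable]: "g' \<in> borel_measurable lborel" and gg': "AE x in lborel. g x = g' x"
      using completion_ex_borel_measurable_real[OF borel_measurable_integrable[OF gi]] by blast
    have gg'l: "AE x in lebesgue. g x = g' x" using gg' by (rule AE_completion)
    have g'i: "integrable lborel g'"
    proof -
      have "integrable lebesgue g'"
        by (rule integrable_cong_AE_imp[OF gi]) (use gg'l in \<open>auto intro: measurable_completion\<close>)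
      then show ?thesis by (simp add: integrable_completion)
    qed
    have int_eq: "(LINT x|lborel. indicator X x * g' x) = (LINT x|lebesgue. indicator X x * g x)"
      if X: "X \<in> sets lborel" for X
    proof -
      have "(LINT x|lborel. indicator X x * g' x) = (LINT x|lebesgue. indicator X x * g' x)"
        using X by (intro integral_completion[symmetric]) auto
      also have "\<dots> = (LINT x|lebesgue. indicator X x * g x)"
      proof (intro integral_cong_AE borel_measurable_times borel_measurable_integrable[OF gi] measurable_completion[OF g'm])
        show "AE x in lebesgue. indicat_real X x * g' x = indicat_real X x * g x"
          using gg'l by eventually_elim simp
        have "X \<in> sets lebesgue" using X by auto
        then show "indicat_real X \<in> borel_measurable lebesgue"
          and "indicat_real X \<in> borel_measurable lebesgue" by simp_all
      qed
      finally show ?thesis .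
    qed
    have "AE x in lborel. g' x = 0"
    proof (rule integral_boxes_zero_imp_AE_zero[OF g'i])
      show "integral\<^sup>L lborel g' = 0" using int_eq[of UNIV] box0[OF ab] by (simp add: g_def[abs_def])
      fix c d
      \<comment> \<open>If the boxes are disjoint, \<open>p\<close> and \<open>q\<close> are chosen so that the closed box is empty as well.\<close>
      have "\<exists>p q. box c d \<inter> box a b = box p q \<and> cbox p q \<subseteq> \<Omega>"
      proof (cases "box c d \<inter> box a b = {}")
        case True
        have "box (\<chi> i. 1) (\<chi> i. 0) = ({} :: (real^'d) set)" "cbox (\<chi> i. 1) (\<chi> i. 0) = ({} :: (real^'d) set)"
          unfolding interval_eq_empty_cart by simp_all
        then show ?thesis using True by (metis empty_subsetI)
      next
        case False
        obtain p q where pq: "box c d \<inter> box a b = box p q" using box_Int_box by blast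
        then have "box p q \<subseteq> box a b" "box p q \<noteq> {}" using False by auto
        then have "cbox p q \<subseteq> cbox a b"
          by (metis closure_box closure_mono subset_empty)
        then show ?thesis using pq ab by blast
      qed
      then obtain p q where pq: "box c d \<inter> box a b = box p q" "cbox p q \<subseteq> \<Omega>" by blast
      have "(LINT x|lborel. indicator (box c d) x * g' x) = (LINT x|lebesgue. indicator (box c d) x * g x)"
        by (rule int_eq) auto
      also have "\<dots> = (LINT x|lebesgue. indicator (box p q) x * f x)"
        unfolding pq(1)[symmetric] g_def by (simp add: indicator_inter_arith mult.assoc)
      also have "\<dots> = 0" by (rule box0[OF pq(2)])
      finally show "set_lebesgue_integral lborel (box c d) g' = 0" by (simp add: set_lebesgue_integral_def)
    qed
    then have "AE x in lebesgue. g' x = 0" by (rule AE_completion)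
    moreover have "AE x in lebesgue. x \<notin> cbox a b - box a b"
      using negligible_frontier_interval[of a b] by (intro AE_not_in) (simp add: negligible_iff_null_sets)
    ultimately show ?thesis using gg'l by eventually_elim (auto simp: g_def indicator_def split: if_splits)
  qed
  obtain D where D: "countable D" "D \<subseteq> Pow \<Omega>" "\<And>X. X \<in> D \<Longrightarrow> \<exists>a b. X = cbox a b" "\<Union>D = \<Omega>"
    using open_countable_Union_open_cbox[OF \<open>open \<Omega>\<close>] by metis
  have "AE x in lebesgue. \<forall>X\<in>D. x \<in> X \<longrightarrow> f x = 0"
    using D cboxAE by (intro AE_ball_countable[THEN iffD2] ballI) (blast, metis PowD subsetD)
  then have "AE x in lebesgue. x \<in> \<Omega> \<longrightarrow> f x = 0" using D(4) by (auto elim: AE_mp)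
  then show ?thesis by (subst AE_restrict_space_iff) auto
qed

section \<open>The space L2\<close>

lemma norm_add_sq_le: "(norm (x + y :: 'a::real_normed_vector))\<^sup>2 \<le> 2 * (norm x)\<^sup>2 + 2 * (norm y)\<^sup>2"
proof -
  have "(norm (x + y))\<^sup>2 \<le> (norm x + norm y)\<^sup>2" by (intro power_mono norm_triangle_ineq norm_ge_zero)
  also have "\<dots> \<le> 2 * (norm x)\<^sup>2 + 2 * (norm y)\<^sup>2"
    using sum_squares_bound[of "norm x" "norm y"] by (simp add: power2_sum)
  finally show ?thesis .
qed

lemma L2_sq_cong_AE: "AE x in M. norm (f x) = norm (g x) \<Longrightarrow> L2_sq M f = L2_sq M g"
  unfolding L2_sq_def by (rule nn_integral_cong_AE) auto

lemma L2_sq_mono_AE: "AE x in M. norm (f x) \<le> norm (g x) \<Longrightarrow> L2_sq M f \<le> L2_sq M g"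
  unfolding L2_sq_def by (rule nn_integral_mono_AE) (auto intro!: ennreal_leI power_mono elim: AE_mp)

lemma L2_sq_add_le:
  assumes [measurable]: "f \<in> borel_measurable M" "g \<in> borel_measurable M"
  shows "L2_sq M (\<lambda>x. f x + g x) \<le> 2 * L2_sq M f + 2 * L2_sq M g"
proof -
  have "L2_sq M (\<lambda>x. f x + g x) \<le> (\<integral>\<^sup>+x. 2 * ennreal ((norm (f x))\<^sup>2) + 2 * ennreal ((norm (g x))\<^sup>2) \<partial>M)"
    unfolding L2_sq_def
  proof (rule nn_integral_mono)
    fix x
    have "ennreal ((norm (f x + g x))\<^sup>2) \<le> ennreal (2 * (norm (f x))\<^sup>2 + 2 * (norm (g x))\<^sup>2)"
      by (intro ennreal_leI norm_add_sq_le)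
    then show "ennreal ((norm (f x + g x))\<^sup>2) \<le> 2 * ennreal ((norm (f x))\<^sup>2) + 2 * ennreal ((norm (g x))\<^sup>2)"
      by (simp add: ennreal_plus ennreal_mult)
  qed
  also have "\<dots> = 2 * L2_sq M f + 2 * L2_sq M g"
    unfolding L2_sq_def by (subst nn_integral_add) (auto simp: nn_integral_cmult)
  finally show ?thesis .
qed

lemma L2_sq_uminus: "L2_sq M (\<lambda>x. - f x) = L2_sq M f"
  by (simp add: L2_sq_def)

lemma L2_sq_minus_commute: "L2_sq M (\<lambda>x. f x - g x) = L2_sq M (\<lambda>x. g x - f x)"
  by (simp add: L2_sq_def norm_minus_commute)

lemma L2_sq_diff_le:
  assumes [measurable]: "f \<in> borel_measurable M" "g \<in> borel_measurable M"
  shows "L2_sq M (\<lambda>x. f x - g x) \<le> 2 * L2_sq M f + 2 * L2_sq M g"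
  using L2_sq_add_le[of f M "\<lambda>x. - g x"] by (simp add: L2_sq_uminus)

lemma L2_diff: "f \<in> L2 M \<Longrightarrow> g \<in> L2 M \<Longrightarrow> (\<lambda>x. f x - g x) \<in> L2 M"
  unfolding L2_def using L2_sq_diff_le[of f M g]
  by (auto intro: le_less_trans simp: ennreal_mult_less_top)

lemma L2_mono: "f \<in> L2 M \<Longrightarrow> g \<in> borel_measurable M \<Longrightarrow> AE x in M. norm (g x) \<le> norm (f x) \<Longrightarrow> g \<in> L2 M"
  unfolding L2_def using L2_sq_mono_AE[where M=M and f=g and g=f] by auto

lemma L2_sq_zero_iff:
  assumes [measurable]: "f \<in> borel_measurable M"
  shows "L2_sq M f = 0 \<longleftrightarrow> (AE x in M. f x = 0)"
  unfolding L2_sq_def by (subst nn_integral_0_iff_AE) (auto simp: ennreal_eq_0_iff)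

lemma L2_integrable_norm_sq: "f \<in> L2 M \<Longrightarrow> integrable M (\<lambda>x. (norm (f x))\<^sup>2)"
  by (rule integrableI_nonneg) (auto simp: L2_def L2_sq_def)

lemma L2_integrable_inner:
  assumes f: "f \<in> L2 M" and g: "g \<in> L2 M"
  shows "integrable M (\<lambda>x. f x \<bullet> g x)"
proof (rule Bochner_Integration.integrable_bound)
  have [measurable]: "f \<in> borel_measurable M" "g \<in> borel_measurable M" using f g by (auto simp: L2_def)
  show "integrable M (\<lambda>x. (norm (f x))\<^sup>2 + (norm (g x))\<^sup>2)"
    using f g by (intro Bochner_Integration.integrable_add L2_integrable_norm_sq)
  show "(\<lambda>x. f x \<bullet> g x) \<in> borel_measurable M" by measurable
  show "AE x in M. norm (f x \<bullet> g x) \<le> norm ((norm (f x))\<^sup>2 + (norm (g x))\<^sup>2)"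
  proof (rule AE_I2)
    fix x
    have "\<bar>f x \<bullet> g x\<bar> \<le> norm (f x) * norm (g x)" by (rule Cauchy_Schwarz_ineq2)
    also have "\<dots> \<le> (norm (f x))\<^sup>2 + (norm (g x))\<^sup>2"
    proof -
      have "2 * (norm (f x) * norm (g x)) \<le> (norm (f x))\<^sup>2 + (norm (g x))\<^sup>2"
        using sum_squares_bound[of "norm (f x)" "norm (g x)"] by (simp add: mult.assoc)
      moreover have "0 \<le> norm (f x) * norm (g x)" by simp
      ultimately show ?thesis by linarith
    qed
    finally show "norm (f x \<bullet> g x) \<le> norm ((norm (f x))\<^sup>2 + (norm (g x))\<^sup>2)" by simp
  qed
qed

text \<open>By Young's inequality \<open>2 \<bar>d \<bullet> g\<bar> \<le> s \<bar>d\<bar>\<^sup>2 + \<bar>g\<bar>\<^sup>2 / s\<close> with \<open>d = f n - f'\<close>. First \<open>s\<close> is taken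
so large that the second term is small, then \<open>n\<close>.\<close>

lemma L2_inner_tendsto:
  assumes f: "\<And>n. f n \<in> L2 M" "f' \<in> L2 M" and g: "g \<in> L2 M"
    and lim: "(\<lambda>n. L2_sq M (\<lambda>x. f n x - f' x)) \<longlonglongrightarrow> 0"
  shows "(\<lambda>n. LINT x|M. f n x \<bullet> g x) \<longlonglongrightarrow> (LINT x|M. f' x \<bullet> g x)"
proof (rule LIMSEQ_I)
  fix r :: real assume r: "0 < r"
  define c where "c = (LINT x|M. (norm (g x))\<^sup>2)"
  have c0: "0 \<le> c" by (simp add: c_def)
  define s where "s = (c + 1) / r"
  have s0: "0 < s" using c0 r by (simp add: s_def)
  have "\<forall>\<^sub>F n in sequentially. L2_sq M (\<lambda>x. f n x - f' x) < ennreal (r / s)"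
    using lim r s0 by (intro order_tendstoD(2)[of _ 0]) auto
  then obtain N where N: "\<And>n. n \<ge> N \<Longrightarrow> L2_sq M (\<lambda>x. f n x - f' x) < ennreal (r / s)"
    by (auto simp: eventually_sequentially)
  have "norm ((LINT x|M. f n x \<bullet> g x) - (LINT x|M. f' x \<bullet> g x)) < r" if n: "n \<ge> N" for n
  proof -
    define d where "d x = f n x - f' x" for x
    have d: "d \<in> L2 M" unfolding d_def by (rule L2_diff[OF f])
    note int_d = L2_integrable_norm_sq[OF d] and int_g = L2_integrable_norm_sq[OF g]
    have "ennreal (LINT x|M. (norm (d x))\<^sup>2) = L2_sq M d"
      unfolding L2_sq_def by (rule nn_integral_eq_integral[symmetric]) (use int_d in auto)
    also have "\<dots> < ennreal (r / s)" using N[OF n] by (simp only: d_def[abs_def])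
    finally have dN: "(LINT x|M. (norm (d x))\<^sup>2) < r / s"
      by (subst (asm) ennreal_less_iff) auto
    have "(LINT x|M. f n x \<bullet> g x) - (LINT x|M. f' x \<bullet> g x) = (LINT x|M. d x \<bullet> g x)"
      unfolding d_def inner_diff_left
      by (rule Bochner_Integration.integral_diff[symmetric]) (intro L2_integrable_inner f g)+
    also have "norm \<dots> \<le> (LINT x|M. norm (d x \<bullet> g x))" by (rule integral_norm_bound)
    also have "\<dots> \<le> (LINT x|M. (s * (norm (d x))\<^sup>2 + (norm (g x))\<^sup>2 / s) / 2)"
    proof (rule integral_mono)
      show "integrable M (\<lambda>x. norm (d x \<bullet> g x))" using L2_integrable_inner[OF d g] by (rule integrable_norm)
      show "integrable M (\<lambda>x. (s * (norm (d x))\<^sup>2 + (norm (g x))\<^sup>2 / s) / 2)"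
        using int_d int_g by auto
      fix x
      have "norm (d x \<bullet> g x) \<le> norm (d x) * norm (g x)" using Cauchy_Schwarz_ineq2 by simp
      moreover have "2 * (norm (d x) * norm (g x)) \<le> s * (norm (d x))\<^sup>2 + (norm (g x))\<^sup>2 / s"
      proof -
        have "0 \<le> (s * norm (d x) - norm (g x))\<^sup>2 / s" using s0 by simp
        also have "\<dots> = s * (norm (d x))\<^sup>2 + (norm (g x))\<^sup>2 / s - 2 * (norm (d x) * norm (g x))"
          using s0 by (simp add: power2_eq_square field_simps)
        finally show ?thesis by simp
      qed
      ultimately show "norm (d x \<bullet> g x) \<le> (s * (norm (d x))\<^sup>2 + (norm (g x))\<^sup>2 / s) / 2" by simp
    qed
    also have "\<dots> = (s * (LINT x|M. (norm (d x))\<^sup>2) + c / s) / 2"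
      using int_d int_g by (simp add: c_def)
    also have "\<dots> < (r + r) / 2"
    proof -
      have "s * (LINT x|M. (norm (d x))\<^sup>2) < r" using dN s0 by (simp add: field_simps)
      moreover have "c / s \<le> r" using c0 r by (simp add: s_def field_simps)
      ultimately show ?thesis by simp
    qed
    finally show ?thesis by simp
  qed
  then show "\<exists>no. \<forall>n\<ge>no. norm ((LINT x|M. f n x \<bullet> g x) - (LINT x|M. f' x \<bullet> g x)) < r" by blast
qed

section \<open>Classical and weak gradients\<close>

text \<open>The Jacobian matrix, with the row convention of \<open>has_weak_gradient\<close>.\<close>

definition classical_grad :: "(real^'d \<Rightarrow> real^'m) \<Rightarrow> real^'d \<Rightarrow> real^'d^'m" where
  "classical_grad p x = (\<chi> i j. frechet_derivative p (at x) (axis j 1) $ i)"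

lemma C1_has_derivative:
  assumes "Ck_on 1 p UNIV"
  shows "(p has_derivative (\<lambda>v. classical_grad p x *v v)) (at x)"
proof -
  have D: "(p has_derivative frechet_derivative p (at x)) (at x)"
    using assms by (simp add: frechet_derivative_works[symmetric])
  have lin: "linear (frechet_derivative p (at x))" using D by (rule has_derivative_linear)
  have "frechet_derivative p (at x) v = classical_grad p x *v v" for v
  proof -
    have "matrix (frechet_derivative p (at x)) = classical_grad p x"
      by (simp add: matrix_def classical_grad_def)
    then show ?thesis using fun_cong[OF matrix_vector_mul(2)[OF lin], of v] by simp
  qed
  then have "frechet_derivative p (at x) = (\<lambda>v. classical_grad p x *v v)" by (rule ext)
  then show ?thesis using D by simp
qed

lemma C1_continuous: "Ck_on 1 p UNIV \<Longrightarrow> continuous_on UNIV p"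
  using Ck_on_SucD[of 0 p UNIV] by simp

lemma C1_continuous_grad:
  assumes "Ck_on 1 p UNIV"
  shows "continuous_on UNIV (classical_grad p)"
proof -
  have "continuous_on UNIV (\<lambda>x. frechet_derivative p (at x) (axis j 1) $ i)" for i j
    using assms by (intro continuous_on_component) (auto simp: axis_in_Basis_iff)
  then show ?thesis unfolding classical_grad_def[abs_def] by (intro continuous_on_vec_lambda)
qed

text \<open>The derivative is prescribed as a matrix field; this is the form in which derivatives of composite
functions are computed below.\<close>

lemma C1_I:
  assumes D: "\<And>x. (p has_derivative (\<lambda>v. G x *v v)) (at x)" and G: "continuous_on UNIV G"
  shows "Ck_on 1 p UNIV" and "classical_grad p = G"
proof -
  have fd: "frechet_derivative p (at x) = (\<lambda>v. G x *v v)" for x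
    by (rule frechet_derivative_at[OF D, symmetric])
  have "continuous_on UNIV (\<lambda>x. G x *v e)" for e
    unfolding matrix_vector_mult_def
    by (intro continuous_on_vec_lambda continuous_on_sum continuous_on_mult continuous_on_component continuous_on_const G)
  then show "Ck_on 1 p UNIV" using D by (auto simp: fd differentiable_def)
  show "classical_grad p = G"
    by (auto simp: classical_grad_def fd vec_eq_iff matrix_vector_mult_basis column_def)
qed

text \<open>The difference quotients of \<open>F\<close> have integral zero because Lebesgue measure is translation
invariant. By the mean value theorem they are bounded uniformly, and they vanish outside a fixed
compact set, so dominated convergence applies.\<close>

lemma integral_directional_derivative_zero:
  fixes F F' :: "real^'d \<Rightarrow> real"
  assumes K: "compact K" and F0: "\<And>x. x \<notin> K \<Longrightarrow> F x = 0" and F'0: "\<And>x. x \<notin> K \<Longrightarrow> F' x = 0"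
    and contF: "continuous_on UNIV F" and contF': "continuous_on UNIV F'"
    and D: "\<And>x t. ((\<lambda>t. F (x + t *\<^sub>R e)) has_real_derivative F' (x + t *\<^sub>R e)) (at t)"
  shows "integrable lborel F'" and "(LINT x|lborel. F' x) = 0"
proof -
  have [measurable]: "F \<in> borel_measurable borel" "F' \<in> borel_measurable borel"
    using contF contF' by (auto intro: borel_measurable_continuous_onI)
  have restr: "integrable lborel H" if "continuous_on UNIV H" "\<And>x. x \<notin> K \<Longrightarrow> H x = 0" for H :: "real^'d \<Rightarrow> real"
  proof -
    have "integrable lborel (\<lambda>x. indicator K x *\<^sub>R H x)"
      by (rule borel_integrable_compact[OF K continuous_on_subset[OF that(1)]]) simp
    moreover have "(\<lambda>x. indicator K x *\<^sub>R H x) = H" using that(2) by (auto simp: fun_eq_iff indicator_def)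
    ultimately show ?thesis by simp
  qed
  show "integrable lborel F'" by (rule restr[OF contF' F'0])
  have Fi: "integrable lborel F" by (rule restr[OF contF F0])
  have "bounded (F' ` K)" by (intro compact_imp_bounded compact_continuous_image continuous_on_subset[OF contF'] K) auto
  then obtain B where B: "\<And>x. x \<in> K \<Longrightarrow> norm (F' x) \<le> B" unfolding bounded_iff by blast
  define B' where "B' = max B 0"
  have B': "norm (F' x) \<le> B'" for x using B[of x] F'0[of x] by (cases "x \<in> K") (auto simp: B'_def)
  define q where "q n x = real (Suc n) * (F (x + inverse (real (Suc n)) *\<^sub>R e) - F x)" for n x
  \<comment> \<open>All points from which a step of length at most one in direction \<open>e\<close> reaches \<open>K\<close>.\<close>
  define K' where "K' = (\<lambda>(k, t). k - t *\<^sub>R e) ` (K \<times> {0..1})"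
  have K': "compact K'" unfolding K'_def
    by (intro compact_continuous_image compact_Times K compact_Icc) (auto intro!: continuous_intros simp: case_prod_beta)
  have q_bound: "norm (q n x) \<le> norm (indicat_real K' x * B')" for n x
  proof (cases "x \<in> K'")
    case True
    let ?h = "inverse (real (Suc n))"
    have h: "0 < ?h" by simp
    obtain z where z: "0 < z" "z < ?h" "F (x + ?h *\<^sub>R e) - F (x + 0 *\<^sub>R e) = (?h - 0) * F' (x + z *\<^sub>R e)"
      using MVT2[OF h, of "\<lambda>t. F (x + t *\<^sub>R e)" "\<lambda>t. F' (x + t *\<^sub>R e)"] D by blast
    then have "q n x = F' (x + z *\<^sub>R e)" by (simp add: q_def field_simps)
    then show ?thesis using B' True by (simp add: B'_def)
  next
    case False
    have "F (x + t *\<^sub>R e) = 0" if "t \<in> {0..1}" for t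
    proof (rule F0)
      show "x + t *\<^sub>R e \<notin> K" using False that by (force simp: K'_def image_iff)
    qed
    from this[of 0] this[of "inverse (real (Suc n))"] show ?thesis
      by (simp add: q_def field_simps)
  qed
  have "(\<lambda>n. LINT x|lborel. q n x) \<longlonglongrightarrow> (LINT x|lborel. F' x)"
  proof (rule integral_dominated_convergence[where w="\<lambda>x. indicat_real K' x * B'"])
    show "integrable lborel (\<lambda>x. indicat_real K' x * B')"
      using K' emeasure_compact_finite[OF K'] by (intro integrable_mult_left integrable_real_indicator) (auto simp: borel_compact)
    show "AE x in lborel. (\<lambda>n. q n x) \<longlonglongrightarrow> F' x"
    proof (rule AE_I2)
      fix x
      have "((\<lambda>h. (F (x + h *\<^sub>R e) - F x) / h) \<longlongrightarrow> F' x) (at 0)"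
        using D[of x 0] by (simp add: DERIV_def)
      moreover have "filterlim (\<lambda>n. inverse (real (Suc n))) (at 0) sequentially"
        using LIMSEQ_inverse_real_of_nat by (auto simp: filterlim_at)
      ultimately have "(\<lambda>n. (F (x + inverse (real (Suc n)) *\<^sub>R e) - F x) / inverse (real (Suc n))) \<longlonglongrightarrow> F' x"
        by (rule filterlim_compose)
      then show "(\<lambda>n. q n x) \<longlonglongrightarrow> F' x" by (simp add: q_def divide_inverse mult.commute)
    qed
    show "AE x in lborel. norm (q n x) \<le> indicat_real K' x * B'" for n
      using q_bound[of n] by (auto simp: B'_def)
    show "F' \<in> borel_measurable lborel" by simp
    show "q n \<in> borel_measurable lborel" for n unfolding q_def by measurable
  qed
  moreover have "(LINT x|lborel. q n x) = 0" for n
  proof -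
    let ?a = "inverse (real (Suc n)) *\<^sub>R e"
    have "integrable (distr lborel borel ((+) ?a)) F" using Fi by (simp add: lborel_distr_plus)
    then have i1: "integrable lborel (\<lambda>x. F (?a + x))" by (subst (asm) integrable_distr_eq) auto
    have "(LINT x|lborel. F (?a + x)) = (LINT x|distr lborel borel ((+) ?a). F x)"
      by (subst integral_distr) auto
    also have "\<dots> = (LINT x|lborel. F x)" by (simp add: lborel_distr_plus)
    finally show ?thesis unfolding q_def using i1 Fi by (simp add: add.commute)
  qed
  ultimately show "(LINT x|lborel. F' x) = 0" by (simp add: LIMSEQ_const_iff)
qed

lemma test_function_C1: "\<psi> \<in> test_functions \<Omega> \<Longrightarrow> Ck_on 1 \<psi> UNIV"
  unfolding test_functions_def Cinf_on_def by blast

lemma test_function_outside: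
  assumes psi: "\<psi> \<in> test_functions \<Omega>" and x: "x \<notin> closure {x. \<psi> x \<noteq> 0}"
  shows "\<psi> x = 0" and "frechet_derivative \<psi> (at x) = (\<lambda>v. 0)"
proof -
  show "\<psi> x = 0" using x closure_subset[of "{x. \<psi> x \<noteq> 0}"] by blast
  have "(\<psi> has_derivative (\<lambda>v. 0)) (at x)"
    by (rule has_derivative_transform_within_open[of "\<lambda>x. 0" _ _ _ "- closure {x. \<psi> x \<noteq> 0}"])
       (use x closure_subset[of "{x. \<psi> x \<noteq> 0}"] in auto)
  then show "frechet_derivative \<psi> (at x) = (\<lambda>v. 0)" by (rule frechet_derivative_at[symmetric])
qed

lemma integral_lebesgue_on_eq_lborel:
  fixes h :: "'a::euclidean_space \<Rightarrow> real"
  assumes "S \<in> sets lebesgue" "h \<in> borel_measurable borel" "\<And>x. x \<notin> S \<Longrightarrow> h x = 0"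
  shows "(LINT x|lebesgue_on S. h x) = (LINT x|lborel. h x)"
proof -
  have "(LINT x|lebesgue_on S. h x) = (LINT x|lebesgue. indicator S x *\<^sub>R h x)"
    using assms by (intro integral_restrict_space) auto
  also have "(\<lambda>x. indicator S x *\<^sub>R h x) = h" using assms(3) by (auto simp: fun_eq_iff indicator_def)
  also have "(LINT x|lebesgue. h x) = (LINT x|lborel. h x)"
    using assms by (intro integral_completion) auto
  finally show ?thesis .
qed

text \<open>Integration by parts: the preceding lemma is applied to the product of a component of \<open>p\<close> with a
test function.\<close>

lemma weak_gradient_classical:
  fixes p :: "real^'d \<Rightarrow> real^'m"
  assumes "open \<Omega>" and p: "Ck_on 1 p UNIV"
  shows "has_weak_gradient \<Omega> p (classical_grad p)"
  unfolding has_weak_gradient_def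
proof (intro ballI allI)
  fix \<psi> :: "real^'d \<Rightarrow> real" and i :: 'm and j :: 'd
  assume psi: "\<psi> \<in> test_functions \<Omega>"
  let ?e = "axis j 1 :: real^'d"
  let ?K = "closure {x. \<psi> x \<noteq> 0}"
  have K: "compact ?K" "?K \<subseteq> \<Omega>" using psi by (auto simp: test_functions_def)
  have out: "\<psi> x = 0" "frechet_derivative \<psi> (at x) ?e = 0" if "x \<notin> ?K" for x
    using test_function_outside[OF psi that] by auto
  define d\<psi> where "d\<psi> x = frechet_derivative \<psi> (at x) ?e" for x
  have contd: "continuous_on UNIV d\<psi>" "continuous_on UNIV \<psi>"
    using test_function_C1[OF psi] by (auto simp: d\<psi>_def axis_in_Basis_iff intro: continuous_at_imp_continuous_on differentiable_imp_continuous_within)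
  have contp: "continuous_on UNIV (\<lambda>x. p x $ i)" "continuous_on UNIV (\<lambda>x. classical_grad p x $ i $ j)"
    by (intro continuous_on_component C1_continuous C1_continuous_grad p)+
  define h1 where "h1 x = p x $ i * d\<psi> x" for x
  define h2 where "h2 x = classical_grad p x $ i $ j * \<psi> x" for x
  have cont: "continuous_on UNIV h1" "continuous_on UNIV h2"
    unfolding h1_def h2_def by (intro continuous_intros contd contp)+
  have h0: "h1 x = 0" "h2 x = 0" if "x \<notin> ?K" for x using out[OF that] by (auto simp: h1_def h2_def d\<psi>_def)
  have D: "((\<lambda>t. p (x + t *\<^sub>R ?e) $ i * \<psi> (x + t *\<^sub>R ?e)) has_real_derivative h1 (x + t *\<^sub>R ?e) + h2 (x + t *\<^sub>R ?e)) (at t)" for x t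
  proof -
    let ?y = "x + t *\<^sub>R ?e"
    have line: "((\<lambda>t. x + t *\<^sub>R ?e) has_derivative (\<lambda>s. s *\<^sub>R ?e)) (at t)"
      by (auto intro!: derivative_eq_intros)
    have "((\<lambda>y. p y $ i) has_derivative (\<lambda>v. (classical_grad p ?y *v v) $ i)) (at ?y)"
      by (intro bounded_linear.has_derivative[OF bounded_linear_vec_nth] C1_has_derivative p)
    from has_derivative_compose[OF line this]
    have 1: "((\<lambda>t. p (x + t *\<^sub>R ?e) $ i) has_real_derivative classical_grad p ?y $ i $ j) (at t)"
      by (simp add: has_field_derivative_def matrix_vector_mult_scaleR matrix_vector_mult_basis column_def mult.commute[of _ "classical_grad p ?y $ i $ j"])
    have psid: "(\<psi> has_derivative frechet_derivative \<psi> (at ?y)) (at ?y)"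
      using test_function_C1[OF psi] by (simp add: frechet_derivative_works[symmetric])
    have "frechet_derivative \<psi> (at ?y) (s *\<^sub>R ?e) = d\<psi> ?y * s" for s
      using linear_scale[OF has_derivative_linear[OF psid]] by (simp add: d\<psi>_def)
    then have 2: "((\<lambda>t. \<psi> (x + t *\<^sub>R ?e)) has_real_derivative d\<psi> ?y) (at t)"
      using has_derivative_compose[OF line psid] by (simp add: has_field_derivative_def)
    show ?thesis using DERIV_mult[OF 1 2] by (simp add: h1_def h2_def add.commute mult.commute)
  qed
  note zero = integral_directional_derivative_zero[OF K(1), where F="\<lambda>x. p x $ i * \<psi> x" and F'="\<lambda>x. h1 x + h2 x" and e="?e"]
  have int: "integrable lborel h" if "continuous_on UNIV h" "\<And>x. x \<notin> ?K \<Longrightarrow> h x = 0" for h :: "real^'d \<Rightarrow> real"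
  proof -
    have "integrable lborel (\<lambda>x. indicator ?K x *\<^sub>R h x)"
      by (rule borel_integrable_compact[OF K(1) continuous_on_subset[OF that(1)]]) simp
    moreover have "(\<lambda>x. indicator ?K x *\<^sub>R h x) = h" using that(2) by (auto simp: fun_eq_iff indicator_def)
    ultimately show ?thesis by simp
  qed
  have "(LINT x|lborel. h1 x + h2 x) = 0"
  proof (rule zero(2))
    show "p x $ i * \<psi> x = 0" "h1 x + h2 x = 0" if "x \<notin> ?K" for x using out(1)[OF that] h0[OF that] by simp_all
    show "continuous_on UNIV (\<lambda>x. p x $ i * \<psi> x)" by (rule continuous_on_mult[OF contp(1) contd(2)])
    show "continuous_on UNIV (\<lambda>x. h1 x + h2 x)" by (rule continuous_on_add[OF cont])
  qed (rule D)
  then have "(LINT x|lborel. h1 x) + (LINT x|lborel. h2 x) = 0"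
    using int[OF cont(1) h0(1)] int[OF cont(2) h0(2)] by simp
  moreover have "(LINT x|lebesgue_on \<Omega>. h x) = (LINT x|lborel. h x)"
    if "continuous_on UNIV h" "\<And>x. x \<notin> ?K \<Longrightarrow> h x = 0" for h :: "real^'d \<Rightarrow> real"
    using that K(2) \<open>open \<Omega>\<close> by (intro integral_lebesgue_on_eq_lborel borel_measurable_continuous_onI) auto
  ultimately have "(LINT x|lebesgue_on \<Omega>. h1 x) = - (LINT x|lebesgue_on \<Omega>. h2 x)"
    using cont h0 by simp
  then show "(LINT x|lebesgue_on \<Omega>. p x $ i * frechet_derivative \<psi> (at x) ?e) = - (LINT x|lebesgue_on \<Omega>. classical_grad p x $ i $ j * \<psi> x)"
    by (simp add: h1_def h2_def d\<psi>_def)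
qed

lemma continuous_measurable_lebesgue_on:
  fixes f :: "'a::euclidean_space \<Rightarrow> 'b::euclidean_space"
  shows "continuous_on UNIV f \<Longrightarrow> f \<in> borel_measurable (lebesgue_on S)"
  by (intro measurable_restrict_space1 measurable_completion) (simp add: borel_measurable_continuous_onI)

lemma nn_integral_lebesgue_on:
  "S \<in> sets lebesgue \<Longrightarrow> (\<integral>\<^sup>+x. f x \<partial>lebesgue_on S) = (\<integral>\<^sup>+x. f x * indicator S x \<partial>lborel)"
  by (simp add: nn_integral_restrict_space nn_integral_completion)

text \<open>A common roof for square integrable fields and for continuous ones. The latter are needed to
identify the gradient of a \<open>C\<^sup>1\<close> function in \<open>H1 \<Omega>\<close> before it is known to be square integrable.\<close>

definition locally_integrable :: "'a::euclidean_space set \<Rightarrow> ('a \<Rightarrow> real) \<Rightarrow> bool" where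
  "locally_integrable \<Omega> f \<longleftrightarrow> (\<forall>K. compact K \<longrightarrow> K \<subseteq> \<Omega> \<longrightarrow> set_integrable lebesgue K f)"

lemma locally_integrable_diff:
  "locally_integrable \<Omega> f \<Longrightarrow> locally_integrable \<Omega> g \<Longrightarrow> locally_integrable \<Omega> (\<lambda>x. f x - g x)"
  by (auto simp: locally_integrable_def)

lemma continuous_locally_integrable:
  fixes f :: "'a::euclidean_space \<Rightarrow> real"
  shows "continuous_on UNIV f \<Longrightarrow> locally_integrable \<Omega> f"
  unfolding locally_integrable_def set_integrable_def
proof (intro allI impI)
  fix K :: "'a set" assume f: "continuous_on UNIV f" and K: "compact K"
  have i: "integrable lborel (\<lambda>x. indicat_real K x *\<^sub>R f x)"
    by (rule borel_integrable_compact[OF K continuous_on_subset[OF f]]) simp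
  show "integrable lebesgue (\<lambda>x. indicat_real K x *\<^sub>R f x)"
    using i by (subst integrable_completion[OF borel_measurable_integrable[OF i]])
qed

lemma L2_component: "u \<in> L2 M \<Longrightarrow> (\<lambda>x. u x $ i) \<in> L2 M"
proof (rule L2_mono[of u])
  assume "u \<in> L2 M"
  then have "u \<in> borel_measurable M" by (simp add: L2_def)
  then show "(\<lambda>x. u x $ i) \<in> borel_measurable M"
    by (rule measurable_compose) (rule borel_measurable_continuous_onI[OF continuous_on_component[OF continuous_on_id]])
qed (auto simp: Finite_Cartesian_Product.norm_nth_le)

lemma L2_indicator_compact:
  assumes "S \<in> sets lebesgue" "compact K"
  shows "indicat_real K \<in> L2 (lebesgue_on S)"
proof -
  have "L2_sq (lebesgue_on S) (indicat_real K) = (\<integral>\<^sup>+x. ennreal ((norm (indicat_real K x))\<^sup>2) * indicator S x \<partial>lborel)"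
    unfolding L2_sq_def by (rule nn_integral_lebesgue_on[OF assms(1)])
  also have "\<dots> \<le> (\<integral>\<^sup>+x. indicator K x \<partial>lborel)"
    by (intro nn_integral_mono) (auto simp: indicator_def)
  also have "\<dots> < \<infinity>" using emeasure_compact_finite[OF assms(2)] assms(2) by (simp add: borel_compact)
  finally show ?thesis using assms(2)
    unfolding L2_def by (auto intro!: borel_measurable_indicator measurable_restrict_space1 simp: borel_compact)
qed

lemma L2_locally_integrable:
  fixes f :: "'a::euclidean_space \<Rightarrow> real"
  assumes "\<Omega> \<in> sets lebesgue" and f: "f \<in> L2 (lebesgue_on \<Omega>)"
  shows "locally_integrable \<Omega> f"
  unfolding locally_integrable_def set_integrable_def
proof (intro allI impI)
  fix K assume K: "compact K" "K \<subseteq> \<Omega>"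
  have "integrable (lebesgue_on \<Omega>) (\<lambda>x. indicat_real K x \<bullet> f x)"
    by (intro L2_integrable_inner L2_indicator_compact f assms K)
  then have "integrable lebesgue (\<lambda>x. indicat_real \<Omega> x *\<^sub>R (indicat_real K x \<bullet> f x))"
    using assms(1) by (subst (asm) integrable_restrict_space) auto
  moreover have "indicat_real \<Omega> x *\<^sub>R (indicat_real K x \<bullet> f x) = indicat_real K x *\<^sub>R f x" for x
    using K(2) by (auto simp: indicator_def)
  ultimately show "integrable lebesgue (\<lambda>x. indicat_real K x *\<^sub>R f x)" by (simp only:)
qed

lemma locally_integrable_mult_test:
  fixes f :: "'a::euclidean_space \<Rightarrow> real"
  assumes "\<Omega> \<in> sets lebesgue" "locally_integrable \<Omega> f" and psi: "\<psi> \<in> test_functions \<Omega>"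
  shows "integrable (lebesgue_on \<Omega>) (\<lambda>x. f x * \<psi> x)"
proof -
  let ?K = "closure {x. \<psi> x \<noteq> 0}"
  have K: "compact ?K" "?K \<subseteq> \<Omega>" using psi by (auto simp: test_functions_def)
  have cont: "continuous_on UNIV \<psi>"
    using Ck_on_SucD[of 0 \<psi> UNIV] test_function_C1[OF psi] by simp
  have "bounded (\<psi> ` ?K)"
    by (intro compact_imp_bounded compact_continuous_image continuous_on_subset[OF cont] K) auto
  then obtain B where B: "\<And>x. x \<in> ?K \<Longrightarrow> norm (\<psi> x) \<le> B" unfolding bounded_iff by blast
  have fi: "integrable lebesgue (\<lambda>x. indicat_real ?K x *\<^sub>R f x)"
    using assms(2) K by (auto simp: locally_integrable_def set_integrable_def)
  have "integrable lebesgue (\<lambda>x. (indicat_real ?K x *\<^sub>R f x) * \<psi> x)"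
  proof (rule Bochner_Integration.integrable_bound)
    show "integrable lebesgue (\<lambda>x. B * (indicat_real ?K x *\<^sub>R f x))" using fi by (rule integrable_mult_right)
    show "(\<lambda>x. (indicat_real ?K x *\<^sub>R f x) * \<psi> x) \<in> borel_measurable lebesgue"
    proof (rule borel_measurable_times[OF borel_measurable_integrable[OF fi]])
      show "\<psi> \<in> borel_measurable lebesgue"
        using cont by (intro measurable_completion) (simp add: borel_measurable_continuous_onI)
    qed
    show "AE x in lebesgue. norm ((indicat_real ?K x *\<^sub>R f x) * \<psi> x) \<le> norm (B * (indicat_real ?K x *\<^sub>R f x))"
    proof (rule AE_I2)
      fix x
      show "norm ((indicat_real ?K x *\<^sub>R f x) * \<psi> x) \<le> norm (B * (indicat_real ?K x *\<^sub>R f x))"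
      proof (cases "x \<in> ?K")
        case True
        have "\<bar>f x\<bar> * \<bar>\<psi> x\<bar> \<le> \<bar>f x\<bar> * \<bar>B\<bar>" using B[OF True] by (intro mult_left_mono) auto
        then show ?thesis using True by (simp add: abs_mult mult.commute)
      qed simp
    qed
  qed
  moreover have "(indicat_real ?K x *\<^sub>R f x) * \<psi> x = indicat_real \<Omega> x *\<^sub>R (f x * \<psi> x)" for x
    using K(2) test_function_outside(1)[OF psi, of x] by (cases "x \<in> ?K") (auto simp: indicator_def)
  ultimately have "integrable lebesgue (\<lambda>x. indicat_real \<Omega> x *\<^sub>R (f x * \<psi> x))" by (simp only:)
  then show ?thesis using assms(1) by (subst integrable_restrict_space) auto
qed

lemma weak_gradient_unique:
  fixes u :: "real^'d \<Rightarrow> real^'m"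
  assumes "open \<Omega>" and G: "has_weak_gradient \<Omega> u G" and H: "has_weak_gradient \<Omega> u H"
    and lG: "\<And>i j. locally_integrable \<Omega> (\<lambda>x. G x $ i $ j)" and lH: "\<And>i j. locally_integrable \<Omega> (\<lambda>x. H x $ i $ j)"
  shows "AE x in lebesgue_on \<Omega>. G x = H x"
proof -
  have m: "\<Omega> \<in> sets lebesgue" using \<open>open \<Omega>\<close> by auto
  have ij: "AE x in lebesgue_on \<Omega>. G x $ i $ j - H x $ i $ j = 0" for i j
  proof (rule fundamental_lemma_calculus_of_variations[OF \<open>open \<Omega>\<close>])
    show "set_integrable lebesgue (cbox a b) (\<lambda>x. G x $ i $ j - H x $ i $ j)" if "cbox a b \<subseteq> \<Omega>" for a b
      using locally_integrable_diff[OF lG lH, of i j i j] that by (auto simp: locally_integrable_def)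
    fix \<psi> :: "real^'d \<Rightarrow> real" assume psi: "\<psi> \<in> test_functions \<Omega>"
    have "(LINT x|lebesgue_on \<Omega>. G x $ i $ j * \<psi> x) = (LINT x|lebesgue_on \<Omega>. H x $ i $ j * \<psi> x)"
      using G[unfolded has_weak_gradient_def, rule_format, OF psi, of i j]
        H[unfolded has_weak_gradient_def, rule_format, OF psi, of i j] by linarith
    moreover have "(LINT x|lebesgue_on \<Omega>. (G x $ i $ j - H x $ i $ j) * \<psi> x) =
      (LINT x|lebesgue_on \<Omega>. G x $ i $ j * \<psi> x) - (LINT x|lebesgue_on \<Omega>. H x $ i $ j * \<psi> x)"
      unfolding left_diff_distrib
      by (intro Bochner_Integration.integral_diff locally_integrable_mult_test m lG lH psi)
    ultimately show "(LINT x|lebesgue_on \<Omega>. (G x $ i $ j - H x $ i $ j) * \<psi> x) = 0" by simp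
  qed
  have "AE x in lebesgue_on \<Omega>. \<forall>i\<in>UNIV. \<forall>j\<in>UNIV. G x $ i $ j - H x $ i $ j = 0"
    by (intro AE_finite_allI ij finite_class.finite_UNIV)
  then show ?thesis by eventually_elim (simp add: vec_eq_iff)
qed

lemma test_field_L2:
  fixes \<eta> :: "'a::euclidean_space \<Rightarrow> real" and e :: "'b::euclidean_space"
  assumes "S \<in> sets lebesgue" "compact K" "continuous_on UNIV \<eta>" "\<And>x. x \<notin> K \<Longrightarrow> \<eta> x = 0"
  shows "(\<lambda>x. \<eta> x *\<^sub>R e) \<in> L2 (lebesgue_on S)"
proof -
  have "bounded (\<eta> ` K)"
    by (intro compact_imp_bounded compact_continuous_image continuous_on_subset[OF assms(3)] assms) auto
  then obtain B where B: "\<And>x. x \<in> K \<Longrightarrow> norm (\<eta> x) \<le> B" unfolding bounded_iff by blast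
  have "(\<lambda>x. B * norm e * indicat_real K x) \<in> L2 (lebesgue_on S)"
  proof -
    have "indicat_real K \<in> L2 (lebesgue_on S)" by (rule L2_indicator_compact[OF assms(1,2)])
    then have "L2_sq (lebesgue_on S) (\<lambda>x. B * norm e * indicat_real K x) < \<infinity>" 
      unfolding L2_def L2_sq_def norm_mult power_mult_distrib
      by (subst ennreal_mult) (auto simp: nn_integral_cmult ennreal_mult_less_top)
    then show ?thesis using \<open>indicat_real K \<in> L2 (lebesgue_on S)\<close> by (auto simp: L2_def)
  qed
  moreover have "(\<lambda>x. \<eta> x *\<^sub>R e) \<in> borel_measurable (lebesgue_on S)"
    by (intro continuous_measurable_lebesgue_on continuous_intros assms)
  moreover have "norm (\<eta> x *\<^sub>R e) \<le> norm (B * norm e * indicat_real K x)" for x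
  proof (cases "x \<in> K")
    case True
    have "\<bar>\<eta> x\<bar> \<le> \<bar>B\<bar>" using B[OF True] by simp
    then show ?thesis using True by (simp add: abs_mult mult_right_mono)
  qed (use assms(4) in simp)
  ultimately show ?thesis by (rule L2_mono[OF _ _ AE_I2])
qed

lemma test_functions_cont:
  assumes "\<psi> \<in> test_functions \<Omega>"
  shows "continuous_on UNIV (\<psi> :: real^'d \<Rightarrow> real)" and "continuous_on UNIV (\<lambda>x. frechet_derivative \<psi> (at x) (axis j 1))"
  using test_function_C1[OF assms] Ck_on_SucD[of 0 \<psi> UNIV] by auto

lemma test_function_L2:
  fixes \<psi> :: "real^'d \<Rightarrow> real" and e :: "'b::euclidean_space"
  assumes m: "\<Omega> \<in> sets lebesgue" and psi: "\<psi> \<in> test_functions \<Omega>"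
  shows "(\<lambda>x. \<psi> x *\<^sub>R e) \<in> L2 (lebesgue_on \<Omega>)"
    and "(\<lambda>x. frechet_derivative \<psi> (at x) (axis j 1) *\<^sub>R e) \<in> L2 (lebesgue_on \<Omega>)"
proof -
  have K: "compact (closure {x. \<psi> x \<noteq> 0})" using psi by (simp add: test_functions_def)
  show "(\<lambda>x. \<psi> x *\<^sub>R e) \<in> L2 (lebesgue_on \<Omega>)"
    by (rule test_field_L2[OF m K test_functions_cont(1)[OF psi] test_function_outside(1)[OF psi]])
  show "(\<lambda>x. frechet_derivative \<psi> (at x) (axis j 1) *\<^sub>R e) \<in> L2 (lebesgue_on \<Omega>)"
    by (rule test_field_L2[OF m K test_functions_cont(2)[OF psi]]) (simp add: test_function_outside(2)[OF psi])
qed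

text \<open>Both sides are inner products in \<open>L2\<close> with fixed fields, so that they pass to \<open>L2\<close> limits.\<close>

lemma has_weak_gradient_iff_inner:
  "has_weak_gradient \<Omega> u G \<longleftrightarrow> (\<forall>\<psi>\<in>(test_functions \<Omega> :: (real^'d \<Rightarrow> real) set). \<forall>i j.
     (LINT x|lebesgue_on \<Omega>. u x \<bullet> (frechet_derivative \<psi> (at x) (axis j 1) *\<^sub>R axis i 1)) =
     - (LINT x|lebesgue_on \<Omega>. G x \<bullet> (\<psi> x *\<^sub>R axis i (axis j 1))))"
  by (simp add: has_weak_gradient_def inner_axis mult.commute)

lemma weak_gradient_diff:
  fixes u v :: "real^'d \<Rightarrow> real^'m"
  assumes m: "\<Omega> \<in> sets lebesgue" and L: "u \<in> L2 (lebesgue_on \<Omega>)" "v \<in> L2 (lebesgue_on \<Omega>)" "G \<in> L2 (lebesgue_on \<Omega>)" "H \<in> L2 (lebesgue_on \<Omega>)"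
    and G: "has_weak_gradient \<Omega> u G" and H: "has_weak_gradient \<Omega> v H"
  shows "has_weak_gradient \<Omega> (\<lambda>x. u x - v x) (\<lambda>x. G x - H x)"
  unfolding has_weak_gradient_iff_inner inner_diff_left
  using G[unfolded has_weak_gradient_iff_inner] H[unfolded has_weak_gradient_iff_inner]
  by (simp add: Bochner_Integration.integral_diff L2_integrable_inner L test_function_L2[OF m] del: inner_scaleR_right)

lemma weak_gradient_limit:
  fixes u :: "real^'d \<Rightarrow> real^'m"
  assumes m: "\<Omega> \<in> sets lebesgue"
    and L: "\<And>n. p n \<in> L2 (lebesgue_on \<Omega>)" "u \<in> L2 (lebesgue_on \<Omega>)" "\<And>n. H n \<in> L2 (lebesgue_on \<Omega>)" "G \<in> L2 (lebesgue_on \<Omega>)"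
    and H: "\<And>n. has_weak_gradient \<Omega> (p n) (H n)"
    and lim: "(\<lambda>n. L2_sq (lebesgue_on \<Omega>) (\<lambda>x. p n x - u x)) \<longlonglongrightarrow> 0" "(\<lambda>n. L2_sq (lebesgue_on \<Omega>) (\<lambda>x. H n x - G x)) \<longlonglongrightarrow> 0"
  shows "has_weak_gradient \<Omega> u G"
  unfolding has_weak_gradient_iff_inner
proof (intro ballI allI)
  fix \<psi> :: "real^'d \<Rightarrow> real" and i :: 'm and j :: 'd
  assume psi: "\<psi> \<in> test_functions \<Omega>"
  let ?d = "\<lambda>x. frechet_derivative \<psi> (at x) (axis j 1) *\<^sub>R axis i (1::real)" and ?p = "\<lambda>x. \<psi> x *\<^sub>R axis i (axis j (1::real))"
  have "(\<lambda>n. LINT x|lebesgue_on \<Omega>. p n x \<bullet> ?d x) \<longlonglongrightarrow> (LINT x|lebesgue_on \<Omega>. u x \<bullet> ?d x)"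
    by (rule L2_inner_tendsto) (intro L lim test_function_L2 m psi)+
  moreover have "(\<lambda>n. - (LINT x|lebesgue_on \<Omega>. H n x \<bullet> ?p x)) \<longlonglongrightarrow> - (LINT x|lebesgue_on \<Omega>. G x \<bullet> ?p x)"
    by (rule tendsto_minus[OF L2_inner_tendsto]) (intro L lim test_function_L2 m psi)+
  moreover have "(LINT x|lebesgue_on \<Omega>. p n x \<bullet> ?d x) = - (LINT x|lebesgue_on \<Omega>. H n x \<bullet> ?p x)" for n
    using H[of n] psi unfolding has_weak_gradient_iff_inner by blast
  ultimately show "(LINT x|lebesgue_on \<Omega>. u x \<bullet> ?d x) = - (LINT x|lebesgue_on \<Omega>. G x \<bullet> ?p x)"
    by (intro LIMSEQ_unique) simp_all
qed

section \<open>H1 functions\<close>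

lemma weak_grad_H1:
  assumes "u \<in> H1 \<Omega>"
  shows "weak_grad \<Omega> u \<in> L2 (lebesgue_on \<Omega>)" and "has_weak_gradient \<Omega> u (weak_grad \<Omega> u)"
proof -
  have "\<exists>G. G \<in> L2 (lebesgue_on \<Omega>) \<and> has_weak_gradient \<Omega> u G" using assms by (auto simp: H1_def)
  from someI_ex[OF this] show "weak_grad \<Omega> u \<in> L2 (lebesgue_on \<Omega>)" "has_weak_gradient \<Omega> u (weak_grad \<Omega> u)"
    by (auto simp: weak_grad_def)
qed

lemma H1_I:
  assumes "open \<Omega>" and u: "u \<in> L2 (lebesgue_on \<Omega>)" "G \<in> L2 (lebesgue_on \<Omega>)" "has_weak_gradient \<Omega> u G"
  shows "u \<in> H1 \<Omega>" and "AE x in lebesgue_on \<Omega>. weak_grad \<Omega> u x = G x"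
proof -
  show H: "u \<in> H1 \<Omega>" using u by (auto simp: H1_def)
  have m: "\<Omega> \<in> sets lebesgue" using \<open>open \<Omega>\<close> by auto
  show "AE x in lebesgue_on \<Omega>. weak_grad \<Omega> u x = G x"
    by (rule weak_gradient_unique[OF \<open>open \<Omega>\<close> weak_grad_H1(2)[OF H] u(3)])
       (intro L2_locally_integrable[OF m] L2_component weak_grad_H1 H u)+
qed

lemma H1_sq_eq:
  assumes "open \<Omega>" "u \<in> L2 (lebesgue_on \<Omega>)" "G \<in> L2 (lebesgue_on \<Omega>)" "has_weak_gradient \<Omega> u G"
  shows "H1_sq \<Omega> u = L2_sq (lebesgue_on \<Omega>) u + L2_sq (lebesgue_on \<Omega>) G"
proof -
  have "L2_sq (lebesgue_on \<Omega>) (weak_grad \<Omega> u) = L2_sq (lebesgue_on \<Omega>) G"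
    by (rule L2_sq_cong_AE) (use H1_I(2)[OF assms] in eventually_elim, simp)
  then show ?thesis by (simp add: H1_sq_def)
qed

text \<open>Membership of \<open>p\<close> in \<open>H1 \<Omega>\<close> only provides some square integrable weak gradient; by uniqueness it
agrees with the classical one.\<close>

lemma C1_H1_iff:
  assumes "open \<Omega>" and p: "Ck_on 1 p UNIV"
  shows "p \<in> H1 \<Omega> \<longleftrightarrow> p \<in> L2 (lebesgue_on \<Omega>) \<and> classical_grad p \<in> L2 (lebesgue_on \<Omega>)"
proof
  note w = weak_gradient_classical[OF assms]
  assume H: "p \<in> H1 \<Omega>"
  have m: "\<Omega> \<in> sets lebesgue" using \<open>open \<Omega>\<close> by auto
  have "AE x in lebesgue_on \<Omega>. weak_grad \<Omega> p x = classical_grad p x"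
    by (rule weak_gradient_unique[OF \<open>open \<Omega>\<close> weak_grad_H1(2)[OF H] w])
       (intro L2_locally_integrable[OF m] L2_component weak_grad_H1 H continuous_locally_integrable continuous_on_component C1_continuous_grad p)+
  then have "AE x in lebesgue_on \<Omega>. norm (classical_grad p x) \<le> norm (weak_grad \<Omega> p x)"
    by eventually_elim simp
  then have "classical_grad p \<in> L2 (lebesgue_on \<Omega>)"
    by (intro L2_mono[OF weak_grad_H1(1)[OF H]] continuous_measurable_lebesgue_on C1_continuous_grad p)
  then show "p \<in> L2 (lebesgue_on \<Omega>) \<and> classical_grad p \<in> L2 (lebesgue_on \<Omega>)" using H by (auto simp: H1_def)
qed (use weak_gradient_classical[OF assms] in \<open>auto simp: H1_def\<close>)

lemma H1_sq_C1_diff: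
  assumes "open \<Omega>" and p: "Ck_on 1 p UNIV" "p \<in> H1 \<Omega>"
    and u: "u \<in> L2 (lebesgue_on \<Omega>)" "G \<in> L2 (lebesgue_on \<Omega>)" "has_weak_gradient \<Omega> u G"
  shows "H1_sq \<Omega> (p - u) = L2_sq (lebesgue_on \<Omega>) (\<lambda>x. p x - u x) + L2_sq (lebesgue_on \<Omega>) (\<lambda>x. classical_grad p x - G x)"
proof -
  have m: "\<Omega> \<in> sets lebesgue" using \<open>open \<Omega>\<close> by auto
  have pL: "p \<in> L2 (lebesgue_on \<Omega>)" "classical_grad p \<in> L2 (lebesgue_on \<Omega>)"
    using C1_H1_iff[OF \<open>open \<Omega>\<close> p(1)] p(2) by auto
  show ?thesis unfolding fun_diff_def
    by (intro H1_sq_eq \<open>open \<Omega>\<close> L2_diff weak_gradient_diff[OF m] pL u weak_gradient_classical p)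
qed

section \<open>Positive parts\<close>

text \<open>The derivative of \<open>smooth_pos \<epsilon>\<close> at \<open>s\<close> is \<open>clamp01 (s / \<epsilon>)\<close>.\<close>

definition clamp01 :: "real \<Rightarrow> real" where
  "clamp01 t = max 0 (min 1 t)"

text \<open>It vanishes for \<open>s \<le> 0\<close>, equals \<open>s\<^sup>2 / (2 \<epsilon>)\<close> for \<open>0 \<le> s \<le> \<epsilon>\<close> and \<open>s - \<epsilon> / 2\<close> for \<open>s \<ge> \<epsilon>\<close>. As a
difference of two translates of one function it is differentiated without splitting into cases.\<close>

definition smooth_pos :: "real \<Rightarrow> real \<Rightarrow> real" where
  "smooth_pos \<epsilon> s = ((max 0 s)\<^sup>2 - (max 0 (s - \<epsilon>))\<^sup>2) / (2 * \<epsilon>)"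

lemma DERIV_pos_sq: "((\<lambda>s. (max 0 s)\<^sup>2) has_real_derivative 2 * max 0 s) (at s)"
proof -
  have bound: "norm (((max 0 (s + h))\<^sup>2 - (max 0 s)\<^sup>2) / h - 2 * max 0 s) \<le> norm h" if False: "h \<noteq> 0" for h :: real
  proof -
    have "\<bar>(max 0 (s + h))\<^sup>2 - (max 0 s)\<^sup>2 - 2 * max 0 s * h\<bar> \<le> h\<^sup>2"
    proof -
      consider "0 \<le> s" "0 \<le> s + h" | "0 \<le> s" "s + h < 0" | "s < 0" "0 \<le> s + h" | "s < 0" "s + h < 0" by linarith
      then show ?thesis
      proof cases
        case 1 then show ?thesis by (simp add: max_def power2_eq_square algebra_simps)
      next
        case 2
        then have "\<bar>(max 0 (s + h))\<^sup>2 - (max 0 s)\<^sup>2 - 2 * max 0 s * h\<bar> = \<bar>s * (- s - 2 * h)\<bar>"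
          by (simp add: max_def power2_eq_square algebra_simps)
        also have "\<dots> = s * (- s - 2 * h)" using 2 by (intro abs_of_nonneg mult_nonneg_nonneg) auto
        also have "\<dots> = h\<^sup>2 - (s + h)\<^sup>2" by (simp add: power2_eq_square algebra_simps)
        finally show ?thesis by simp
      next
        case 3
        then have "(s + h)\<^sup>2 \<le> h\<^sup>2" by (intro power_mono) auto
        then show ?thesis using 3 by (simp add: max_def)
      next
        case 4 then show ?thesis by (simp add: max_def)
      qed
    qed
    then have "\<bar>((max 0 (s + h))\<^sup>2 - (max 0 s)\<^sup>2 - 2 * max 0 s * h) / h\<bar> \<le> h\<^sup>2 / \<bar>h\<bar>"
      unfolding abs_divide by (intro divide_right_mono) auto
    also have "h\<^sup>2 / \<bar>h\<bar> = \<bar>h\<bar>" using False by (cases "0 < h") (simp_all add: power2_eq_square)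
    finally show ?thesis using False by (simp add: diff_divide_distrib)
  qed
  have "((\<lambda>h. ((max 0 (s + h))\<^sup>2 - (max 0 s)\<^sup>2) / h - 2 * max 0 s) \<longlongrightarrow> 0) (at 0)"
  proof (rule Lim_null_comparison)
    show "\<forall>\<^sub>F h in at 0. norm (((max 0 (s + h))\<^sup>2 - (max 0 s)\<^sup>2) / h - 2 * max 0 s) \<le> norm h"
      by (rule eventually_mono[OF eventually_neq_at_within bound])
    show "((\<lambda>h::real. norm h) \<longlongrightarrow> 0) (at 0)" by (intro tendsto_norm_zero tendsto_ident_at)
  qed
  then show ?thesis unfolding DERIV_def by (rule LIM_zero_cancel)
qed

lemma DERIV_smooth_pos:
  assumes "0 < \<epsilon>"
  shows "(smooth_pos \<epsilon> has_real_derivative clamp01 (s / \<epsilon>)) (at s)"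
proof -
  have "((\<lambda>s. (max 0 (s - \<epsilon>))\<^sup>2) has_real_derivative 2 * max 0 (s - \<epsilon>)) (at s)"
  proof -
    have "((\<lambda>s. s - \<epsilon>) has_real_derivative 1) (at s)" by (auto intro!: derivative_eq_intros)
    from DERIV_chain2[OF DERIV_pos_sq this] show ?thesis by simp
  qed
  from DERIV_cdivide[OF DERIV_diff[OF DERIV_pos_sq this], of "2 * \<epsilon>"]
  have "(smooth_pos \<epsilon> has_real_derivative (2 * max 0 s - 2 * max 0 (s - \<epsilon>)) / (2 * \<epsilon>)) (at s)"
    by (simp add: smooth_pos_def[abs_def])
  also have "(2 * max 0 s - 2 * max 0 (s - \<epsilon>)) / (2 * \<epsilon>) = clamp01 (s / \<epsilon>)"
    using assms by (auto simp: clamp01_def max_def min_def field_simps)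
  finally show ?thesis .
qed

lemma clamp01_bounds: "0 \<le> clamp01 t" "clamp01 t \<le> 1" by (auto simp: clamp01_def)

lemma smooth_pos_Lipschitz:
  assumes "0 < \<epsilon>"
  shows "\<bar>smooth_pos \<epsilon> s - smooth_pos \<epsilon> t\<bar> \<le> \<bar>s - t\<bar>"
  using field_differentiable_bound[of UNIV "smooth_pos \<epsilon>" "\<lambda>s. clamp01 (s / \<epsilon>)" 1 s t]
    DERIV_smooth_pos[OF assms] clamp01_bounds by auto

lemma smooth_pos_zero: "0 < \<epsilon> \<Longrightarrow> smooth_pos \<epsilon> 0 = 0"
  by (simp add: smooth_pos_def)

lemma smooth_pos_approx:
  assumes e: "0 < \<epsilon>"
  shows "\<bar>smooth_pos \<epsilon> s - max 0 s\<bar> \<le> \<bar>s\<bar>" and "\<bar>smooth_pos \<epsilon> s - max 0 s\<bar> \<le> \<epsilon>"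
proof -
  have *: "0 \<le> max 0 s - smooth_pos \<epsilon> s \<and> max 0 s - smooth_pos \<epsilon> s \<le> max 0 s \<and> max 0 s - smooth_pos \<epsilon> s \<le> \<epsilon>"
  proof -
    consider "s \<le> 0" | "0 < s" "s \<le> \<epsilon>" | "\<epsilon> < s" by linarith
    then show ?thesis
    proof cases
      case 1 then show ?thesis using e by (simp add: smooth_pos_def)
    next
      case 2
      have "s * s \<le> s * \<epsilon>" using 2 by (intro mult_left_mono) auto
      moreover have "0 < s * \<epsilon>" using 2 e by simp
      ultimately have "s * s / (2 * \<epsilon>) \<le> s" using e by (simp add: divide_le_eq)
      moreover have "smooth_pos \<epsilon> s = s * s / (2 * \<epsilon>)" using 2 e by (simp add: smooth_pos_def power2_eq_square)
      moreover have "0 \<le> s * s / (2 * \<epsilon>)" using e by simp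
      moreover have "max 0 s = s" using 2 by simp
      ultimately show ?thesis using 2 by (intro conjI; linarith)
    next
      case 3
      then have "smooth_pos \<epsilon> s = s - \<epsilon> / 2" using e by (simp add: smooth_pos_def power2_eq_square field_simps)
      then show ?thesis using 3 e by simp
    qed
  qed
  then show "\<bar>smooth_pos \<epsilon> s - max 0 s\<bar> \<le> \<bar>s\<bar>" "\<bar>smooth_pos \<epsilon> s - max 0 s\<bar> \<le> \<epsilon>" by (auto simp: max_def split: if_splits)
qed

definition vec_pos :: "real^'m \<Rightarrow> real^'m" where
  "vec_pos z = (\<chi> i. max 0 (z $ i))"

definition vec_smooth_pos :: "real \<Rightarrow> real^'m \<Rightarrow> real^'m" where
  "vec_smooth_pos \<epsilon> z = (\<chi> i. smooth_pos \<epsilon> (z $ i))"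

text \<open>By the chain rule, composing each component with a scalar function multiplies the corresponding
row of the gradient by the derivative of that function.\<close>

definition row_scale :: "real^'m \<Rightarrow> real^'d^'m \<Rightarrow> real^'d^'m" where
  "row_scale c A = (\<chi> i. c $ i *\<^sub>R A $ i)"

definition pos_indicator :: "real^'m \<Rightarrow> real^'m" where
  "pos_indicator z = (\<chi> i. if 0 < z $ i then 1 else 0)"

lemma norm_row_scale_le:
  assumes "\<And>i. \<bar>c $ i\<bar> \<le> 1"
  shows "norm (row_scale c A) \<le> norm A"
proof -
  have "norm (row_scale c A) = L2_set (\<lambda>i. norm (row_scale c A $ i)) UNIV" by (rule norm_vec_def)
  also have "\<dots> \<le> L2_set (\<lambda>i. norm (A $ i)) UNIV"
    by (intro L2_set_mono) (auto simp: row_scale_def intro!: mult_left_le_one_le assms)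
  also have "\<dots> = norm A" by (rule norm_vec_def[symmetric])
  finally show ?thesis .
qed

lemma row_scale_diff: "row_scale c A - row_scale d A = row_scale (c - d) A"
  and row_scale_diff2: "row_scale c A - row_scale c B = row_scale c (A - B)"
  by (auto simp: row_scale_def vec_eq_iff algebra_simps)

lemma norm_vec_smooth_pos_diff_le:
  "0 < \<epsilon> \<Longrightarrow> norm (vec_smooth_pos \<epsilon> y - vec_smooth_pos \<epsilon> z) \<le> norm (y - z)"
  by (rule norm_le_componentwise_cart) (simp add: vec_smooth_pos_def smooth_pos_Lipschitz)

lemma norm_vec_smooth_pos_le: "0 < \<epsilon> \<Longrightarrow> norm (vec_smooth_pos \<epsilon> z) \<le> norm z"
  using norm_vec_smooth_pos_diff_le[of \<epsilon> z 0] by (simp add: vec_smooth_pos_def[of _ 0] smooth_pos_zero zero_vec_def[symmetric])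

lemma norm_vec_smooth_pos_vec_pos_le: "0 < \<epsilon> \<Longrightarrow> norm (vec_smooth_pos \<epsilon> z - vec_pos z) \<le> norm z"
  by (rule norm_le_componentwise_cart) (simp add: vec_smooth_pos_def vec_pos_def smooth_pos_approx)

lemma vec_smooth_pos_tendsto:
  assumes e: "\<And>n. 0 < \<epsilon> n" "\<epsilon> \<longlonglongrightarrow> 0"
  shows "(\<lambda>n. vec_smooth_pos (\<epsilon> n) z) \<longlonglongrightarrow> vec_pos z"
  unfolding vec_smooth_pos_def vec_pos_def
proof (rule tendsto_vec_lambda)
  fix i
  have "(\<lambda>n. smooth_pos (\<epsilon> n) (z $ i) - max 0 (z $ i)) \<longlonglongrightarrow> 0"
    by (rule tendsto_rabs_zero_cancel, rule real_tendsto_sandwich[where f="\<lambda>_. 0" and h=\<epsilon>])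
       (use smooth_pos_approx(2) e in auto)
  then show "(\<lambda>n. smooth_pos (\<epsilon> n) (z $ i)) \<longlonglongrightarrow> max 0 (z $ i)" by (rule LIM_zero_cancel)
qed

lemma continuous_vec_smooth_pos: "0 < \<epsilon> \<Longrightarrow> continuous_on UNIV (vec_smooth_pos \<epsilon>)"
proof -
  assume "0 < \<epsilon>"
  then have c: "continuous_on UNIV (smooth_pos \<epsilon>)"
    using DERIV_isCont[OF DERIV_smooth_pos] by (intro continuous_at_imp_continuous_on) blast
  show ?thesis
    unfolding vec_smooth_pos_def[abs_def]
    by (intro continuous_on_vec_lambda continuous_on_compose2[OF c continuous_on_component[OF continuous_on_id]] subset_UNIV)
qed

lemma borel_measurable_vec_components:
  fixes f :: "'a \<Rightarrow> ('b::euclidean_space)^'n"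
  assumes "\<And>i. (\<lambda>x. f x $ i) \<in> borel_measurable M"
  shows "f \<in> borel_measurable M"
proof (subst borel_measurable_euclidean_space, intro ballI)
  fix b :: "'b^'n" assume "b \<in> Basis"
  then obtain i c where "b = axis i c" by (auto simp: Basis_vec_def)
  then have "(\<lambda>x. f x \<bullet> b) = (\<lambda>x. f x $ i \<bullet> c)" by (simp add: inner_axis)
  also have "\<dots> \<in> borel_measurable M" using assms by measurable
  finally show "(\<lambda>x. f x \<bullet> b) \<in> borel_measurable M" .
qed

lemma borel_measurable_vec_component:
  fixes f :: "'a \<Rightarrow> ('b::euclidean_space)^'n"
  assumes "f \<in> borel_measurable M"
  shows "(\<lambda>x. f x $ i) \<in> borel_measurable M"
  by (rule measurable_compose[OF assms]) (rule borel_measurable_continuous_onI[OF continuous_on_component[OF continuous_on_id]])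

lemma continuous_vec_pos: "continuous_on UNIV vec_pos"
  unfolding vec_pos_def[abs_def] by (intro continuous_on_vec_lambda continuous_intros)

lemma measurable_vec_pos: "u \<in> borel_measurable M \<Longrightarrow> (\<lambda>x. vec_pos (u x)) \<in> borel_measurable M"
  by (rule measurable_compose[OF _ borel_measurable_continuous_onI[OF continuous_vec_pos]])

lemma measurable_vec_smooth_pos: "0 < \<epsilon> \<Longrightarrow> u \<in> borel_measurable M \<Longrightarrow> (\<lambda>x. vec_smooth_pos \<epsilon> (u x)) \<in> borel_measurable M"
  by (rule measurable_compose[OF _ borel_measurable_continuous_onI[OF continuous_vec_smooth_pos]])

lemma measurable_row_scale:
  assumes "c \<in> borel_measurable M" "A \<in> borel_measurable M"
  shows "(\<lambda>x. row_scale (c x) (A x)) \<in> borel_measurable M"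
proof (rule borel_measurable_vec_components)
  fix i
  have [measurable]: "(\<lambda>x. c x $ i) \<in> borel_measurable M" "(\<lambda>x. A x $ i) \<in> borel_measurable M"
    using assms by (auto intro: borel_measurable_vec_component)
  show "(\<lambda>x. row_scale (c x) (A x) $ i) \<in> borel_measurable M" by (simp add: row_scale_def)
qed

lemma measurable_pos_indicator:
  assumes "u \<in> borel_measurable M"
  shows "(\<lambda>x. pos_indicator (u x)) \<in> borel_measurable M"
proof (rule borel_measurable_vec_components)
  fix i
  have [measurable]: "(\<lambda>x. u x $ i) \<in> borel_measurable M" using assms by (rule borel_measurable_vec_component)
  show "(\<lambda>x. pos_indicator (u x) $ i) \<in> borel_measurable M" by (simp add: pos_indicator_def)
qed

lemma vec_smooth_pos_C1:
  fixes p :: "real^'d \<Rightarrow> real^'m"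
  assumes e: "0 < \<epsilon>" and p: "Ck_on 1 p UNIV"
  shows "Ck_on 1 (\<lambda>x. vec_smooth_pos \<epsilon> (p x)) UNIV"
    and "classical_grad (\<lambda>x. vec_smooth_pos \<epsilon> (p x)) = (\<lambda>x. row_scale (\<chi> i. clamp01 (p x $ i / \<epsilon>)) (classical_grad p x))"
proof -
  let ?G = "\<lambda>x. row_scale (\<chi> i. clamp01 (p x $ i / \<epsilon>)) (classical_grad p x)"
  have "((\<lambda>x. vec_smooth_pos \<epsilon> (p x)) has_derivative (\<lambda>v. ?G x *v v)) (at x)" for x
  proof -
    have "((\<lambda>x. vec_smooth_pos \<epsilon> (p x) $ i) has_derivative (\<lambda>v. (?G x *v v) $ i)) (at x)" for i
    proof -
      have "((\<lambda>y. p y $ i) has_derivative (\<lambda>v. (classical_grad p x *v v) $ i)) (at x)"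
        by (intro bounded_linear.has_derivative[OF bounded_linear_vec_nth] C1_has_derivative p)
      from DERIV_compose_FDERIV[OF DERIV_smooth_pos[OF e] this]
      show ?thesis
        by (simp add: vec_smooth_pos_def matrix_vector_mul_component row_scale_def mult.commute)
    qed
    then show ?thesis
      by (subst has_derivative_componentwise_within) (auto simp: Basis_vec_def inner_axis)
  qed
  moreover have "continuous_on UNIV ?G"
  proof -
    have "continuous_on UNIV (\<lambda>x. ?G x $ i $ j)" for i j
      using e unfolding row_scale_def clamp01_def
      by (simp, intro continuous_intros continuous_on_component C1_continuous[OF p] C1_continuous_grad[OF p]) auto
    then have "continuous_on UNIV (\<lambda>x. \<chi> i j. ?G x $ i $ j)" by (intro continuous_on_vec_lambda)
    then show ?thesis by simp
  qed
  ultimately show "Ck_on 1 (\<lambda>x. vec_smooth_pos \<epsilon> (p x)) UNIV" "classical_grad (\<lambda>x. vec_smooth_pos \<epsilon> (p x)) = ?G"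
    by (rule C1_I; assumption)+
qed

lemma ennreal_squeeze_0:
  fixes f g :: "nat \<Rightarrow> ennreal"
  assumes "\<And>n. f n \<le> g n" and "g \<longlonglongrightarrow> 0"
  shows "f \<longlonglongrightarrow> 0"
  by (rule tendsto_sandwich[OF always_eventually always_eventually tendsto_const assms(2)]) (simp_all add: assms(1))

lemma L2_sq_dominated_tendsto_0:
  assumes f: "\<And>n. f n \<in> borel_measurable M" and g: "g \<in> L2 M"
    and le: "\<And>n. AE x in M. norm (f n x) \<le> norm (g x)" and lim: "AE x in M. (\<lambda>n. f n x) \<longlonglongrightarrow> 0"
  shows "(\<lambda>n. L2_sq M (f n)) \<longlonglongrightarrow> 0"
proof -
  note [measurable] = f
  have [measurable]: "g \<in> borel_measurable M" using g by (simp add: L2_def)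
  have "(\<lambda>n. \<integral>\<^sup>+x. ennreal ((norm (f n x))\<^sup>2) \<partial>M) \<longlonglongrightarrow> (\<integral>\<^sup>+x. 0 \<partial>M)"
  proof (rule nn_integral_dominated_convergence[where w="\<lambda>x. ennreal ((norm (g x))\<^sup>2)"])
    show "AE x in M. ennreal ((norm (f n x))\<^sup>2) \<le> ennreal ((norm (g x))\<^sup>2)" for n
      using le[of n] by eventually_elim (auto intro!: ennreal_leI power_mono)
    show "(\<integral>\<^sup>+x. ennreal ((norm (g x))\<^sup>2) \<partial>M) < \<infinity>" using g by (simp add: L2_def L2_sq_def)
    show "AE x in M. (\<lambda>n. ennreal ((norm (f n x))\<^sup>2)) \<longlonglongrightarrow> 0"
      using lim
    proof eventually_elim
      case (elim x)
      then have "(\<lambda>n. (norm (f n x))\<^sup>2) \<longlonglongrightarrow> (norm (0::'b))\<^sup>2" by (intro tendsto_power tendsto_norm)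
      then show ?case using tendsto_ennrealI by fastforce
    qed
  qed auto
  then show ?thesis by (simp add: L2_sq_def)
qed

text \<open>The sum of the squares has a finite integral, hence it is finite almost everywhere.\<close>

lemma summable_L2_sq_imp_AE_tendsto_0:
  assumes f: "\<And>n. f n \<in> borel_measurable M" and fin: "(\<Sum>n. L2_sq M (f n)) < \<infinity>"
  shows "AE x in M. (\<lambda>n. f n x) \<longlonglongrightarrow> 0"
proof -
  note [measurable] = f
  have "(\<integral>\<^sup>+x. (\<Sum>n. ennreal ((norm (f n x))\<^sup>2)) \<partial>M) = (\<Sum>n. L2_sq M (f n))"
    unfolding L2_sq_def by (rule nn_integral_suminf) measurable
  then have "AE x in M. (\<Sum>n. ennreal ((norm (f n x))\<^sup>2)) \<noteq> \<infinity>"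
    using fin by (intro nn_integral_PInf_AE) auto
  then show ?thesis
  proof eventually_elim
    case (elim x)
    then have "summable (\<lambda>n. (norm (f n x))\<^sup>2)"
      by (intro summable_suminf_not_top) auto
    then have "(\<lambda>n. (norm (f n x))\<^sup>2) \<longlonglongrightarrow> 0" by (rule summable_LIMSEQ_zero)
    then have "(\<lambda>n. sqrt ((norm (f n x))\<^sup>2)) \<longlonglongrightarrow> sqrt 0" by (rule tendsto_real_sqrt)
    then show ?case by (simp add: tendsto_norm_zero_iff)
  qed
qed

text \<open>The limit is determined also at \<open>s = 0\<close>, although the indicator of the positive half line jumps
there. This is where it matters that \<open>a\<close> is an error measured relative to \<open>\<epsilon>\<close>.\<close>

lemma clamp01_tendsto_pos_indicator:
  assumes a: "a \<longlonglongrightarrow> 0" and e: "\<And>n. 0 < \<epsilon> n" "\<epsilon> \<longlonglongrightarrow> 0"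
  shows "(\<lambda>n. clamp01 (a n + s / \<epsilon> n)) \<longlonglongrightarrow> (if 0 < s then 1 else 0)"
proof -
  have a1: "\<forall>\<^sub>F n in sequentially. \<bar>a n\<bar> < 1"
    using order_tendstoD(2)[OF tendsto_rabs_zero[OF a], of 1] by simp
  have big: "\<forall>\<^sub>F n in sequentially. 2 \<le> \<bar>s\<bar> / \<epsilon> n" if "s \<noteq> 0"
    using order_tendstoD(2)[OF e(2), of "\<bar>s\<bar> / 2"] that
    by (auto elim!: eventually_mono simp: field_simps e(1))
  consider "0 < s" | "s = 0" | "s < 0" by linarith
  then show ?thesis
  proof cases
    case 1
    then have "s \<noteq> 0" by simp
    from a1 big[OF this] have "\<forall>\<^sub>F n in sequentially. clamp01 (a n + s / \<epsilon> n) = 1"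
      by eventually_elim (use 1 in \<open>simp add: clamp01_def\<close>)
    then show ?thesis using 1 by (simp add: tendsto_eventually)
  next
    case 2
    have "(\<lambda>n. max 0 (min 1 (a n))) \<longlonglongrightarrow> max 0 (min 1 0)" by (intro tendsto_intros a)
    then show ?thesis using 2 by (simp add: clamp01_def)
  next
    case 3
    then have "s \<noteq> 0" by simp
    from a1 big[OF this] have "\<forall>\<^sub>F n in sequentially. clamp01 (a n + s / \<epsilon> n) = 0"
      by eventually_elim (use 3 in \<open>simp add: clamp01_def\<close>)
    then show ?thesis using 3 by (simp add: tendsto_eventually)
  qed
qed

text \<open>The error is split at \<open>vec_smooth_pos (\<epsilon> n) (u x)\<close>. One part is controlled by \<open>p n - u\<close> because
\<open>vec_smooth_pos\<close> does not increase distances. The other is dominated by \<open>u\<close> itself; a uniform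
bound would not be square integrable on a set of infinite measure.\<close>

lemma vec_smooth_pos_L2_tendsto:
  assumes p: "\<And>n. p n \<in> borel_measurable M" and u: "u \<in> L2 M"
    and lim: "(\<lambda>n. L2_sq M (\<lambda>x. p n x - u x)) \<longlonglongrightarrow> 0"
    and e: "\<And>n. 0 < \<epsilon> n" "\<epsilon> \<longlonglongrightarrow> 0"
  shows "(\<lambda>n. L2_sq M (\<lambda>x. vec_smooth_pos (\<epsilon> n) (p n x) - vec_pos (u x))) \<longlonglongrightarrow> 0"
proof -
  have um: "u \<in> borel_measurable M" using u by (simp add: L2_def)
  note [measurable] = measurable_vec_smooth_pos[OF e(1) p] measurable_vec_smooth_pos[OF e(1) um] measurable_vec_pos[OF um]
  let ?a = "\<lambda>n. L2_sq M (\<lambda>x. p n x - u x)"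
  let ?b = "\<lambda>n. L2_sq M (\<lambda>x. vec_smooth_pos (\<epsilon> n) (u x) - vec_pos (u x))"
  let ?c = "\<lambda>n. L2_sq M (\<lambda>x. vec_smooth_pos (\<epsilon> n) (p n x) - vec_pos (u x))"
  have A: "(\<lambda>n. ?b n) \<longlonglongrightarrow> 0"
  proof (rule L2_sq_dominated_tendsto_0[OF _ u])
    show "AE x in M. norm (vec_smooth_pos (\<epsilon> n) (u x) - vec_pos (u x)) \<le> norm (u x)" for n
      using e by (intro AE_I2 norm_vec_smooth_pos_vec_pos_le)
    show "AE x in M. (\<lambda>n. vec_smooth_pos (\<epsilon> n) (u x) - vec_pos (u x)) \<longlonglongrightarrow> 0"
      using e by (intro AE_I2 LIM_zero vec_smooth_pos_tendsto)
  qed measurable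
  have le: "?c n
    \<le> 2 * ?a n + 2 * ?b n" for n
  proof -
    have "?c n =
      L2_sq M (\<lambda>x. (vec_smooth_pos (\<epsilon> n) (p n x) - vec_smooth_pos (\<epsilon> n) (u x)) + (vec_smooth_pos (\<epsilon> n) (u x) - vec_pos (u x)))"
      by simp
    also have "\<dots> \<le> 2 * L2_sq M (\<lambda>x. vec_smooth_pos (\<epsilon> n) (p n x) - vec_smooth_pos (\<epsilon> n) (u x)) + 2 * ?b n"
      by (rule L2_sq_add_le) measurable
    also have "L2_sq M (\<lambda>x. vec_smooth_pos (\<epsilon> n) (p n x) - vec_smooth_pos (\<epsilon> n) (u x)) \<le> ?a n"
      using e by (intro L2_sq_mono_AE AE_I2 norm_vec_smooth_pos_diff_le)
    finally show ?thesis by (simp add: add_right_mono mult_left_mono)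
  qed
  have "(\<lambda>n. 2 * ?a n + 2 * ?b n) \<longlonglongrightarrow> 2 * 0 + 2 * 0"
    by (intro tendsto_add ennreal_tendsto_cmult lim A) auto
  then show ?thesis by (intro ennreal_squeeze_0[OF le]) simp
qed

text \<open>The approximations \<open>p (r k)\<close> are chosen with squared errors at most \<open>8\<^sup>-\<^sup>k\<close> and the regularisation
parameter is \<open>2\<^sup>-\<^sup>k\<close>. The errors divided by the parameter then have summable squared norms, so they
tend to zero almost everywhere. Hence the derivative factors converge almost everywhere to the
indicator of \<open>u > 0\<close>, also on the set where \<open>u = 0\<close>, and by dominated convergence the gradients
converge strongly.\<close>

lemma smooth_positive_part_approximation:
  fixes p :: "nat \<Rightarrow> real^'d \<Rightarrow> real^'m"
  assumes p: "\<And>n. Ck_on 1 (p n) UNIV" "\<And>n. p n \<in> L2 (lebesgue_on \<Omega>)" "\<And>n. classical_grad (p n) \<in> L2 (lebesgue_on \<Omega>)"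
    and u: "u \<in> L2 (lebesgue_on \<Omega>)" "G \<in> L2 (lebesgue_on \<Omega>)"
    and w: "w \<in> L2 N" "\<And>n. p n \<in> borel_measurable N"
    and lim: "(\<lambda>n. L2_sq (lebesgue_on \<Omega>) (\<lambda>x. p n x - u x)) \<longlonglongrightarrow> 0"
      "(\<lambda>n. L2_sq (lebesgue_on \<Omega>) (\<lambda>x. classical_grad (p n) x - G x)) \<longlonglongrightarrow> 0"
      "(\<lambda>n. L2_sq N (\<lambda>x. p n x - w x)) \<longlonglongrightarrow> 0"
  obtains q where "\<And>n. Ck_on 1 (q n) UNIV" "\<And>n. q n \<in> L2 (lebesgue_on \<Omega>)" "\<And>n. classical_grad (q n) \<in> L2 (lebesgue_on \<Omega>)"
    and "\<And>n. q n \<in> borel_measurable N"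
    and "(\<lambda>n. L2_sq (lebesgue_on \<Omega>) (\<lambda>x. q n x - vec_pos (u x))) \<longlonglongrightarrow> 0"
    and "(\<lambda>n. L2_sq (lebesgue_on \<Omega>) (\<lambda>x. classical_grad (q n) x - row_scale (pos_indicator (u x)) (G x))) \<longlonglongrightarrow> 0"
    and "(\<lambda>n. L2_sq N (\<lambda>x. q n x - vec_pos (w x))) \<longlonglongrightarrow> 0"
proof -
  let ?M = "lebesgue_on \<Omega>"
  define S where "S n = L2_sq ?M (\<lambda>x. p n x - u x) + L2_sq ?M (\<lambda>x. classical_grad (p n) x - G x) + L2_sq N (\<lambda>x. p n x - w x)" for n
  have "S \<longlonglongrightarrow> 0 + 0 + 0" unfolding S_def by (intro tendsto_add lim)
  then have S0: "S \<longlonglongrightarrow> 0" by simp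
  have "\<exists>n. S n < ennreal ((1/8) ^ k)" for k
    using order_tendstoD(2)[OF S0, of "ennreal ((1/8) ^ k)"] by (auto simp: eventually_sequentially)
  then obtain r where r: "\<And>k. S (r k) < ennreal ((1/8) ^ k)" by metis
  have e8: "(\<lambda>k. ennreal ((1/8) ^ k)) \<longlonglongrightarrow> 0"
    using tendsto_ennrealI[OF LIMSEQ_realpow_zero[of "1/8::real"]] by simp
  let ?a = "\<lambda>k. L2_sq ?M (\<lambda>x. p (r k) x - u x)"
  let ?g = "\<lambda>k. L2_sq ?M (\<lambda>x. classical_grad (p (r k)) x - G x)"
  let ?w = "\<lambda>k. L2_sq N (\<lambda>x. p (r k) x - w x)"
  have small: "?a k \<le> ennreal ((1/8) ^ k)"
    "?g k \<le> ennreal ((1/8) ^ k)"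
    "?w k \<le> ennreal ((1/8) ^ k)" for k
  proof -
    have "a \<le> a + b + c" "b \<le> a + b + c" "c \<le> a + b + c" for a b c :: ennreal
      by (auto simp: add_increasing add_increasing2 add.assoc)
    note parts = this[where a="?a k" and b="?g k" and c="?w k"]
    note le = less_imp_le[OF r[of k, unfolded S_def]]
    show "?a k \<le> ennreal ((1/8) ^ k)"
      "?g k \<le> ennreal ((1/8) ^ k)"
      "?w k \<le> ennreal ((1/8) ^ k)"
      by (rule order_trans[OF parts(1) le], rule order_trans[OF parts(2) le], rule order_trans[OF parts(3) le])
  qed
  have lim': "(\<lambda>k. ?a k) \<longlonglongrightarrow> 0"
    "(\<lambda>k. ?g k) \<longlonglongrightarrow> 0"
    "(\<lambda>k. ?w k) \<longlonglongrightarrow> 0"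
    by (rule ennreal_squeeze_0[OF small(1) e8], rule ennreal_squeeze_0[OF small(2) e8], rule ennreal_squeeze_0[OF small(3) e8])
  define \<epsilon> :: "nat \<Rightarrow> real" where "\<epsilon> k = (1/2) ^ k" for k
  have e: "0 < \<epsilon> k" for k by (simp add: \<epsilon>_def)
  have e0: "\<epsilon> \<longlonglongrightarrow> 0" unfolding \<epsilon>_def by (rule LIMSEQ_realpow_zero) auto
  define q where "q k x = vec_smooth_pos (\<epsilon> k) (p (r k) x)" for k x
  define c where "c k x = (\<chi> i. clamp01 (p (r k) x $ i / \<epsilon> k))" for k x
  have qC1: "Ck_on 1 (q k) UNIV" and qG: "classical_grad (q k) = (\<lambda>x. row_scale (c k x) (classical_grad (p (r k)) x))" for k
    unfolding q_def[abs_def] c_def by (rule vec_smooth_pos_C1[OF e p(1)])+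
  have c1: "\<bar>c k x $ i\<bar> \<le> 1" for k x i using clamp01_bounds by (simp add: c_def)
  have meas: "u \<in> borel_measurable ?M" "G \<in> borel_measurable ?M" "p n \<in> borel_measurable ?M" "classical_grad (p n) \<in> borel_measurable ?M" for n
    using u p by (auto simp: L2_def)
  have cm: "c k \<in> borel_measurable ?M" for k
  proof (rule borel_measurable_vec_components)
    fix i
    have [measurable]: "(\<lambda>x. p (r k) x $ i) \<in> borel_measurable ?M" by (rule borel_measurable_vec_component[OF meas(3)])
    show "(\<lambda>x. c k x $ i) \<in> borel_measurable ?M" unfolding c_def clamp01_def by simp
  qed
  have qL2: "q k \<in> L2 ?M" for k
    unfolding q_def[abs_def]
    by (rule L2_mono[OF p(2)[of "r k"] measurable_vec_smooth_pos[OF e meas(3)]]) (simp add: norm_vec_smooth_pos_le e)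
  have qGL2: "classical_grad (q k) \<in> L2 ?M" for k
    unfolding qG
    by (rule L2_mono[OF p(3)[of "r k"] measurable_row_scale[OF cm meas(4)]]) (simp add: norm_row_scale_le c1)
  have qN: "q k \<in> borel_measurable N" for k
    unfolding q_def[abs_def] by (rule measurable_vec_smooth_pos[OF e w(2)])
  have conv_grad: "(\<lambda>k. L2_sq ?M (\<lambda>x. classical_grad (q k) x - row_scale (pos_indicator (u x)) (G x))) \<longlonglongrightarrow> 0"
  proof -
    let ?c = "\<lambda>k. L2_sq ?M (\<lambda>x. classical_grad (q k) x - row_scale (pos_indicator (u x)) (G x))"
    let ?d = "\<lambda>k. L2_sq ?M (\<lambda>x. row_scale (c k x - pos_indicator (u x)) (G x))"
    have AEc: "AE x in ?M. (\<lambda>k. (1 / \<epsilon> k) *\<^sub>R (p (r k) x - u x)) \<longlonglongrightarrow> 0"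
    proof (rule summable_L2_sq_imp_AE_tendsto_0)
      show "(\<lambda>x. (1 / \<epsilon> k) *\<^sub>R (p (r k) x - u x)) \<in> borel_measurable ?M" for k
        using meas by measurable
      have "L2_sq ?M (\<lambda>x. (1 / \<epsilon> k) *\<^sub>R (p (r k) x - u x)) \<le> ennreal ((1/2) ^ k)" for k
      proof -
        have "L2_sq ?M (\<lambda>x. (1 / \<epsilon> k) *\<^sub>R (p (r k) x - u x)) = (\<integral>\<^sup>+x. ennreal (4 ^ k) * ennreal ((norm (p (r k) x - u x))\<^sup>2) \<partial>?M)"
          unfolding L2_sq_def
          by (intro nn_integral_cong) (simp add: \<epsilon>_def power_mult_distrib ennreal_mult[symmetric] power_one_over power_mult[symmetric] mult.commute[of _ 2] power_mult[of 2 2, simplified])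
        also have "\<dots> = ennreal (4 ^ k) * ?a k"
          unfolding L2_sq_def using meas by (intro nn_integral_cmult) measurable
        also have "\<dots> \<le> ennreal (4 ^ k) * ennreal ((1/8) ^ k)" by (intro mult_left_mono small) simp
        also have "\<dots> = ennreal ((1/2) ^ k)" by (simp add: ennreal_mult[symmetric] power_mult_distrib[symmetric])
        finally show ?thesis .
      qed
      then have "(\<Sum>k. L2_sq ?M (\<lambda>x. (1 / \<epsilon> k) *\<^sub>R (p (r k) x - u x))) \<le> (\<Sum>k. ennreal ((1/2) ^ k))"
        by (intro suminf_le) auto
      also have "\<dots> < \<infinity>"
        by (subst suminf_ennreal2) (auto intro: summable_geometric)
      finally show "(\<Sum>k. L2_sq ?M (\<lambda>x. (1 / \<epsilon> k) *\<^sub>R (p (r k) x - u x))) < \<infinity>" .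
    qed
    have clim: "AE x in ?M. (\<lambda>k. c k x) \<longlonglongrightarrow> pos_indicator (u x)"
      using AEc
    proof eventually_elim
      case (elim x)
      show ?case unfolding c_def pos_indicator_def
      proof (rule tendsto_vec_lambda)
        fix i
        have a: "(\<lambda>k. ((1 / \<epsilon> k) *\<^sub>R (p (r k) x - u x)) $ i) \<longlonglongrightarrow> 0"
          using tendsto_vec_nth[OF elim, of i] by simp
        have "p (r k) x $ i / \<epsilon> k = ((1 / \<epsilon> k) *\<^sub>R (p (r k) x - u x)) $ i + u x $ i / \<epsilon> k" for k
          by (simp add: diff_divide_distrib)
        then show "(\<lambda>k. clamp01 (p (r k) x $ i / \<epsilon> k)) \<longlonglongrightarrow> (if 0 < u x $ i then 1 else 0)"
          using clamp01_tendsto_pos_indicator[OF a e e0, of "u x $ i"] by simp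
      qed
    qed
    have B: "(\<lambda>k. ?d k) \<longlonglongrightarrow> 0"
    proof (rule L2_sq_dominated_tendsto_0[OF _ u(2)])
      show "(\<lambda>x. row_scale (c k x - pos_indicator (u x)) (G x)) \<in> borel_measurable ?M" for k
        by (intro measurable_row_scale borel_measurable_diff cm measurable_pos_indicator meas)
      have "\<bar>(c k x - pos_indicator (u x)) $ i\<bar> \<le> 1" for k x i
        using clamp01_bounds[of "p (r k) x $ i / \<epsilon> k"] by (simp add: c_def pos_indicator_def)
      then show "AE x in ?M. norm (row_scale (c k x - pos_indicator (u x)) (G x)) \<le> norm (G x)" for k
        by (intro AE_I2 norm_row_scale_le)
      show "AE x in ?M. (\<lambda>k. row_scale (c k x - pos_indicator (u x)) (G x)) \<longlonglongrightarrow> 0"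
        using clim
      proof eventually_elim
        case (elim x)
        have "(\<lambda>k. (c k x - pos_indicator (u x)) $ i *\<^sub>R G x $ i) \<longlonglongrightarrow> 0 *\<^sub>R G x $ i" for i
        proof (rule tendsto_scaleR[OF _ tendsto_const])
          show "(\<lambda>k. (c k x - pos_indicator (u x)) $ i) \<longlonglongrightarrow> 0"
            using tendsto_vec_nth[OF LIM_zero[OF elim], of i] by simp
        qed
        then have "(\<lambda>k. \<chi> i. (c k x - pos_indicator (u x)) $ i *\<^sub>R G x $ i) \<longlonglongrightarrow> (\<chi> i. 0 *\<^sub>R G x $ i)"
          by (rule tendsto_vec_lambda)
        then show ?case by (simp add: row_scale_def zero_vec_def)
      qed
    qed
    have le: "?c k
      \<le> 2 * ?g k + 2 * ?d k" for k
    proof -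
      have "?c k =
        L2_sq ?M (\<lambda>x. row_scale (c k x) (classical_grad (p (r k)) x - G x) + row_scale (c k x - pos_indicator (u x)) (G x))"
        by (simp add: qG row_scale_diff[symmetric] row_scale_diff2[symmetric])
      also have "\<dots> \<le> 2 * L2_sq ?M (\<lambda>x. row_scale (c k x) (classical_grad (p (r k)) x - G x)) + 2 * ?d k"
        by (intro L2_sq_add_le measurable_row_scale borel_measurable_diff cm measurable_pos_indicator meas)
      also have "L2_sq ?M (\<lambda>x. row_scale (c k x) (classical_grad (p (r k)) x - G x)) \<le> ?g k"
        by (intro L2_sq_mono_AE AE_I2 norm_row_scale_le c1)
      finally show ?thesis by (simp add: add_right_mono mult_left_mono)
    qed
    have "(\<lambda>k. 2 * ?g k + 2 * ?d k) \<longlonglongrightarrow> 2 * 0 + 2 * 0"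
      by (intro tendsto_add ennreal_tendsto_cmult lim' B) auto
    then show ?thesis by (intro ennreal_squeeze_0[OF le]) simp
  qed
  show ?thesis
  proof
    show "(\<lambda>k. L2_sq ?M (\<lambda>x. q k x - vec_pos (u x))) \<longlonglongrightarrow> 0"
      unfolding q_def by (rule vec_smooth_pos_L2_tendsto[OF meas(3) u(1) lim'(1) e e0])
    show "(\<lambda>k. L2_sq N (\<lambda>x. q k x - vec_pos (w x))) \<longlonglongrightarrow> 0"
      unfolding q_def by (rule vec_smooth_pos_L2_tendsto[OF w(2) w(1) lim'(3) e e0])
  qed (fact qC1 qL2 qGL2 qN conv_grad)+
qed

section \<open>Estimates along segments\<close>

lemma norm_matrix_vector_mult_le:
  fixes A :: "real^'d^'m"
  shows "norm (A *v e) \<le> norm A * norm e"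
proof -
  have "norm (A *v e) = L2_set (\<lambda>i. \<bar>A $ i \<bullet> e\<bar>) UNIV"
    by (simp add: norm_vec_def matrix_vector_mul_component)
  also have "\<dots> \<le> L2_set (\<lambda>i. norm (A $ i) * norm e) UNIV"
    by (intro L2_set_mono Cauchy_Schwarz_ineq2) simp
  also have "\<dots> = norm A * norm e"
    by (simp add: norm_vec_def[of A] L2_set_left_distrib)
  finally show ?thesis .
qed

text \<open>The Cauchy-Schwarz inequality: \<open>g\<close> deviates from its mean by a function with nonnegative square
integral.\<close>

lemma square_integral_le:
  fixes g :: "real \<Rightarrow> real"
  assumes T: "0 < T" and g: "continuous_on {0..T} g"
  shows "(LINT t|lborel. indicator {0..T} t *\<^sub>R g t)\<^sup>2 \<le> T * (LINT t|lborel. indicator {0..T} t *\<^sub>R (g t)\<^sup>2)"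
proof -
  define I where "I = (LINT t|lborel. indicator {0..T} t *\<^sub>R g t)"
  define J where "J = (LINT t|lborel. indicator {0..T} t *\<^sub>R (g t)\<^sup>2)"
  have int: "integrable lborel (\<lambda>t. indicat_real {0..T} t *\<^sub>R h t)" if "continuous_on {0..T} h" for h :: "real \<Rightarrow> real"
    using borel_integrable_atLeastAtMost'[OF that] by (simp add: set_integrable_def)
  have i1: "integrable lborel (\<lambda>t. indicat_real {0..T} t *\<^sub>R g t)" by (rule int[OF g])
  have i2: "integrable lborel (\<lambda>t. indicat_real {0..T} t *\<^sub>R (g t)\<^sup>2)" by (intro int continuous_intros g)
  have i3: "integrable lborel (\<lambda>t. indicat_real {0..T} t)" using int[of "\<lambda>t. 1"] by simp
  \<comment> \<open>\<open>I / T\<close> is the mean of \<open>g\<close>; multiplying by \<open>T\<close> avoids the division.\<close>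
  have "0 \<le> (LINT t|lborel. indicator {0..T} t *\<^sub>R (T * g t - I)\<^sup>2)"
    by (intro integral_nonneg_AE AE_I2) (auto simp: indicator_def)
  also have "(\<lambda>t. indicat_real {0..T} t *\<^sub>R (T * g t - I)\<^sup>2) =
     (\<lambda>t. T\<^sup>2 * (indicat_real {0..T} t *\<^sub>R (g t)\<^sup>2) - 2 * T * I * (indicat_real {0..T} t *\<^sub>R g t) + I\<^sup>2 * indicat_real {0..T} t)"
    by (auto simp: power2_eq_square algebra_simps)
  also have "(LINT t|lborel. \<dots> t) = T\<^sup>2 * J - 2 * T * I * I + I\<^sup>2 * T"
    using i1 i2 i3 T unfolding I_def J_def by simp
  also have "\<dots> = T * (T * J - I\<^sup>2)" by (simp add: power2_eq_square algebra_simps)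
  finally show ?thesis using T by (simp add: zero_le_mult_iff I_def J_def)
qed

lemma C1_segment_estimate:
  fixes q :: "real^'d \<Rightarrow> real^'m"
  assumes q: "Ck_on 1 q UNIV" and T: "0 \<le> T"
  shows "ennreal ((norm (q (x + T *\<^sub>R e) - q x))\<^sup>2)
    \<le> ennreal T * (\<integral>\<^sup>+t. ennreal ((norm (classical_grad q (x + t *\<^sub>R e) *v e))\<^sup>2) * indicator {0..T} t \<partial>lborel)"
proof (cases "T = 0")
  case False
  then have T: "0 < T" using T by simp
  define D where "D t = classical_grad q (x + t *\<^sub>R e) *v e" for t
  have cD: "continuous_on {0..T} D"
    unfolding D_def matrix_vector_mult_def
    by (intro continuous_on_vec_lambda continuous_on_sum continuous_on_mult continuous_on_component continuous_on_const
        continuous_on_compose2[OF C1_continuous_grad[OF q]] continuous_intros) simp_all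
  have vd: "((\<lambda>t. q (x + t *\<^sub>R e)) has_vector_derivative D t) (at t within {0..T})" for t
  proof -
    have line: "((\<lambda>t. x + t *\<^sub>R e) has_derivative (\<lambda>s. s *\<^sub>R e)) (at t within {0..T})"
      by (auto intro!: derivative_eq_intros)
    from has_derivative_compose[OF line C1_has_derivative[OF q]]
    show ?thesis by (simp add: has_vector_derivative_def D_def matrix_vector_mult_scaleR)
  qed
  have "q (x + T *\<^sub>R e) - q x = (LINT t|lborel. indicator {0..T} t *\<^sub>R D t)"
    using integral_FTC_atLeastAtMost[OF less_imp_le[OF T] vd cD] by simp
  also have "norm \<dots> \<le> (LINT t|lborel. norm (indicator {0..T} t *\<^sub>R D t))" by (rule integral_norm_bound)
  also have "\<dots> = (LINT t|lborel. indicator {0..T} t *\<^sub>R norm (D t))" by simp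
  finally have "(norm (q (x + T *\<^sub>R e) - q x))\<^sup>2 \<le> (LINT t|lborel. indicator {0..T} t *\<^sub>R norm (D t))\<^sup>2"
    by (intro power_mono) auto
  also have "\<dots> \<le> T * (LINT t|lborel. indicator {0..T} t *\<^sub>R (norm (D t))\<^sup>2)"
    by (intro square_integral_le T continuous_intros cD)
  finally have "ennreal ((norm (q (x + T *\<^sub>R e) - q x))\<^sup>2) \<le> ennreal T * ennreal (LINT t|lborel. indicator {0..T} t *\<^sub>R (norm (D t))\<^sup>2)"
    using T by (simp add: ennreal_mult[symmetric] ennreal_leI)
  also have "ennreal (LINT t|lborel. indicator {0..T} t *\<^sub>R (norm (D t))\<^sup>2) = (\<integral>\<^sup>+t. ennreal (indicator {0..T} t *\<^sub>R (norm (D t))\<^sup>2) \<partial>lborel)"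
  proof (rule nn_integral_eq_integral[symmetric])
    have "continuous_on {0..T} (\<lambda>t. (norm (D t))\<^sup>2)" by (intro continuous_intros cD)
    from borel_integrable_atLeastAtMost'[OF this]
    show "integrable lborel (\<lambda>t. indicat_real {0..T} t *\<^sub>R (norm (D t))\<^sup>2)" by (simp add: set_integrable_def)
  qed auto
  also have "\<dots> = (\<integral>\<^sup>+t. ennreal ((norm (D t))\<^sup>2) * indicator {0..T} t \<partial>lborel)"
    by (intro nn_integral_cong) (auto simp: indicator_def)
  finally show ?thesis by (simp add: D_def)
qed simp

lemma nn_integral_lborel_shift:
  fixes f :: "'a::euclidean_space \<Rightarrow> ennreal"
  assumes [measurable]: "f \<in> borel_measurable borel"
  shows "(\<integral>\<^sup>+x. f (x + a) \<partial>lborel) = (\<integral>\<^sup>+x. f x \<partial>lborel)"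
proof -
  have "(\<integral>\<^sup>+x. f (x + a) \<partial>lborel) = (\<integral>\<^sup>+x. f x \<partial>distr lborel borel ((+) a))"
    by (subst nn_integral_distr) (auto simp: add.commute)
  then show ?thesis by (simp add: lborel_distr_plus)
qed

text \<open>For each \<open>x\<close> the difference \<open>q (x + \<tau> x *\<^sub>R e) - q x\<close> is controlled by the integral of the
squared gradient along the segment, and by Fubini and translation invariance the integral of this
over all \<open>x\<close> costs at most the length of the time interval. The endpoint itself may lie outside
\<open>\<Omega>\<close>, which allows it to be on the boundary.\<close>

lemma C1_moving_endpoint_estimate:
  fixes q :: "real^'d \<Rightarrow> real^'m" and \<tau> :: "real^'d \<Rightarrow> real"
  assumes q: "Ck_on 1 q UNIV" and "open \<Omega>" and K [measurable]: "K \<in> sets borel"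
    and \<tau> [measurable]: "\<tau> \<in> borel_measurable borel"
    and \<tau>R: "\<And>x. x \<in> K \<Longrightarrow> 0 \<le> \<tau> x \<and> \<tau> x \<le> R"
    and seg: "\<And>x t. x \<in> K \<Longrightarrow> 0 \<le> t \<Longrightarrow> t < \<tau> x \<Longrightarrow> x + t *\<^sub>R e \<in> \<Omega>"
  shows "(\<integral>\<^sup>+x. ennreal ((norm (q x))\<^sup>2) * indicator K x \<partial>lborel)
    \<le> 2 * (\<integral>\<^sup>+x. ennreal ((norm (q (x + \<tau> x *\<^sub>R e)))\<^sup>2) * indicator K x \<partial>lborel)
      + ennreal (2 * R\<^sup>2 * (norm e)\<^sup>2) * L2_sq (lebesgue_on \<Omega>) (classical_grad q)" (is "_ \<le> 2 * ?B + _ * ?D")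
proof (cases "K = {}")
  case False
  then have R0: "0 \<le> R" using \<tau>R by force
  have [measurable]: "q \<in> borel_measurable borel" "classical_grad q \<in> borel_measurable borel"
    using C1_continuous[OF q] C1_continuous_grad[OF q] by (auto intro: borel_measurable_continuous_onI)
  have [measurable]: "\<Omega> \<in> sets borel" using \<open>open \<Omega>\<close> by auto
  define F where "F y = ennreal ((norm (classical_grad q y *v e))\<^sup>2) * indicator \<Omega> y" for y
  have cont: "continuous_on UNIV (\<lambda>y. classical_grad q y *v e)"
    unfolding matrix_vector_mult_def
    by (intro continuous_on_vec_lambda continuous_on_sum continuous_on_mult continuous_on_component continuous_on_const C1_continuous_grad q)
  have [measurable]: "(\<lambda>y. classical_grad q y *v e) \<in> borel_measurable borel"
    by (rule borel_measurable_continuous_onI[OF cont])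
  have [measurable]: "F \<in> borel_measurable borel" unfolding F_def by measurable
  let ?l = "\<lambda>x. \<integral>\<^sup>+t. F (x + t *\<^sub>R e) * indicator {0..R} t \<partial>lborel"
  let ?L = "\<lambda>x. \<integral>\<^sup>+t. F (x + t *\<^sub>R e) * indicator {0..R} t * indicator K x \<partial>lborel"
  let ?S = "\<lambda>t. \<integral>\<^sup>+x. F (x + t *\<^sub>R e) * indicator {0..R} t * indicator K x \<partial>lborel"
  have F_le: "(\<integral>\<^sup>+y. F y \<partial>lborel) \<le> ennreal ((norm e)\<^sup>2) * ?D"
  proof -
    have "(\<integral>\<^sup>+y. F y \<partial>lborel) \<le> (\<integral>\<^sup>+y. ennreal ((norm e)\<^sup>2) * (ennreal ((norm (classical_grad q y))\<^sup>2) * indicator \<Omega> y) \<partial>lborel)"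
    proof (rule nn_integral_mono)
      fix y
      have "(norm (classical_grad q y *v e))\<^sup>2 \<le> (norm e)\<^sup>2 * (norm (classical_grad q y))\<^sup>2"
        using power_mono[OF norm_matrix_vector_mult_le[of "classical_grad q y" e], of 2]
        by (simp add: power_mult_distrib mult.commute)
      then show "F y \<le> ennreal ((norm e)\<^sup>2) * (ennreal ((norm (classical_grad q y))\<^sup>2) * indicator \<Omega> y)"
        by (auto simp: F_def indicator_def ennreal_mult[symmetric] ennreal_leI)
    qed
    also have "\<dots> = ennreal ((norm e)\<^sup>2) * (\<integral>\<^sup>+y. ennreal ((norm (classical_grad q y))\<^sup>2) * indicator \<Omega> y \<partial>lborel)"
      by (rule nn_integral_cmult) measurable
    also have "(\<integral>\<^sup>+y. ennreal ((norm (classical_grad q y))\<^sup>2) * indicator \<Omega> y \<partial>lborel) = ?D"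
      unfolding L2_sq_def by (rule nn_integral_lebesgue_on[symmetric]) (use \<open>open \<Omega>\<close> in auto)
    finally show ?thesis .
  qed
  have pointwise: "ennreal ((norm (q x))\<^sup>2) \<le> 2 * ennreal ((norm (q (x + \<tau> x *\<^sub>R e)))\<^sup>2)
      + ennreal (2 * R) * ?l x" if x: "x \<in> K" for x
  proof -
    note T = \<tau>R[OF x]
    have "ennreal ((norm (q x))\<^sup>2) \<le> ennreal (2 * (norm (q (x + \<tau> x *\<^sub>R e)))\<^sup>2 + 2 * (norm (q (x + \<tau> x *\<^sub>R e) - q x))\<^sup>2)"
      using norm_add_sq_le[of "q (x + \<tau> x *\<^sub>R e)" "q x - q (x + \<tau> x *\<^sub>R e)"]
      by (intro ennreal_leI) (simp add: norm_minus_commute)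
    also have "\<dots> = 2 * ennreal ((norm (q (x + \<tau> x *\<^sub>R e)))\<^sup>2) + 2 * ennreal ((norm (q (x + \<tau> x *\<^sub>R e) - q x))\<^sup>2)"
      by (simp add: ennreal_plus ennreal_mult)
    also have "ennreal ((norm (q (x + \<tau> x *\<^sub>R e) - q x))\<^sup>2) \<le> ennreal R * ?l x"
    proof (rule order_trans[OF C1_segment_estimate[OF q conjunct1[OF T]] mult_mono])
      show "(\<integral>\<^sup>+t. ennreal ((norm (classical_grad q (x + t *\<^sub>R e) *v e))\<^sup>2) * indicator {0..\<tau> x} t \<partial>lborel)
         \<le> ?l x"
      proof (rule nn_integral_mono_AE)
        show "AE t in lborel. ennreal ((norm (classical_grad q (x + t *\<^sub>R e) *v e))\<^sup>2) * indicator {0..\<tau> x} t \<le> F (x + t *\<^sub>R e) * indicator {0..R} t"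
          using AE_lborel_singleton[of "\<tau> x"]
        proof eventually_elim
          case (elim t)
          show ?case
          proof (cases "t \<in> {0..\<tau> x}")
            case True
            then have "x + t *\<^sub>R e \<in> \<Omega>" using seg[OF x, of t] elim by auto
            then show ?thesis using True T by (simp add: F_def)
          qed simp
        qed
      qed
    qed (use T in \<open>auto intro: ennreal_leI\<close>)
    finally show ?thesis using R0 by (simp add: ennreal_mult mult.assoc mult_left_mono)
  qed
  have m2: "case_prod (\<lambda>x t. F (x + t *\<^sub>R e) * indicator {0..R} t * indicator K x) \<in> borel_measurable (lborel \<Otimes>\<^sub>M lborel)"
    by measurable
  have inner: "(\<integral>\<^sup>+x. ?L x \<partial>lborel)
      \<le> ennreal R * (\<integral>\<^sup>+y. F y \<partial>lborel)"
  proof -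
    have "(\<integral>\<^sup>+x. ?L x \<partial>lborel)
      = (\<integral>\<^sup>+t. ?S t \<partial>lborel)"
      by (rule lborel_pair.Fubini'[OF m2, symmetric])
    also have "\<dots> \<le> (\<integral>\<^sup>+t. indicator {0..R} t * (\<integral>\<^sup>+y. F y \<partial>lborel) \<partial>lborel)"
    proof (rule nn_integral_mono)
      fix t :: real
      have "?S t \<le> (\<integral>\<^sup>+x. indicator {0..R} t * F (x + t *\<^sub>R e) \<partial>lborel)"
        by (intro nn_integral_mono) (auto simp: indicator_def)
      also have "\<dots> = indicator {0..R} t * (\<integral>\<^sup>+x. F (x + t *\<^sub>R e) \<partial>lborel)" by (rule nn_integral_cmult) measurable
      also have "(\<integral>\<^sup>+x. F (x + t *\<^sub>R e) \<partial>lborel) = (\<integral>\<^sup>+y. F y \<partial>lborel)" by (rule nn_integral_lborel_shift) measurable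
      finally show "?S t \<le> indicator {0..R} t * (\<integral>\<^sup>+y. F y \<partial>lborel)" .
    qed
    also have "\<dots> = ennreal R * (\<integral>\<^sup>+y. F y \<partial>lborel)"
      using R0 by (subst nn_integral_multc) auto
    finally show ?thesis .
  qed
  have "(\<integral>\<^sup>+x. ennreal ((norm (q x))\<^sup>2) * indicator K x \<partial>lborel)
    \<le> (\<integral>\<^sup>+x. 2 * (ennreal ((norm (q (x + \<tau> x *\<^sub>R e)))\<^sup>2) * indicator K x)
      + ennreal (2 * R) * ?L x \<partial>lborel)"
  proof (rule nn_integral_mono)
    fix x
    show "ennreal ((norm (q x))\<^sup>2) * indicator K x \<le> 2 * (ennreal ((norm (q (x + \<tau> x *\<^sub>R e)))\<^sup>2) * indicator K x)
      + ennreal (2 * R) * ?L x"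
      using pointwise[of x] by (cases "x \<in> K") auto
  qed
  also have "\<dots> = 2 * ?B
      + ennreal (2 * R) * (\<integral>\<^sup>+x. ?L x \<partial>lborel)"
  proof -
    have [measurable]: "(\<lambda>x. \<integral>\<^sup>+t. F (x + t *\<^sub>R e) * indicator {0..R} t * indicator K x \<partial>lborel) \<in> borel_measurable lborel"
      using lborel.borel_measurable_nn_integral_fst[OF m2] by simp
    show ?thesis by (subst nn_integral_add) (auto simp: nn_integral_cmult)
  qed
  also have "\<dots> \<le> 2 * ?B
      + ennreal (2 * R) * (ennreal R * (ennreal ((norm e)\<^sup>2) * ?D))"
    by (intro add_left_mono mult_left_mono order_trans[OF inner] F_le) auto
  also have "ennreal (2 * R) * (ennreal R * (ennreal ((norm e)\<^sup>2) * ?D))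
     = ennreal (2 * R\<^sup>2 * (norm e)\<^sup>2) * ?D"
    using R0 by (simp add: ennreal_mult power2_eq_square mult.assoc)
  finally show ?thesis .
qed simp

section \<open>Hausdorff measure is a Borel measure\<close>

lemma ennreal_suminf_tail_tendsto_0:
  fixes f :: "nat \<Rightarrow> ennreal"
  assumes "(\<Sum>i. f i) < top"
  shows "(\<lambda>n. \<Sum>i. f (i + n)) \<longlonglongrightarrow> 0"
proof -
  have fin: "\<And>i. f i < top" using assms by (rule ennreal_suminf_lessD)
  define r where "r i = enn2real (f i)" for i
  have fr: "f i = ennreal (r i)" for i using fin[of i] by (simp add: r_def)
  have r0: "0 \<le> r i" for i by (simp add: r_def)
  have sm: "summable r"
    by (rule summable_suminf_not_top) (use assms r0 in \<open>auto simp: fr\<close>)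
  have eq: "(\<Sum>i. f (i + n)) = ennreal (\<Sum>i. r (i + n))" for n
    unfolding fr by (rule suminf_ennreal2) (use r0 sm in \<open>auto simp: summable_iff_shift\<close>)
  have "(\<lambda>n. \<Sum>i. r (i + n)) = (\<lambda>n. suminf r - sum r {..<n})"
    using suminf_minus_initial_segment[OF sm] by auto
  moreover have "(\<lambda>n. suminf r - sum r {..<n}) \<longlonglongrightarrow> suminf r - suminf r"
    by (intro tendsto_intros summable_LIMSEQ sm)
  ultimately have "(\<lambda>n. \<Sum>i. r (i + n)) \<longlonglongrightarrow> 0" by simp
  then show ?thesis unfolding eq using tendsto_ennrealI by fastforce
qed

text \<open>An outer measure that is additive on sets at positive distance.\<close>

locale metric_outer_measure =
  fixes \<mu> :: "'a::metric_space set \<Rightarrow> ennreal"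
  assumes empty: "\<mu> {} = 0"
    and mono: "\<And>A B. A \<subseteq> B \<Longrightarrow> \<mu> A \<le> \<mu> B"
    and subadd: "\<And>A :: nat \<Rightarrow> 'a set. \<mu> (\<Union>i. A i) \<le> (\<Sum>i. \<mu> (A i))"
    and separated: "\<And>A B \<eta>. 0 < \<eta> \<Longrightarrow> (\<And>x y. x \<in> A \<Longrightarrow> y \<in> B \<Longrightarrow> \<eta> \<le> dist x y) \<Longrightarrow> \<mu> A + \<mu> B \<le> \<mu> (A \<union> B)"
begin

lemma subadd2: "\<mu> (A \<union> B) \<le> \<mu> A + \<mu> B"
proof -
  have "\<mu> (A \<union> B) = \<mu> (\<Union>i. if i = 0 then A else if i = Suc 0 then B else {})"
    by (rule arg_cong[where f=\<mu>]) (auto split: if_splits)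
  also have "\<dots> \<le> (\<Sum>i. \<mu> (if i = 0 then A else if i = Suc 0 then B else {}))"
    by (rule subadd)
  also have "\<dots> = (\<Sum>i\<in>{0, Suc 0}. \<mu> (if i = 0 then A else if i = Suc 0 then B else {}))"
    by (rule suminf_finite) (auto simp: empty)
  also have "\<dots> = \<mu> A + \<mu> B" by simp
  finally show ?thesis .
qed

text \<open>Caratheodory's argument. The part of \<open>A\<close> outside \<open>F\<close> is exhausted by the sets \<open>D n\<close> of points of
distance more than \<open>1 / (n + 1)\<close> from \<open>F\<close>, on which \<open>separated\<close> can be used. What is missing
consists of the annuli \<open>R k\<close>; annuli of equal parity have positive distance from each other,
so the sum of their measures is bounded by that of \<open>A\<close>, and the tails of the two sums tend to zero.\<close>

lemma closed_splits:
  assumes F: "closed F"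
  shows "\<mu> (A \<inter> F) + \<mu> (A - F) \<le> \<mu> A"
proof (cases "F = {} \<or> \<mu> A = top")
  case True
  then show ?thesis by (auto simp: empty top_greatest)
next
  case False
  then have ne: "F \<noteq> {}" and fin: "\<mu> A < top" by (auto simp: less_top)
  define D where "D n = {x \<in> A. infdist x F > 1 / real (Suc n)}" for n
  define R where "R n = {x \<in> A. 1 / real (Suc (Suc n)) < infdist x F \<and> infdist x F \<le> 1 / real (Suc n)}" for n
  have infl: "\<bar>infdist x F - infdist y F\<bar> \<le> dist x y" for x y
    using infdist_triangle[of x F y] infdist_triangle[of y F x] by (simp add: dist_commute)
  \<comment> \<open>The offset \<open>c\<close> selects the parity.\<close>
  have sum_le: "(\<Sum>i. \<mu> (R (2 * i + c))) \<le> \<mu> A" for c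
  proof -
    have "(\<Sum>i<n. \<mu> (R (2 * i + c))) \<le> \<mu> (\<Union>i<n. R (2 * i + c))" for n
    proof (induction n)
      case 0 show ?case by simp
    next
      case (Suc n)
      have "(\<Sum>i<Suc n. \<mu> (R (2 * i + c))) \<le> \<mu> (\<Union>i<n. R (2 * i + c)) + \<mu> (R (2 * n + c))"
        using Suc by (simp add: add_right_mono)
      also have "\<dots> \<le> \<mu> ((\<Union>i<n. R (2 * i + c)) \<union> R (2 * n + c))"
      proof (cases n)
        case 0 then show ?thesis by (simp add: empty)
      next
        case (Suc k)
        show ?thesis
        proof (rule separated)
          show "0 < 1 / real (2 * n + c) - 1 / real (Suc (2 * n + c))"
            using Suc by (intro diff_gt_0_iff_gt[THEN iffD2] divide_strict_left_mono) auto
          fix x y assume "x \<in> (\<Union>i<n. R (2 * i + c))" "y \<in> R (2 * n + c)"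
          then obtain i where i: "i < n" "1 / real (Suc (Suc (2 * i + c))) < infdist x F"
            "infdist y F \<le> 1 / real (Suc (2 * n + c))" by (auto simp: R_def)
          have "1 / real (2 * n + c) \<le> 1 / real (Suc (Suc (2 * i + c)))"
            using i(1) by (intro divide_left_mono) auto
          then show "1 / real (2 * n + c) - 1 / real (Suc (2 * n + c)) \<le> dist x y"
            using i infl[of x y] by linarith
        qed
      qed
      also have "(\<Union>i<n. R (2 * i + c)) \<union> R (2 * n + c) = (\<Union>i<Suc n. R (2 * i + c))"
        by (auto simp: less_Suc_eq)
      finally show ?case .
    qed
    moreover have "\<mu> (\<Union>i<n. R (2 * i + c)) \<le> \<mu> A" for n
      by (rule mono) (auto simp: R_def)
    ultimately show ?thesis
      unfolding suminf_eq_SUP by (intro SUP_least) (meson order_trans)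
  qed
  define t where "t c n = (\<Sum>i. \<mu> (R (2 * (i + n) + c)))" for c n
  have t0: "t c \<longlonglongrightarrow> 0" for c
    unfolding t_def
    by (rule ennreal_suminf_tail_tendsto_0[where f="\<lambda>i. \<mu> (R (2 * i + c))"]) (rule le_less_trans[OF sum_le fin])
  have bound: "\<mu> (A \<inter> F) + \<mu> (A - F) \<le> \<mu> A + (t 0 n + t 1 n)" for n
  proof -
    have "A - F \<subseteq> D (2 * n) \<union> ((\<Union>i. R (2 * (i + n) + 0)) \<union> (\<Union>i. R (2 * (i + n) + 1)))"
    proof
      fix x assume x: "x \<in> A - F"
      then have pos: "infdist x F > 0"
        using in_closed_iff_infdist_zero[OF F ne] infdist_nonneg[of x F] by (metis DiffD2 less_eq_real_def)
      have ex: "\<exists>k. 1 / real (Suc k) < infdist x F"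
        using reals_Archimedean[OF pos] by (simp add: inverse_eq_divide)
      define k where "k = (LEAST k. 1 / real (Suc k) < infdist x F)"
      have k1: "1 / real (Suc k) < infdist x F" unfolding k_def using ex by (rule LeastI_ex)
      have k2: "infdist x F \<le> 1 / real (Suc j)" if "j < k" for j
        using not_less_Least[OF that[unfolded k_def]] by (simp add: not_less)
      show "x \<in> D (2 * n) \<union> ((\<Union>i. R (2 * (i + n) + 0)) \<union> (\<Union>i. R (2 * (i + n) + 1)))"
      proof (cases "k \<le> 2 * n")
        case True
        then have "1 / real (Suc (2 * n)) \<le> 1 / real (Suc k)" by (intro divide_left_mono) auto
        then show ?thesis using k1 x by (auto simp: D_def)
      next
        case False
        define j where "j = k - 1 - 2 * n"
        have kj: "k = Suc (2 * n + j)" using False by (simp add: j_def)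
        have xR: "x \<in> R (2 * n + j)" using k1 k2[of "2 * n + j"] x by (auto simp: R_def kj)
        have "2 * n + j = 2 * (j div 2 + n) + 0 \<or> 2 * n + j = 2 * (j div 2 + n) + 1" by presburger
        then show ?thesis using xR by (metis UNIV_I UN_I UnCI)
      qed
    qed
    then have "\<mu> (A - F) \<le> \<mu> (D (2 * n) \<union> ((\<Union>i. R (2 * (i + n) + 0)) \<union> (\<Union>i. R (2 * (i + n) + 1))))"
      by (rule mono)
    also have "\<dots> \<le> \<mu> (D (2 * n)) + (\<mu> (\<Union>i. R (2 * (i + n) + 0)) + \<mu> (\<Union>i. R (2 * (i + n) + 1)))"
      by (rule order_trans[OF subadd2 add_left_mono[OF subadd2]])
    also have "\<dots> \<le> \<mu> (D (2 * n)) + (t 0 n + t 1 n)"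
      unfolding t_def by (rule add_left_mono[OF add_mono[OF subadd subadd]])
    finally have "\<mu> (A \<inter> F) + \<mu> (A - F) \<le> (\<mu> (A \<inter> F) + \<mu> (D (2 * n))) + (t 0 n + t 1 n)"
      by (simp add: add.assoc add_left_mono)
    also have "\<mu> (A \<inter> F) + \<mu> (D (2 * n)) \<le> \<mu> ((A \<inter> F) \<union> D (2 * n))"
    proof (rule separated)
      show "0 < 1 / real (Suc (2 * n))" by simp
      fix x y assume "x \<in> A \<inter> F" "y \<in> D (2 * n)"
      then show "1 / real (Suc (2 * n)) \<le> dist x y"
        using infl[of x y] infdist_zero[of x F] by (auto simp: D_def)
    qed
    also have "\<mu> ((A \<inter> F) \<union> D (2 * n)) \<le> \<mu> A" by (rule mono) (auto simp: D_def)
    finally show ?thesis by (simp add: add_right_mono)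
  qed
  have "(\<lambda>n. \<mu> A + (t 0 n + t 1 n)) \<longlonglongrightarrow> \<mu> A + (0 + 0)"
    by (intro tendsto_add tendsto_const t0)
  then show ?thesis
    using bound by (intro LIMSEQ_le_const[of _ "\<mu> A"]) auto
qed

lemma measure_space_borel: "measure_space UNIV (sets borel) \<mu>"
proof -
  interpret P: sigma_algebra UNIV "Pow UNIV :: 'a set set" by (rule sigma_algebra_Pow)
  have "outer_measure_space (Pow UNIV) \<mu>"
    by (auto simp: outer_measure_space_def positive_def increasing_def countably_subadditive_def empty mono subadd)
  from P.caratheodory_lemma[OF this]
  have ms: "measure_space UNIV (lambda_system UNIV (Pow UNIV) \<mu>) \<mu>" .
  then interpret L: sigma_algebra UNIV "lambda_system UNIV (Pow UNIV) \<mu>"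
    by (simp add: measure_space_def)
  have "F \<in> lambda_system UNIV (Pow UNIV) \<mu>" if "closed F" for F
  proof -
    have "\<mu> (A \<inter> F) + \<mu> (A - F) = \<mu> A" for A
      using closed_splits[OF that, of A] subadd2[of "A \<inter> F" "A - F"] by (simp only: Int_Diff_Un antisym)
    then show ?thesis unfolding P.lambda_system_eq by blast
  qed
  then have "sigma_sets UNIV (Collect closed) \<subseteq> lambda_system UNIV (Pow UNIV) \<mu>"
    by (intro L.sigma_sets_subset) auto
  then have sub: "sets borel \<subseteq> lambda_system UNIV (Pow UNIV) \<mu>"
    by (simp add: borel_eq_closed)
  show ?thesis
    using ms sub sets.sigma_algebra_axioms[of "borel :: 'a measure"]
    unfolding measure_space_def positive_def countably_additive_def by (auto simp: subset_eq)
qed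

end

definition hausdorff_covers :: "real \<Rightarrow> 'a::metric_space set \<Rightarrow> (nat \<Rightarrow> 'a set) set" where
  "hausdorff_covers \<delta> A = {C. A \<subseteq> (\<Union>n. C n) \<and> (\<forall>n. bounded (C n) \<and> diameter (C n) \<le> \<delta>)}"

text \<open>The inner infimum in the definition of \<open>hausdorff_outer\<close>.\<close>

definition hausdorff_content :: "nat \<Rightarrow> real \<Rightarrow> 'a::metric_space set \<Rightarrow> ennreal" where
  "hausdorff_content k \<delta> A = (INF C\<in>hausdorff_covers \<delta> A. \<Sum>n. hausdorff_weight k (C n))"

lemma hausdorff_outer_eq: "hausdorff_outer k A = (SUP \<delta>\<in>{0<..}. hausdorff_content k \<delta> A)"
  by (simp add: hausdorff_outer_def hausdorff_content_def hausdorff_covers_def)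

lemma hausdorff_content_le_outer: "0 < \<delta> \<Longrightarrow> hausdorff_content k \<delta> A \<le> hausdorff_outer k A"
  unfolding hausdorff_outer_eq by (rule SUP_upper) simp

lemma hausdorff_content_mono: "A \<subseteq> B \<Longrightarrow> hausdorff_content k \<delta> A \<le> hausdorff_content k \<delta> B"
  unfolding hausdorff_content_def hausdorff_covers_def by (intro INF_superset_mono) auto

lemma hausdorff_content_antimono: "\<delta> \<le> \<epsilon> \<Longrightarrow> hausdorff_content k \<epsilon> A \<le> hausdorff_content k \<delta> A"
  unfolding hausdorff_content_def hausdorff_covers_def
  by (intro INF_superset_mono) (auto intro: order_trans)

lemma hausdorff_content_subadd:
  fixes A :: "nat \<Rightarrow> 'a::metric_space set"
  shows "hausdorff_content k \<delta> (\<Union>i. A i) \<le> (\<Sum>i. hausdorff_content k \<delta> (A i))"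
proof (rule ennreal_le_epsilon)
  let ?O = "hausdorff_content k \<delta>" and ?w = "hausdorff_weight k"
  fix e :: real assume e: "0 < e" and fin: "(\<Sum>i. ?O (A i)) < top"
  then have "?O (A n) < ?O (A n) + e * (1/2)^Suc n" for n
    by (auto simp add: less_top dest!: ennreal_suminf_lessD)
  then have "\<exists>B\<in>hausdorff_covers \<delta> (A n). (\<Sum>i. ?w (B i)) < ?O (A n) + e * (1/2)^Suc n" for n
    unfolding hausdorff_content_def INF_less_iff by auto
  then obtain B where B: "\<And>n. B n \<in> hausdorff_covers \<delta> (A n)"
    and Ble: "\<And>n. (\<Sum>i. ?w (B n i)) < ?O (A n) + e * (1/2)^Suc n" by metis
  define C where "C = case_prod B o prod_decode"
  have "C \<in> hausdorff_covers \<delta> (\<Union>i. A i)"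
  proof -
    have "(\<Union>i. A i) \<subseteq> (\<Union>i. C i)"
    proof
      fix x assume "x \<in> (\<Union>i. A i)"
      then obtain i j where "x \<in> B i j" using B unfolding hausdorff_covers_def by blast
      then have "x \<in> C (prod_encode (i, j))" by (simp add: C_def)
      then show "x \<in> (\<Union>i. C i)" by blast
    qed
    then show ?thesis
      using B by (auto simp: C_def hausdorff_covers_def split: prod.splits)
  qed
  then have "?O (\<Union>i. A i) \<le> (\<Sum>i. ?w (C i))"
    unfolding hausdorff_content_def by (rule INF_lower)
  also have "\<dots> = (\<Sum>n. \<Sum>i. ?w (B n i))"
    unfolding C_def comp_def
    by (subst suminf_ennreal_2dimen[where f="\<lambda>p. ?w (case_prod B p)"]) auto
  also have "\<dots> \<le> (\<Sum>n. ?O (A n) + e * (1/2) ^ Suc n)"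
    by (intro suminf_le allI less_imp_le[OF Ble]) auto
  also have "\<dots> = (\<Sum>n. ?O (A n)) + (\<Sum>n. ennreal e * ennreal ((1/2) ^ Suc n))"
    using e by (subst suminf_add[symmetric])
               (auto simp del: ennreal_suminf_cmult simp add: ennreal_mult[symmetric])
  also have "\<dots> = (\<Sum>n. ?O (A n)) + e"
    unfolding ennreal_suminf_cmult
    by (subst suminf_ennreal_eq[OF zero_le_power power_half_series]) auto
  finally show "?O (\<Union>i. A i) \<le> (\<Sum>n. ?O (A n)) + e" .
qed

text \<open>A set of diameter at most \<open>\<delta>\<close> cannot meet both \<open>A\<close> and \<open>B\<close>, so a cover of the union splits into
covers of the two parts.\<close>

lemma hausdorff_content_separated:
  assumes sep: "\<And>x y. x \<in> A \<Longrightarrow> y \<in> B \<Longrightarrow> \<delta> < dist x y" and "0 < \<delta>"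
  shows "hausdorff_content k \<delta> A + hausdorff_content k \<delta> B \<le> hausdorff_content k \<delta> (A \<union> B)"
  unfolding hausdorff_content_def[of k \<delta> "A \<union> B"]
proof (rule INF_greatest)
  fix C assume C: "C \<in> hausdorff_covers \<delta> (A \<union> B)"
  define restr where "restr S n = (if C n \<inter> S = {} then {} else C n)" for S n
  have le: "hausdorff_content k \<delta> S \<le> (\<Sum>n. hausdorff_weight k (restr S n))" if "S \<subseteq> A \<union> B" for S
  proof -
    have "restr S \<in> hausdorff_covers \<delta> S"
      using C that \<open>0 < \<delta>\<close> unfolding hausdorff_covers_def restr_def by (auto; force)
    then show ?thesis unfolding hausdorff_content_def by (rule INF_lower)
  qed
  have dis: "restr A n = {} \<or> restr B n = {}" for n
  proof (rule ccontr)
    assume "\<not> ?thesis"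
    then obtain x y where "x \<in> C n" "x \<in> A" "y \<in> C n" "y \<in> B"
      by (auto simp: restr_def split: if_splits)
    moreover have "bounded (C n)" "diameter (C n) \<le> \<delta>" using C by (auto simp: hausdorff_covers_def)
    ultimately show False using sep[of x y] diameter_bounded_bound[of "C n" x y] by force
  qed
  have w: "hausdorff_weight k (restr A n) + hausdorff_weight k (restr B n) \<le> hausdorff_weight k (C n)" for n
    using dis[of n] by (cases "C n \<inter> A = {}"; cases "C n \<inter> B = {}") (simp_all add: restr_def hausdorff_weight_def)
  have "hausdorff_content k \<delta> A + hausdorff_content k \<delta> B
    \<le> (\<Sum>n. hausdorff_weight k (restr A n)) + (\<Sum>n. hausdorff_weight k (restr B n))"
    by (intro add_mono le) auto
  also have "\<dots> = (\<Sum>n. hausdorff_weight k (restr A n) + hausdorff_weight k (restr B n))"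
    by (rule suminf_add) auto
  also have "\<dots> \<le> (\<Sum>n. hausdorff_weight k (C n))"
    by (intro suminf_le w) auto
  finally show "hausdorff_content k \<delta> A + hausdorff_content k \<delta> B \<le> (\<Sum>n. hausdorff_weight k (C n))" .
qed

lemma metric_outer_measure_hausdorff: "metric_outer_measure (hausdorff_outer k)"
proof
  have "hausdorff_content k \<delta> ({} :: 'a set) \<le> 0" if "0 < \<delta>" for \<delta>
  proof -
    have "(\<lambda>n. {}) \<in> hausdorff_covers \<delta> ({} :: 'a set)" using that by (auto simp: hausdorff_covers_def)
    then have "hausdorff_content k \<delta> ({} :: 'a set) \<le> (\<Sum>n. hausdorff_weight k ({} :: 'a set))"
      unfolding hausdorff_content_def by (rule INF_lower)
    then show ?thesis by (simp add: hausdorff_weight_def)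
  qed
  then show "hausdorff_outer k ({} :: 'a set) = 0"
    unfolding hausdorff_outer_eq by (intro antisym SUP_least) auto
next
  fix A B :: "'a set" assume "A \<subseteq> B"
  then show "hausdorff_outer k A \<le> hausdorff_outer k B"
    unfolding hausdorff_outer_eq by (intro SUP_mono') (rule hausdorff_content_mono)
next
  fix A :: "nat \<Rightarrow> 'a set"
  have "hausdorff_content k \<delta> (\<Union>i. A i) \<le> (\<Sum>i. hausdorff_outer k (A i))" if "0 < \<delta>" for \<delta>
    using that by (intro order_trans[OF hausdorff_content_subadd] suminf_le hausdorff_content_le_outer) auto
  then show "hausdorff_outer k (\<Union>i. A i) \<le> (\<Sum>i. hausdorff_outer k (A i))"
    unfolding hausdorff_outer_eq[of k "\<Union>i. A i"] by (intro SUP_least) auto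
next
  fix A B :: "'a set" and \<eta> :: real
  assume eta: "0 < \<eta>" and sep: "\<And>x y. x \<in> A \<Longrightarrow> y \<in> B \<Longrightarrow> \<eta> \<le> dist x y"
  have le: "hausdorff_content k \<delta> A + hausdorff_content k \<epsilon> B \<le> hausdorff_outer k (A \<union> B)"
    if "0 < \<delta>" "0 < \<epsilon>" for \<delta> \<epsilon>
  proof -
    \<comment> \<open>Half of \<open>\<eta>\<close>, since \<open>hausdorff_content_separated\<close> needs a gap strictly larger than the scale.\<close>
    define \<theta> where "\<theta> = min (min \<delta> \<epsilon>) (\<eta> / 2)"
    have th: "0 < \<theta>" "\<theta> \<le> \<delta>" "\<theta> \<le> \<epsilon>" "\<theta> < \<eta>" using that eta by (auto simp: \<theta>_def)
    have "hausdorff_content k \<delta> A + hausdorff_content k \<epsilon> B \<le> hausdorff_content k \<theta> A + hausdorff_content k \<theta> B"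
      using th by (intro add_mono hausdorff_content_antimono) auto
    also have "\<dots> \<le> hausdorff_content k \<theta> (A \<union> B)"
      using th sep by (intro hausdorff_content_separated) force+
    also have "\<dots> \<le> hausdorff_outer k (A \<union> B)" using th by (intro hausdorff_content_le_outer)
    finally show ?thesis .
  qed
  have ne: "{0::real<..} \<noteq> {}" by (auto intro: exI[of _ 1])
  show "hausdorff_outer k A + hausdorff_outer k B \<le> hausdorff_outer k (A \<union> B)"
    unfolding hausdorff_outer_eq[of k A] hausdorff_outer_eq[of k B]
      ennreal_SUP_add_left[OF ne, symmetric] ennreal_SUP_add_right[OF ne]
    by (intro SUP_least le) auto
qed

lemma sets_hausdorff_measure [simp, measurable_cong]: "sets (hausdorff_measure k) = sets borel"
  and space_hausdorff_measure [simp]: "space (hausdorff_measure k) = UNIV"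
  using sets.sigma_sets_eq[of borel] by (auto simp: hausdorff_measure_def)

lemma emeasure_hausdorff_measure:
  assumes "A \<in> sets borel"
  shows "emeasure (hausdorff_measure k) A = hausdorff_outer k A"
  unfolding hausdorff_measure_def
  by (rule emeasure_measure_of_sigma)
     (use metric_outer_measure.measure_space_borel[OF metric_outer_measure_hausdorff, of k] assms
      in \<open>auto simp: measure_space_def\<close>)

section \<open>The boundary seen along a transversal direction\<close>

text \<open>The ratio between the weight of a set of diameter \<open>r\<close> and a bound for the volume of the tube of
length \<open>R\<close> over it; here \<open>n\<close> is the dimension of the space.\<close>

definition shadow_const :: "nat \<Rightarrow> real \<Rightarrow> real" where
  "shadow_const n R = unit_ball_vol (real (n - 1)) / (4 ^ n * R)"

text \<open>The tube over a set of diameter \<open>r \<le> R\<close> in a coordinate direction fits into a box with one side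
\<open>2 (R + r) \<le> 4 R\<close> and all other sides \<open>2 r\<close>. This covers the degenerate case \<open>r = 0\<close> in dimension
one, where the weight of a point is positive.\<close>

lemma hausdorff_weight_ge_tube:
  fixes S :: "'a::euclidean_space set"
  assumes e: "e \<in> Basis" "e' = e \<or> e' = - e" and R: "0 < R"
    and S: "bounded S" "diameter S \<le> R"
  shows "\<exists>T\<in>sets borel. {x. \<exists>t\<in>{0..R}. x + t *\<^sub>R e' \<in> S} \<subseteq> T \<and>
    ennreal (shadow_const DIM('a) R) * emeasure lborel T \<le> hausdorff_weight (DIM('a) - 1) S"
proof (cases "S = {}")
  case True
  then show ?thesis by (intro bexI[of _ "{}"]) auto
next
  case False
  then obtain c where c: "c \<in> S" by blast
  define r where "r = diameter S"
  have r: "0 \<le> r" "r \<le> R" using S by (auto simp: r_def diameter_ge_0)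
  define w where "w = (\<Sum>b\<in>Basis. (if b = e then R + r else r) *\<^sub>R b)"
  have w: "w \<bullet> b = (if b = e then R + r else r)" if "b \<in> Basis" for b
    using that by (simp add: w_def)
  have sub: "{x. \<exists>t\<in>{0..R}. x + t *\<^sub>R e' \<in> S} \<subseteq> cbox (c - w) (c + w)"
  proof
    fix x assume "x \<in> {x. \<exists>t\<in>{0..R}. x + t *\<^sub>R e' \<in> S}"
    then obtain t where t: "0 \<le> t" "t \<le> R" "x + t *\<^sub>R e' \<in> S" by auto
    have "dist (x + t *\<^sub>R e') c \<le> r" unfolding r_def by (rule diameter_bounded_bound[OF S(1) t(3) c])
    then have d: "\<bar>(x + t *\<^sub>R e' - c) \<bullet> b\<bar> \<le> r" if "b \<in> Basis" for b
      using Basis_le_norm[OF that, of "x + t *\<^sub>R e' - c"] by (simp add: dist_norm)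
    show "x \<in> cbox (c - w) (c + w)"
      unfolding mem_box
    proof (intro ballI)
      fix b :: 'a assume b: "b \<in> Basis"
      have eb: "e \<bullet> b = (if b = e then 1 else 0)" using e(1) b by (auto simp: inner_Basis)
      show "(c - w) \<bullet> b \<le> x \<bullet> b \<and> x \<bullet> b \<le> (c + w) \<bullet> b"
        using d[OF b] e(2) t eb by (auto simp: w[OF b] inner_add_left inner_diff_left abs_le_iff split: if_splits)
    qed
  qed
  have "emeasure lborel (cbox (c - w) (c + w)) = ennreal (\<Prod>b\<in>Basis. (c + w - (c - w)) \<bullet> b)"
    using r R by (subst emeasure_lborel_cbox_eq) (auto simp: inner_diff_left inner_add_left w)
  also have "(\<Prod>b\<in>Basis. (c + w - (c - w)) \<bullet> b) = (\<Prod>b\<in>(Basis::'a set). if b = e then 2 * (R + r) else 2 * r)"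
    by (rule prod.cong) (auto simp: inner_diff_left inner_add_left w)
  also have "\<dots> = 2 * (R + r) * (2 * r) ^ (DIM('a) - 1)"
    using e(1) by (subst prod.remove[OF finite_Basis e(1)]) (simp add: card_Diff_singleton)
  also have "ennreal (shadow_const DIM('a) R) * ennreal (2 * (R + r) * (2 * r) ^ (DIM('a) - 1))
      \<le> hausdorff_weight (DIM('a) - 1) S"
  proof -
    define k where "k = DIM('a) - 1"
    have k: "DIM('a) = Suc k" using DIM_positive[where 'a='a] by (simp add: k_def)
    let ?\<omega> = "unit_ball_vol (real k)"
    have om: "0 < ?\<omega>" by simp
    have "?\<omega> / (4 ^ Suc k * R) * (2 * (R + r) * (2 * r) ^ k) \<le> ?\<omega> / (4 ^ Suc k * R) * (4 * R * (2 * r) ^ k)"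
      using om r R by (intro mult_left_mono mult_right_mono) auto
    also have "\<dots> = ?\<omega> * ((2 * r) ^ k / 4 ^ k)" using R by (simp add: field_simps)
    also have "(2 * r) ^ k / 4 ^ k = (r / 2) ^ k" by (subst power_divide[symmetric]) simp
    finally have "?\<omega> / (4 ^ Suc k * R) * (2 * (R + r) * (2 * r) ^ k) \<le> ?\<omega> * (r / 2) ^ k" .
    then show ?thesis
      using False om r R unfolding shadow_const_def k_def[symmetric] k hausdorff_weight_def r_def[symmetric]
      by (simp add: ennreal_mult[symmetric] ennreal_leI del: power_Suc)
  qed
  finally show ?thesis using sub by (intro bexI[of _ "cbox (c - w) (c + w)"]) auto
qed

text \<open>A cover of \<open>A\<close> yields a cover of \<open>E\<close> by the tubes over its members.\<close>

lemma hausdorff_outer_ge_shadow: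
  fixes A :: "'a::euclidean_space set"
  assumes e: "e \<in> Basis" "e' = e \<or> e' = - e" and R: "0 < R"
    and E: "E \<in> sets lborel" "\<And>x. x \<in> E \<Longrightarrow> \<exists>t\<in>{0..R}. x + t *\<^sub>R e' \<in> A"
  shows "ennreal (shadow_const DIM('a) R) * emeasure lborel E \<le> hausdorff_outer (DIM('a) - 1) A"
proof -
  let ?c = "ennreal (shadow_const DIM('a) R)"
  have "?c * emeasure lborel E \<le> hausdorff_content (DIM('a) - 1) R A"
    unfolding hausdorff_content_def
  proof (rule INF_greatest)
    fix C assume C: "C \<in> hausdorff_covers R A"
    then have Cn: "bounded (C n)" "diameter (C n) \<le> R" for n
      unfolding hausdorff_covers_def by blast+
    have "\<forall>n. \<exists>T. T \<in> sets borel \<and> {x. \<exists>t\<in>{0..R}. x + t *\<^sub>R e' \<in> C n} \<subseteq> T \<and>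
        ?c * emeasure lborel T \<le> hausdorff_weight (DIM('a) - 1) (C n)"
      using hausdorff_weight_ge_tube[OF e R Cn] unfolding Bex_def by (rule allI)
    from choice[OF this] obtain T where "\<forall>n. T n \<in> sets borel \<and> {x. \<exists>t\<in>{0..R}. x + t *\<^sub>R e' \<in> C n} \<subseteq> T n \<and>
        ?c * emeasure lborel (T n) \<le> hausdorff_weight (DIM('a) - 1) (C n)" by (rule exE)
    then have T: "\<And>n. T n \<in> sets borel" "\<And>n. {x. \<exists>t\<in>{0..R}. x + t *\<^sub>R e' \<in> C n} \<subseteq> T n"
      "\<And>n. ?c * emeasure lborel (T n) \<le> hausdorff_weight (DIM('a) - 1) (C n)" by simp_all
    have AC: "A \<subseteq> (\<Union>n. C n)" using C by (simp add: hausdorff_covers_def)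
    have "E \<subseteq> (\<Union>n. T n)"
    proof
      fix x assume "x \<in> E"
      then obtain t where t: "t \<in> {0..R}" "x + t *\<^sub>R e' \<in> A" using E(2) by blast
      then obtain n where "x + t *\<^sub>R e' \<in> C n" using AC by blast
      then have "x \<in> T n" using T(2)[of n] t(1) by blast
      then show "x \<in> (\<Union>n. T n)" by blast
    qed
    then have "emeasure lborel E \<le> emeasure lborel (\<Union>n. T n)" using T(1) by (intro emeasure_mono) auto
    also have "\<dots> \<le> (\<Sum>n. emeasure lborel (T n))" using T(1) by (intro emeasure_subadditive_countably) auto
    finally have "?c * emeasure lborel E \<le> ?c * (\<Sum>n. emeasure lborel (T n))" by (rule mult_left_mono) simp
    also have "\<dots> = (\<Sum>n. ?c * emeasure lborel (T n))" by (rule ennreal_suminf_cmult[symmetric])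
    also have "\<dots> \<le> (\<Sum>n. hausdorff_weight (DIM('a) - 1) (C n))" by (intro suminf_le T(3)) auto
    finally show "?c * emeasure lborel E \<le> (\<Sum>n. hausdorff_weight (DIM('a) - 1) (C n))" .
  qed
  also have "\<dots> \<le> hausdorff_outer (DIM('a) - 1) A" by (rule hausdorff_content_le_outer[OF R])
  finally show ?thesis .
qed

text \<open>Near \<open>x0\<close> the defining function \<open>\<rho>\<close> of the domain increases strictly in the direction of a signed
basis vector \<open>e'\<close>, because some partial derivative of \<open>\<rho>\<close> at \<open>x0\<close> is not zero. Segments that start
in a small ball below \<open>x0\<close> therefore stay in the domain up to a unique zero of \<open>\<rho>\<close>, which is a
boundary point. A direction from the basis, rather than the normal, suits the boxes of
\<open>hausdorff_weight_ge_tube\<close>.\<close>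

lemma boundary_hitting_time:
  fixes \<Omega> :: "'a::euclidean_space set"
  assumes sm: "smooth_domain \<Omega>" and x0: "x0 \<in> frontier \<Omega>"
  obtains z \<delta> e e' R \<tau> where "0 < \<delta>" "ball z \<delta> \<subseteq> \<Omega>" "e \<in> Basis" "e' = e \<or> e' = - e" "0 < R"
    and "\<tau> \<in> borel_measurable borel" "\<And>x. x \<in> ball z \<delta> \<Longrightarrow> 0 \<le> \<tau> x \<and> \<tau> x \<le> R"
    and "\<And>x t. x \<in> ball z \<delta> \<Longrightarrow> 0 \<le> t \<Longrightarrow> t < \<tau> x \<Longrightarrow> x + t *\<^sub>R e' \<in> \<Omega>"
    and "\<And>x. x \<in> ball z \<delta> \<Longrightarrow> x + \<tau> x *\<^sub>R e' \<in> frontier \<Omega>"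
proof -
  have op: "open \<Omega>" using sm by (simp add: smooth_domain_def)
  obtain U and \<rho> :: "'a \<Rightarrow> real" where U: "open U" "x0 \<in> U" and \<rho>: "Cinf_on \<rho> U"
    and nz: "\<And>y. y \<in> U \<Longrightarrow> frechet_derivative \<rho> (at y) \<noteq> (\<lambda>v. 0)" and \<Omega>U: "\<Omega> \<inter> U = {y \<in> U. \<rho> y < 0}"
    using sm x0 unfolding smooth_domain_def by blast
  have C1: "Ck_on 1 \<rho> U" using \<rho> by (simp add: Cinf_on_def)
  have D: "(\<rho> has_derivative frechet_derivative \<rho> (at y)) (at y)" if "y \<in> U" for y
    using C1 that by (simp add: frechet_derivative_works[symmetric])
  have cont: "continuous_on U \<rho>" using Ck_on_SucD[of 0 \<rho> U] C1 by simp
  have lin: "linear (frechet_derivative \<rho> (at y))" if "y \<in> U" for y using has_derivative_linear[OF D[OF that]] .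
  have zero: "\<rho> x0 = 0"
  proof (rule ccontr)
    assume "\<rho> x0 \<noteq> 0"
    moreover have "x0 \<notin> \<Omega>" using op x0 frontier_disjoint_eq by blast
    ultimately have "0 < \<rho> x0" using \<Omega>U U(2) by force
    moreover have "open (U \<inter> \<rho> -` {0<..})" using cont U(1) by (intro continuous_open_preimage) auto
    moreover have "x0 \<in> closure \<Omega>" using x0 by (simp add: frontier_def)
    ultimately have "(U \<inter> \<rho> -` {0<..}) \<inter> \<Omega> \<noteq> {}"
      using U(2) by (metis IntI greaterThan_iff open_Int_closure_eq_empty vimageI emptyE)
    then show False using \<Omega>U by force
  qed
  obtain e where e: "e \<in> Basis" "frechet_derivative \<rho> (at x0) e \<noteq> 0"
  proof -
    have "\<exists>e\<in>Basis. frechet_derivative \<rho> (at x0) e \<noteq> 0"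
    proof (rule ccontr)
      assume "\<not> ?thesis"
      then have "frechet_derivative \<rho> (at x0) = (\<lambda>v. 0)"
        by (intro linear_eq_stdbasis lin U linear_zero) auto
      then show False using nz[OF U(2)] by simp
    qed
    then show ?thesis using that by blast
  qed
  define \<sigma> where "\<sigma> = sgn (frechet_derivative \<rho> (at x0) e)"
  define e' where "e' = \<sigma> *\<^sub>R e"
  have \<sigma>: "\<sigma> = 1 \<or> \<sigma> = - 1" using e(2) by (auto simp: \<sigma>_def sgn_real_def)
  have e': "e' = e \<or> e' = - e" using \<sigma> by (auto simp: e'_def)
  have ne: "norm e' = 1" using e' e(1) by auto
  have De': "frechet_derivative \<rho> (at y) e' = \<sigma> * frechet_derivative \<rho> (at y) e" if "y \<in> U" for y
    using linear_scale[OF lin[OF that]] by (simp add: e'_def)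
  have cD: "continuous_on U (\<lambda>y. \<sigma> * frechet_derivative \<rho> (at y) e)"
    using C1 e(1) by (auto intro!: continuous_intros)
  have "open (U \<inter> (\<lambda>y. \<sigma> * frechet_derivative \<rho> (at y) e) -` {0<..})"
    by (intro continuous_open_preimage cD U) auto
  moreover have "x0 \<in> U \<inter> (\<lambda>y. \<sigma> * frechet_derivative \<rho> (at y) e) -` {0<..}"
    using U(2) e(2) by (auto simp: \<sigma>_def sgn_real_def)
  ultimately obtain r where r: "0 < r" and "ball x0 r \<subseteq> U \<inter> (\<lambda>y. \<sigma> * frechet_derivative \<rho> (at y) e) -` {0<..}"
    unfolding open_contains_ball by blast
  then have BU: "ball x0 r \<subseteq> U" and pos: "\<And>y. y \<in> ball x0 r \<Longrightarrow> 0 < frechet_derivative \<rho> (at y) e'"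
    using De' by (auto simp: subset_eq)
  \<comment> \<open>Inside the ball \<open>\<rho>\<close> increases strictly along segments in direction \<open>e'\<close>.\<close>
  have incr: "\<rho> (x + s *\<^sub>R e') < \<rho> (x + t *\<^sub>R e')"
    if "s < t" and inb: "\<And>\<theta>. s \<le> \<theta> \<Longrightarrow> \<theta> \<le> t \<Longrightarrow> x + \<theta> *\<^sub>R e' \<in> ball x0 r" for x s t
  proof (rule DERIV_pos_imp_increasing[OF that(1)])
    fix \<theta> assume th: "s \<le> \<theta>" "\<theta> \<le> t"
    have inU: "x + \<theta> *\<^sub>R e' \<in> U" using inb[OF th] BU by blast
    have line: "((\<lambda>\<theta>. x + \<theta> *\<^sub>R e') has_derivative (\<lambda>h. h *\<^sub>R e')) (at \<theta>)"
      by (auto intro!: derivative_eq_intros)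
    from has_derivative_compose[OF line D[OF inU]]
    have "((\<lambda>\<theta>. \<rho> (x + \<theta> *\<^sub>R e')) has_real_derivative frechet_derivative \<rho> (at (x + \<theta> *\<^sub>R e')) e') (at \<theta>)"
      by (simp add: has_field_derivative_def linear_scale[OF lin[OF inU]] mult.commute[of _ "frechet_derivative \<rho> (at (x + \<theta> *\<^sub>R e')) e'"])
    then show "\<exists>y. ((\<lambda>\<theta>. \<rho> (x + \<theta> *\<^sub>R e')) has_real_derivative y) (at \<theta>) \<and> 0 < y"
      using pos[OF inb[OF th]] by blast
  qed
  define a where "a = r / 2"
  define ym where "ym = x0 - a *\<^sub>R e'"
  define yp where "yp = x0 + a *\<^sub>R e'"
  have inb0: "x0 + \<theta> *\<^sub>R e' \<in> ball x0 r" if "\<bar>\<theta>\<bar> \<le> a" for \<theta>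
    using that r ne by (simp add: dist_norm a_def)
  have neg: "\<rho> ym < 0"
    using incr[of "- a" 0 x0] inb0 r zero by (simp add: ym_def a_def)
  have posp: "0 < \<rho> yp"
    using incr[of 0 a x0] inb0 r zero by (simp add: yp_def a_def)
  have ymB: "ym \<in> ball x0 r" using inb0[of "- a"] r by (simp add: ym_def a_def)
  have ypB: "yp \<in> ball x0 r" using inb0[of a] r by (simp add: yp_def a_def)
  have contB: "continuous_on (ball x0 r) \<rho>" using cont BU continuous_on_subset by blast
  obtain d1 where d1: "0 < d1" "ball ym d1 \<subseteq> ball x0 r \<inter> \<rho> -` {..<0}"
    using continuous_open_preimage[OF contB open_ball open_lessThan[of 0]] neg ymB open_contains_ball_eq by (metis IntI lessThan_iff vimageI)
  obtain d2 where d2: "0 < d2" "ball yp d2 \<subseteq> ball x0 r \<inter> \<rho> -` {0<..}"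
    using continuous_open_preimage[OF contB open_ball open_greaterThan[of 0]] posp ypB open_contains_ball_eq by (metis IntI greaterThan_iff vimageI)
  define \<delta> where "\<delta> = min (r / 4) (min d1 d2)"
  have \<delta>: "0 < \<delta>" "\<delta> \<le> r / 4" "\<delta> \<le> d1" "\<delta> \<le> d2" using r d1 d2 by (auto simp: \<delta>_def)
  have inB: "x + t *\<^sub>R e' \<in> ball x0 r" if x: "x \<in> ball ym \<delta>" and t: "0 \<le> t" "t \<le> r" for x t
  proof -
    have "norm (x + t *\<^sub>R e' - x0) = norm ((x - ym) + (t - a) *\<^sub>R e')"
      by (simp add: ym_def algebra_simps)
    also have "\<dots> \<le> norm (x - ym) + \<bar>t - a\<bar>" using norm_triangle_ineq[of "x - ym" "(t - a) *\<^sub>R e'"] ne by simp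
    also have "\<dots> < r" using x \<delta> t r by (simp add: dist_norm norm_minus_commute a_def abs_if)
    finally show ?thesis by (simp add: dist_norm norm_minus_commute)
  qed
  have start: "\<rho> x < 0" if "x \<in> ball ym \<delta>" for x
    using that d1(2) \<delta>(3) by (auto simp: subset_eq)
  have final: "0 < \<rho> (x + r *\<^sub>R e')" if x: "x \<in> ball ym \<delta>" for x
  proof -
    have eq: "yp - (x + r *\<^sub>R e') = ym - x" by (simp add: ym_def yp_def a_def algebra_simps scaleR_add_left[symmetric])
    have "x + r *\<^sub>R e' \<in> ball yp \<delta>" using x by (simp only: mem_ball dist_norm eq)
    then show ?thesis using d2(2) \<delta>(4) by (auto simp: subset_eq)
  qed
  have ex: "\<exists>t. 0 < t \<and> t < r \<and> \<rho> (x + t *\<^sub>R e') = 0" if x: "x \<in> ball ym \<delta>" for x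
  proof -
    have "continuous_on {0..r} (\<lambda>t. \<rho> (x + t *\<^sub>R e'))"
      by (rule continuous_on_compose2[OF contB]) (auto intro!: continuous_intros inB[OF x])
    then obtain t where t: "0 \<le> t" "t \<le> r" "\<rho> (x + t *\<^sub>R e') = 0"
      using IVT'[of "\<lambda>t. \<rho> (x + t *\<^sub>R e')" 0 0 r] start[OF x] final[OF x] r by auto
    moreover have "t \<noteq> 0" "t \<noteq> r" using t(3) start[OF x] final[OF x] by auto
    ultimately show ?thesis by (intro exI[of _ t]) auto
  qed
  define \<tau> where "\<tau> x = (if x \<in> ball ym \<delta> then SOME t. 0 < t \<and> t < r \<and> \<rho> (x + t *\<^sub>R e') = 0 else 0)" for x
  have \<tau>: "0 < \<tau> x" "\<tau> x < r" "\<rho> (x + \<tau> x *\<^sub>R e') = 0" if "x \<in> ball ym \<delta>" for x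
    using someI_ex[OF ex[OF that]] that by (auto simp: \<tau>_def)
  \<comment> \<open>This describes the superlevel sets of \<open>\<tau>\<close> by the open set \<open>\<Omega>\<close> alone, whence \<open>\<tau>\<close> is measurable.\<close>
  have before: "t < \<tau> x \<longleftrightarrow> x + t *\<^sub>R e' \<in> \<Omega>" if x: "x \<in> ball ym \<delta>" and t: "0 \<le> t" "t \<le> r" for x t
  proof -
    have inU: "x + t *\<^sub>R e' \<in> U" using inB[OF x t] BU by blast
    then have "x + t *\<^sub>R e' \<in> \<Omega> \<longleftrightarrow> \<rho> (x + t *\<^sub>R e') < 0" using \<Omega>U by blast
    also have "\<dots> \<longleftrightarrow> t < \<tau> x"
    proof -
      have "\<rho> (x + t *\<^sub>R e') < \<rho> (x + \<tau> x *\<^sub>R e')" if "t < \<tau> x"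
        using that t \<tau>[OF x] by (intro incr inB[OF x]) auto
      moreover have "\<rho> (x + \<tau> x *\<^sub>R e') < \<rho> (x + t *\<^sub>R e')" if "\<tau> x < t"
        using that t \<tau>[OF x] by (intro incr inB[OF x]) auto
      ultimately show ?thesis using \<tau>[OF x] by (cases "t < \<tau> x"; cases "t = \<tau> x") auto
    qed
    finally show ?thesis by simp
  qed
  have meas: "\<tau> \<in> borel_measurable borel"
    unfolding borel_measurable_iff_greater
  proof
    fix s :: real
    have "{x. s < \<tau> x} \<in> sets borel"
    proof (cases "0 \<le> s \<and> s \<le> r")
      case True
      have "{x. s < \<tau> x} = ball ym \<delta> \<inter> (\<lambda>x. x + s *\<^sub>R e') -` \<Omega>"
        using before True by (auto simp: \<tau>_def[of x for x])
      moreover have "open ((\<lambda>x. x + s *\<^sub>R e') -` \<Omega>)"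
        by (intro open_vimage op continuous_intros)
      ultimately show ?thesis by auto
    next
      case False
      have "0 \<le> \<tau> x \<and> \<tau> x \<le> r" for x using \<tau>[of x] r by (cases "x \<in> ball ym \<delta>") (auto simp: \<tau>_def[of x])
      then have "s < \<tau> x \<longleftrightarrow> s < 0" for x using False by (smt (verit))
      then have "{x. s < \<tau> x} = {x. s < 0}" by simp
      then show ?thesis by simp
    qed
    then show "{w \<in> space borel. s < \<tau> w} \<in> sets borel" by simp
  qed
  have front: "x + \<tau> x *\<^sub>R e' \<in> frontier \<Omega>" if x: "x \<in> ball ym \<delta>" for x
  proof -
    have "x + \<tau> x *\<^sub>R e' \<notin> \<Omega>" using before[OF x, of "\<tau> x"] \<tau>[OF x] by simp
    moreover have "x + \<tau> x *\<^sub>R e' \<in> closure \<Omega>"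
      unfolding closure_approachable
    proof (intro allI impI)
      fix \<epsilon> :: real assume \<epsilon>: "0 < \<epsilon>"
      define t where "t = max 0 (\<tau> x - \<epsilon> / 2)"
      have t: "0 \<le> t" "t < \<tau> x" "\<tau> x - t < \<epsilon>" using \<epsilon> \<tau>[OF x] by (auto simp: t_def)
      then have "x + t *\<^sub>R e' \<in> \<Omega>" using before[OF x, of t] \<tau>[OF x] by simp
      moreover have "dist (x + t *\<^sub>R e') (x + \<tau> x *\<^sub>R e') < \<epsilon>"
        using t ne by (simp add: dist_norm scaleR_diff_left[symmetric])
      ultimately show "\<exists>y\<in>\<Omega>. dist y (x + \<tau> x *\<^sub>R e') < \<epsilon>" by blast
    qed
    ultimately show ?thesis using op by (simp add: frontier_def interior_open)
  qed
  show ?thesis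
  proof (rule that)
    show "ball ym \<delta> \<subseteq> \<Omega>" using start d1(2) \<delta>(3) BU \<Omega>U by (fastforce simp: subset_eq)
    show "x + t *\<^sub>R e' \<in> \<Omega>" if "x \<in> ball ym \<delta>" "0 \<le> t" "t < \<tau> x" for x t
      using before[of x t] \<tau>[of x] that by auto
    show "0 \<le> \<tau> x \<and> \<tau> x \<le> r" if "x \<in> ball ym \<delta>" for x using \<tau>[OF that] by simp
  qed (use \<delta> e e' r meas front in auto)
qed

text \<open>The image of Lebesgue measure on \<open>K\<close> under the map to the hitting point is, up to the constant, at
most the Hausdorff measure: on Borel sets this is \<open>hausdorff_outer_ge_shadow\<close>.\<close>

lemma surface_integral_ge_shadow_integral:
  fixes f :: "'a::euclidean_space \<Rightarrow> ennreal"
  assumes e: "e \<in> Basis" "e' = e \<or> e' = - e" and R: "0 < R"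
    and K [measurable]: "K \<in> sets borel" and \<tau> [measurable]: "\<tau> \<in> borel_measurable borel"
    and \<tau>R: "\<And>x. x \<in> K \<Longrightarrow> 0 \<le> \<tau> x \<and> \<tau> x \<le> R" and hit: "\<And>x. x \<in> K \<Longrightarrow> x + \<tau> x *\<^sub>R e' \<in> \<Gamma>"
    and \<Gamma> [measurable]: "\<Gamma> \<in> sets borel" and f [measurable]: "f \<in> borel_measurable borel"
  shows "ennreal (shadow_const DIM('a) R) * (\<integral>\<^sup>+x. f (x + \<tau> x *\<^sub>R e') * indicator K x \<partial>lborel)
    \<le> (\<integral>\<^sup>+y. f y \<partial>surface_measure \<Gamma>)"
proof -
  let ?c = "ennreal (shadow_const DIM('a) R)"
  let ?\<pi> = "\<lambda>x. x + \<tau> x *\<^sub>R e'"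
  define P where "P = distr (density lborel (indicator K)) borel ?\<pi>"
  have [measurable]: "?\<pi> \<in> borel_measurable borel" by measurable
  have le: "scale_measure ?c P \<le> hausdorff_measure (DIM('a) - 1)"
  proof (subst le_measure)
    show "sets (scale_measure ?c P) = sets (hausdorff_measure (DIM('a) - 1))" by (simp add: P_def)
    show "\<forall>A\<in>sets (scale_measure ?c P). emeasure (scale_measure ?c P) A \<le> emeasure (hausdorff_measure (DIM('a) - 1)) A"
    proof
      fix A assume "A \<in> sets (scale_measure ?c P)"
      then have A [measurable]: "A \<in> sets borel" by (simp add: P_def)
      have pm: "?\<pi> -` A \<in> sets borel" using measurable_sets[OF \<open>?\<pi> \<in> borel_measurable borel\<close> A] by simp
      have "emeasure P A = emeasure (density lborel (indicator K)) (?\<pi> -` A)"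
        unfolding P_def by (subst emeasure_distr) auto
      also have "\<dots> = emeasure lborel (K \<inter> ?\<pi> -` A)"
        using pm by (subst emeasure_density) (auto simp: indicator_inter_arith[symmetric])
      finally have "emeasure (scale_measure ?c P) A = ?c * emeasure lborel (K \<inter> ?\<pi> -` A)" by simp
      also have "\<dots> \<le> hausdorff_outer (DIM('a) - 1) A"
        by (rule hausdorff_outer_ge_shadow[OF e R]) (use pm \<tau>R in auto)
      finally show "emeasure (scale_measure ?c P) A \<le> emeasure (hausdorff_measure (DIM('a) - 1)) A"
        by (simp add: emeasure_hausdorff_measure)
    qed
  qed
  have "?c * (\<integral>\<^sup>+x. f (?\<pi> x) * indicator K x \<partial>lborel) = ?c * (\<integral>\<^sup>+x. f (?\<pi> x) * indicator \<Gamma> (?\<pi> x) * indicator K x \<partial>lborel)"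
    using hit by (intro arg_cong[where f="\<lambda>x. ?c * x"] nn_integral_cong) (auto simp: indicator_def)
  also have "(\<integral>\<^sup>+x. f (?\<pi> x) * indicator \<Gamma> (?\<pi> x) * indicator K x \<partial>lborel) = (\<integral>\<^sup>+x. f (?\<pi> x) * indicator \<Gamma> (?\<pi> x) \<partial>density lborel (indicator K))"
    by (subst nn_integral_density) (auto simp: mult.commute)
  also have "\<dots> = (\<integral>\<^sup>+y. f y * indicator \<Gamma> y \<partial>P)"
    unfolding P_def by (subst nn_integral_distr) auto
  also have "?c * \<dots> = (\<integral>\<^sup>+y. f y * indicator \<Gamma> y \<partial>scale_measure ?c P)"
    by (subst nn_integral_scale_measure) (auto simp: P_def)
  also have "\<dots> \<le> (\<integral>\<^sup>+y. f y * indicator \<Gamma> y \<partial>hausdorff_measure (DIM('a) - 1))"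
    by (rule nn_integral_mono_measure[OF _ le]) (simp add: P_def)
  also have "\<dots> = (\<integral>\<^sup>+y. f y \<partial>surface_measure \<Gamma>)"
    unfolding surface_measure_def by (subst nn_integral_restrict_space) auto
  finally show ?thesis .
qed

section \<open>A function with vanishing gradient and vanishing trace\<close>

lemma L2_sq_lebesgue_on:
  "S \<in> sets lebesgue \<Longrightarrow> L2_sq (lebesgue_on S) f = (\<integral>\<^sup>+x. ennreal ((norm (f x))\<^sup>2) * indicator S x \<partial>lborel)"
  unfolding L2_sq_def by (rule nn_integral_lebesgue_on)

lemma L2_sq_lebesgue_on_mono:
  "S \<subseteq> T \<Longrightarrow> S \<in> sets lebesgue \<Longrightarrow> T \<in> sets lebesgue \<Longrightarrow> L2_sq (lebesgue_on S) f \<le> L2_sq (lebesgue_on T) f"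
  by (auto simp: L2_sq_lebesgue_on indicator_def intro!: nn_integral_mono)

lemma measurable_lebesgue_on_subset:
  fixes f :: "'a::euclidean_space \<Rightarrow> 'b::euclidean_space"
  assumes "f \<in> borel_measurable (lebesgue_on T)" "S \<subseteq> T"
  shows "f \<in> borel_measurable (lebesgue_on S)"
  using measurable_restrict_mono[OF assms] .

lemma L2_sq_approx_le:
  assumes "f \<in> borel_measurable M" "g \<in> borel_measurable M"
  shows "L2_sq M f \<le> 2 * L2_sq M g + 2 * L2_sq M (\<lambda>x. f x - g x)"
  using L2_sq_add_le[of g M "\<lambda>x. f x - g x"] assms by simp

text \<open>That \<open>v\<close> has gradient zero is expressed by \<open>C\<^sup>1\<close> approximations, since these also carry its trace.\<close>

locale vanishing_gradient_limit =
  fixes \<Omega> :: "(real^'d) set" and q :: "nat \<Rightarrow> real^'d \<Rightarrow> real^'m" and v :: "real^'d \<Rightarrow> real^'m"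
  assumes op: "open \<Omega>" and q: "\<And>n. Ck_on 1 (q n) UNIV" and v: "v \<in> L2 (lebesgue_on \<Omega>)"
    and conv: "(\<lambda>n. L2_sq (lebesgue_on \<Omega>) (\<lambda>x. q n x - v x)) \<longlonglongrightarrow> 0"
    and grad: "(\<lambda>n. L2_sq (lebesgue_on \<Omega>) (classical_grad (q n))) \<longlonglongrightarrow> 0"
begin

lemma v_measurable: "S \<subseteq> \<Omega> \<Longrightarrow> v \<in> borel_measurable (lebesgue_on S)"
  using v measurable_lebesgue_on_subset by (auto simp: L2_def)

lemma q_measurable: "q n \<in> borel_measurable (lebesgue_on S)"
  by (rule continuous_measurable_lebesgue_on[OF C1_continuous[OF q]])

lemma L2_sq_compare_approximant:
  assumes S: "S \<subseteq> \<Omega>" "S \<in> sets lebesgue"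
  shows "L2_sq (lebesgue_on S) v \<le> 2 * L2_sq (lebesgue_on S) (q n) + 2 * L2_sq (lebesgue_on \<Omega>) (\<lambda>x. q n x - v x)"
    and "L2_sq (lebesgue_on S) (q n) \<le> 2 * L2_sq (lebesgue_on S) v + 2 * L2_sq (lebesgue_on \<Omega>) (\<lambda>x. q n x - v x)"
proof -
  have le: "L2_sq (lebesgue_on S) (\<lambda>x. q n x - v x) \<le> L2_sq (lebesgue_on \<Omega>) (\<lambda>x. q n x - v x)"
    using S op by (intro L2_sq_lebesgue_on_mono) auto
  have "L2_sq (lebesgue_on S) v \<le> 2 * L2_sq (lebesgue_on S) (q n) + 2 * L2_sq (lebesgue_on S) (\<lambda>x. v x - q n x)"
    by (rule L2_sq_approx_le[OF v_measurable[OF S(1)] q_measurable])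
  also have "L2_sq (lebesgue_on S) (\<lambda>x. v x - q n x) = L2_sq (lebesgue_on S) (\<lambda>x. q n x - v x)" by (rule L2_sq_minus_commute)
  finally show "L2_sq (lebesgue_on S) v \<le> 2 * L2_sq (lebesgue_on S) (q n) + 2 * L2_sq (lebesgue_on \<Omega>) (\<lambda>x. q n x - v x)"
    using le by (meson add_left_mono mult_left_mono order_trans zero_le)
  have "L2_sq (lebesgue_on S) (q n) \<le> 2 * L2_sq (lebesgue_on S) v + 2 * L2_sq (lebesgue_on S) (\<lambda>x. q n x - v x)"
    by (rule L2_sq_approx_le[OF q_measurable v_measurable[OF S(1)]])
  then show "L2_sq (lebesgue_on S) (q n) \<le> 2 * L2_sq (lebesgue_on S) v + 2 * L2_sq (lebesgue_on \<Omega>) (\<lambda>x. q n x - v x)"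
    using le by (meson add_left_mono mult_left_mono order_trans zero_le)
qed

text \<open>The limit of \<open>C1_moving_endpoint_estimate\<close>: the gradients disappear, and the masses \<open>I n\<close> at the
displaced points are left.\<close>

lemma moving_endpoint_bound:
  assumes K: "K \<in> sets borel" "K \<subseteq> \<Omega>" and \<tau>: "\<tau> \<in> borel_measurable borel"
    and \<tau>R: "\<And>x. x \<in> K \<Longrightarrow> 0 \<le> \<tau> x \<and> \<tau> x \<le> R"
    and seg: "\<And>x t. x \<in> K \<Longrightarrow> 0 \<le> t \<Longrightarrow> t < \<tau> x \<Longrightarrow> x + t *\<^sub>R e \<in> \<Omega>"
    and I: "\<And>n. (\<integral>\<^sup>+x. ennreal ((norm (q n (x + \<tau> x *\<^sub>R e)))\<^sup>2) * indicator K x \<partial>lborel) \<le> I n" "I \<longlonglongrightarrow> J"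
  shows "L2_sq (lebesgue_on K) v \<le> 4 * J"
proof -
  define a where "a n = L2_sq (lebesgue_on \<Omega>) (\<lambda>x. q n x - v x)" for n
  define c where "c n = L2_sq (lebesgue_on \<Omega>) (classical_grad (q n))" for n
  have Kl: "K \<in> sets lebesgue" using K(1) by auto
  have "L2_sq (lebesgue_on K) v \<le> 2 * (2 * I n + ennreal (2 * R\<^sup>2 * (norm e)\<^sup>2) * c n) + 2 * a n" for n
  proof -
    have "L2_sq (lebesgue_on K) (q n) \<le> 2 * I n + ennreal (2 * R\<^sup>2 * (norm e)\<^sup>2) * c n"
      unfolding L2_sq_lebesgue_on[OF Kl] c_def
      using C1_moving_endpoint_estimate[OF q op K(1) \<tau> \<tau>R seg, of n] I(1)[of n]
      by (meson add_right_mono mult_left_mono order_trans zero_le)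
    then show ?thesis
      using L2_sq_compare_approximant(1)[OF K(2) Kl, of n] unfolding a_def
      by (meson add_right_mono mult_left_mono order_trans zero_le)
  qed
  moreover have "(\<lambda>n. 2 * (2 * I n + ennreal (2 * R\<^sup>2 * (norm e)\<^sup>2) * c n) + 2 * a n)
     \<longlonglongrightarrow> 2 * (2 * J + ennreal (2 * R\<^sup>2 * (norm e)\<^sup>2) * 0) + 2 * 0"
    by (intro tendsto_add ennreal_tendsto_cmult I(2) conv[folded a_def] grad[folded c_def]) auto
  ultimately have "L2_sq (lebesgue_on K) v \<le> 2 * (2 * J + ennreal (2 * R\<^sup>2 * (norm e)\<^sup>2) * 0) + 2 * 0"
    by (intro LIMSEQ_le_const) auto
  also have "\<dots> = (2 * 2) * J" by (simp only: mult.assoc mult_zero_right add_0_right)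
  finally show ?thesis by simp
qed

lemma translation_bound:
  assumes seg: "\<And>x t. x \<in> K \<Longrightarrow> 0 \<le> t \<Longrightarrow> t \<le> 1 \<Longrightarrow> x + t *\<^sub>R h \<in> \<Omega>"
    and K: "K \<in> sets borel" "K' \<in> sets borel" "\<And>x. x + h \<in> K' \<longleftrightarrow> x \<in> K"
  shows "L2_sq (lebesgue_on K) v \<le> 8 * L2_sq (lebesgue_on K') v"
proof -
  have sub: "K \<subseteq> \<Omega>" using seg[of _ 0] by auto
  have sub': "K' \<subseteq> \<Omega>"
  proof
    fix y assume "y \<in> K'"
    then have "y - h \<in> K" using K(3)[of "y - h"] by simp
    then show "y \<in> \<Omega>" using seg[of "y - h" 1] by simp
  qed
  have Kl: "K' \<in> sets lebesgue" using K(2) by auto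
  have [measurable]: "q n \<in> borel_measurable borel" for n
    using C1_continuous[OF q] by (auto intro: borel_measurable_continuous_onI)
  note [measurable] = K(1,2)
  have eq: "(\<integral>\<^sup>+x. ennreal ((norm (q n (x + 1 *\<^sub>R h)))\<^sup>2) * indicator K x \<partial>lborel) = L2_sq (lebesgue_on K') (q n)" for n
  proof -
    have "(\<integral>\<^sup>+x. ennreal ((norm (q n (x + 1 *\<^sub>R h)))\<^sup>2) * indicator K x \<partial>lborel)
      = (\<integral>\<^sup>+x. ennreal ((norm (q n (x + h)))\<^sup>2) * indicator K' (x + h) \<partial>lborel)"
      using K(3) by (intro nn_integral_cong) (auto simp: indicator_def)
    also have "\<dots> = (\<integral>\<^sup>+x. ennreal ((norm (q n x))\<^sup>2) * indicator K' x \<partial>lborel)"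
      by (rule nn_integral_lborel_shift[of "\<lambda>x. ennreal ((norm (q n x))\<^sup>2) * indicator K' x"]) measurable
    finally show ?thesis by (simp add: L2_sq_lebesgue_on[OF Kl])
  qed
  have "L2_sq (lebesgue_on K) v \<le> 4 * (2 * L2_sq (lebesgue_on K') v + 2 * 0)"
  proof (rule moving_endpoint_bound[where \<tau>="\<lambda>_. 1" and R=1 and e=h])
    show "(\<integral>\<^sup>+x. ennreal ((norm (q n (x + 1 *\<^sub>R h)))\<^sup>2) * indicator K x \<partial>lborel) \<le>
       2 * L2_sq (lebesgue_on K') v + 2 * L2_sq (lebesgue_on \<Omega>) (\<lambda>x. q n x - v x)" for n
      unfolding eq by (rule L2_sq_compare_approximant(2)[OF sub' Kl])
    show "(\<lambda>n. 2 * L2_sq (lebesgue_on K') v + 2 * L2_sq (lebesgue_on \<Omega>) (\<lambda>x. q n x - v x)) \<longlonglongrightarrow> 2 * L2_sq (lebesgue_on K') v + 2 * 0"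
      by (intro tendsto_add tendsto_const ennreal_tendsto_cmult conv) auto
  qed (use K sub seg in auto)
  also have "\<dots> = (4 * 2) * L2_sq (lebesgue_on K') v" by (simp only: mult.assoc mult_zero_right add_0_right)
  finally show ?thesis by simp
qed

lemma zero_on_ball_from_ball:
  assumes "ball x r \<subseteq> \<Omega>" "z \<in> ball x (r / 2)" "s \<le> r / 2" "L2_sq (lebesgue_on (ball z s)) v = 0"
  shows "L2_sq (lebesgue_on (ball x s)) v = 0"
proof -
  have "L2_sq (lebesgue_on (ball x s)) v \<le> 8 * L2_sq (lebesgue_on (ball z s)) v"
  proof (rule translation_bound[where h="z - x"])
    show "y + (z - x) \<in> ball z s \<longleftrightarrow> y \<in> ball x s" for y
      by (simp add: dist_norm algebra_simps)
    fix y and t :: real assume y: "y \<in> ball x s" and t: "0 \<le> t" "t \<le> 1"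
    have "norm (y + t *\<^sub>R (z - x) - x) = norm ((y - x) + t *\<^sub>R (z - x))" by (simp add: algebra_simps)
    also have "\<dots> \<le> norm (y - x) + t * norm (z - x)" using norm_triangle_ineq[of "y - x" "t *\<^sub>R (z - x)"] t by simp
    also have "t * norm (z - x) \<le> norm (z - x)" using t by (simp add: mult_left_le_one_le)
    also have "norm (y - x) + norm (z - x) < r" using y assms(2,3) by (simp add: dist_norm norm_minus_commute)
    finally show "y + t *\<^sub>R (z - x) \<in> \<Omega>" using assms(1) by (auto simp: subset_eq dist_norm norm_minus_commute)
  qed auto
  then show ?thesis using assms(4) by simp
qed

text \<open>The set of centres of balls on which \<open>v\<close> vanishes is open. It is closed in \<open>\<Omega>\<close> because such a ball,
shrunk if necessary, can be translated to any centre near its own inside a larger ball in \<open>\<Omega>\<close>.\<close>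

lemma zero_from_ball:
  assumes conn: "connected \<Omega>" and z: "0 < s0" "ball z s0 \<subseteq> \<Omega>" "L2_sq (lebesgue_on (ball z s0)) v = 0"
  shows "AE x in lebesgue_on \<Omega>. v x = 0"
proof -
  define Z where "Z = {x. \<exists>s>0. ball x s \<subseteq> \<Omega> \<and> L2_sq (lebesgue_on (ball x s)) v = 0}"
  have Z\<Omega>: "Z \<subseteq> \<Omega>" by (auto simp: Z_def subset_eq)
  have openZ: "open Z"
    unfolding open_contains_ball
  proof
    fix x assume "x \<in> Z"
    then obtain s where s: "0 < s" "ball x s \<subseteq> \<Omega>" "L2_sq (lebesgue_on (ball x s)) v = 0" by (auto simp: Z_def)
    have "y \<in> Z" if y: "y \<in> ball x s" for y
    proof -
      have sub: "ball y (s - dist x y) \<subseteq> ball x s"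
        by (metis add_diff_cancel_left' ball_subset_ball_iff dist_commute diff_add_cancel le_diff_eq order_refl)
      then have "L2_sq (lebesgue_on (ball y (s - dist x y))) v \<le> L2_sq (lebesgue_on (ball x s)) v"
        by (intro L2_sq_lebesgue_on_mono) auto
      then show "y \<in> Z" using y s sub by (auto simp: Z_def intro!: exI[of _ "s - dist x y"])
    qed
    then show "\<exists>e>0. ball x e \<subseteq> Z" using s(1) by blast
  qed
  have openC: "open (\<Omega> - Z)"
    unfolding open_contains_ball
  proof
    fix x assume x: "x \<in> \<Omega> - Z"
    then obtain r where r: "0 < r" "ball x r \<subseteq> \<Omega>" using op open_contains_ball by blast
    have "y \<notin> Z" if y: "y \<in> ball x (r / 2)" for y
    proof
      assume "y \<in> Z"
      then obtain s where s: "0 < s" "ball y s \<subseteq> \<Omega>" "L2_sq (lebesgue_on (ball y s)) v = 0" by (auto simp: Z_def)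
      define s' where "s' = min s (r / 2)"
      have "L2_sq (lebesgue_on (ball y s')) v \<le> L2_sq (lebesgue_on (ball y s)) v"
        by (intro L2_sq_lebesgue_on_mono) (auto simp: s'_def)
      then have "L2_sq (lebesgue_on (ball x s')) v = 0"
        using s(3) by (intro zero_on_ball_from_ball[OF r(2) y]) (auto simp: s'_def)
      moreover have "0 < s'" "ball x s' \<subseteq> \<Omega>" using r s by (auto simp: s'_def subset_eq)
      ultimately have "x \<in> Z" by (auto simp: Z_def)
      then show False using x by simp
    qed
    moreover have "ball x (r / 2) \<subseteq> \<Omega>" using r by (auto simp: subset_eq)
    ultimately show "\<exists>e>0. ball x e \<subseteq> \<Omega> - Z" using r(1) by (intro exI[of _ "r / 2"]) auto
  qed
  have "z \<in> Z" using z by (auto simp: Z_def)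
  have "Z = \<Omega>"
  proof (rule ccontr)
    assume "Z \<noteq> \<Omega>"
    then have "\<Omega> - Z \<noteq> {}" using Z\<Omega> by blast
    then show False
      using connectedD[OF conn openZ openC] \<open>z \<in> Z\<close> Z\<Omega> by blast
  qed
  define \<F> where "\<F> = {ball x s |x s. ball x s \<subseteq> \<Omega> \<and> L2_sq (lebesgue_on (ball x s)) v = 0}"
  have "\<Union>\<F> = \<Omega>"
  proof
    show "\<Union>\<F> \<subseteq> \<Omega>" by (auto simp: \<F>_def)
    show "\<Omega> \<subseteq> \<Union>\<F>"
    proof
      fix x assume "x \<in> \<Omega>"
      then have "x \<in> Z" using \<open>Z = \<Omega>\<close> by simp
      then obtain s where s: "0 < s" "ball x s \<subseteq> \<Omega>" "L2_sq (lebesgue_on (ball x s)) v = 0"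
        by (auto simp: Z_def)
      then have "ball x s \<in> \<F>" unfolding \<F>_def by blast
      then show "x \<in> \<Union>\<F>" using s(1) by (metis UnionI centre_in_ball)
    qed
  qed
  moreover have "\<And>S. S \<in> \<F> \<Longrightarrow> open S" by (auto simp: \<F>_def)
  then obtain \<F>' where F': "\<F>' \<subseteq> \<F>" "countable \<F>'" "\<Union>\<F>' = \<Union>\<F>" using Lindelof by metis
  have "AE x in lebesgue. x \<in> S \<longrightarrow> v x = 0" if S: "S \<in> \<F>'" for S
  proof -
    obtain x s where xs: "S = ball x s" "ball x s \<subseteq> \<Omega>" "L2_sq (lebesgue_on (ball x s)) v = 0"
      using S F'(1) by (auto simp: \<F>_def)
    have "AE x in lebesgue_on S. v x = 0"
      using L2_sq_zero_iff[OF v_measurable[OF xs(2)]] xs(3) unfolding xs(1) by blast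
    then show ?thesis by (subst (asm) AE_restrict_space_iff) (auto simp: xs(1))
  qed
  then have "AE x in lebesgue. \<forall>S\<in>\<F>'. x \<in> S \<longrightarrow> v x = 0"
    using F'(2) by (subst AE_ball_countable) auto
  then have "AE x in lebesgue. x \<in> \<Omega> \<longrightarrow> v x = 0"
    by eventually_elim (use F'(3) calculation in blast)
  then show ?thesis using op by (subst AE_restrict_space_iff) auto
qed

text \<open>All unit balls carry comparable masses of \<open>v\<close>, but the masses of balls that move to infinity tend
to zero because \<open>v\<close> is square integrable.\<close>

lemma zero_on_whole_space:
  assumes UNIV: "\<Omega> = UNIV"
  shows "L2_sq (lebesgue_on (ball 0 1)) v = 0"
proof -
  obtain e :: "real^'d" where e: "norm e = 1" using vector_choose_size[of 1] by auto
  define c where "c n = real n *\<^sub>R e" for n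
  have le: "L2_sq (lebesgue_on (ball 0 1)) v \<le> 8 * L2_sq (lebesgue_on (ball (c n) 1)) v" for n
    by (rule translation_bound[where h="c n"]) (auto simp: UNIV dist_norm algebra_simps)
  have "(\<lambda>n. L2_sq (lebesgue_on \<Omega>) (\<lambda>x. indicat_real (ball (c n) 1) x *\<^sub>R v x)) \<longlonglongrightarrow> 0"
  proof (rule L2_sq_dominated_tendsto_0[OF _ v])
    have [measurable]: "v \<in> borel_measurable (lebesgue_on \<Omega>)" by (rule v_measurable) simp
    show "(\<lambda>x. indicat_real (ball (c n) 1) x *\<^sub>R v x) \<in> borel_measurable (lebesgue_on \<Omega>)" for n
      by (intro borel_measurable_scaleR borel_measurable_indicator v_measurable order_refl measurable_restrict_space1)
         (simp add: UNIV)
    show "AE x in lebesgue_on \<Omega>. norm (indicat_real (ball (c n) 1) x *\<^sub>R v x) \<le> norm (v x)" for n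
      by (auto simp: indicator_def)
    show "AE x in lebesgue_on \<Omega>. (\<lambda>n. indicat_real (ball (c n) 1) x *\<^sub>R v x) \<longlonglongrightarrow> 0"
    proof (rule AE_I2)
      fix x :: "real^'d"
      obtain N :: nat where N: "norm x + 1 < real N" using reals_Archimedean2 by blast
      have "indicat_real (ball (c n) 1) x *\<^sub>R v x = 0" if "n \<ge> N" for n
      proof -
        have "real n = norm (c n)" by (simp add: c_def e)
        also have "\<dots> \<le> dist (c n) x + norm x" using norm_triangle_sub[of "c n" x] by (simp add: dist_norm)
        finally have "x \<notin> ball (c n) 1" using N that by simp
        then show ?thesis by simp
      qed
      then show "(\<lambda>n. indicat_real (ball (c n) 1) x *\<^sub>R v x) \<longlonglongrightarrow> 0"
        by (intro tendsto_eventually) (auto simp: eventually_sequentially)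
    qed
  qed
  moreover have "L2_sq (lebesgue_on \<Omega>) (\<lambda>x. indicat_real (ball (c n) 1) x *\<^sub>R v x) = L2_sq (lebesgue_on (ball (c n) 1)) v" for n
  proof -
    have "L2_sq (lebesgue_on \<Omega>) (\<lambda>x. indicat_real (ball (c n) 1) x *\<^sub>R v x) =
      (\<integral>\<^sup>+x. ennreal ((norm (indicat_real (ball (c n) 1) x *\<^sub>R v x))\<^sup>2) * indicator \<Omega> x \<partial>lborel)"
      by (rule L2_sq_lebesgue_on) (simp add: UNIV)
    also have "\<dots> = L2_sq (lebesgue_on (ball (c n) 1)) v"
      by (subst L2_sq_lebesgue_on) (auto simp: UNIV indicator_def intro!: nn_integral_cong)
    finally show ?thesis .
  qed
  ultimately have "(\<lambda>n. L2_sq (lebesgue_on (ball (c n) 1)) v) \<longlonglongrightarrow> 0" by simp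
  then have "(\<lambda>n. 8 * L2_sq (lebesgue_on (ball (c n) 1)) v) \<longlonglongrightarrow> 8 * 0" by (intro ennreal_tendsto_cmult) auto
  then have "L2_sq (lebesgue_on (ball 0 1)) v \<le> 0"
    using le by (intro LIMSEQ_le_const[of _ "0::ennreal"]) auto
  then show ?thesis by simp
qed

lemma zero_near_boundary:
  assumes sm: "smooth_domain \<Omega>" and ne: "frontier \<Omega> \<noteq> {}"
    and tr: "(\<lambda>n. L2_sq (surface_measure (frontier \<Omega>)) (q n)) \<longlonglongrightarrow> 0"
  obtains z s where "0 < s" "ball z s \<subseteq> \<Omega>" "L2_sq (lebesgue_on (ball z s)) v = 0"
proof -
  obtain x0 where x0: "x0 \<in> frontier \<Omega>" using ne by blast
  obtain z \<delta> e e' R \<tau> where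
    \<delta>: "0 < \<delta>" "ball z \<delta> \<subseteq> \<Omega>" and e: "e \<in> Basis" "e' = e \<or> e' = - e" and R: "0 < R"
    and \<tau>: "\<tau> \<in> borel_measurable borel" "\<And>x. x \<in> ball z \<delta> \<Longrightarrow> 0 \<le> \<tau> x \<and> \<tau> x \<le> R"
    and seg: "\<And>x t. x \<in> ball z \<delta> \<Longrightarrow> 0 \<le> t \<Longrightarrow> t < \<tau> x \<Longrightarrow> x + t *\<^sub>R e' \<in> \<Omega>"
    and hit: "\<And>x. x \<in> ball z \<delta> \<Longrightarrow> x + \<tau> x *\<^sub>R e' \<in> frontier \<Omega>"
    by (rule boundary_hitting_time[OF sm x0]) (rule that, assumption+)
  define c where "c = shadow_const DIM(real^'d) R"
  have c: "0 < c" using R by (simp add: c_def shadow_const_def)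
  define I where "I n = ennreal (1 / c) * L2_sq (surface_measure (frontier \<Omega>)) (q n)" for n
  have qb: "q n \<in> borel_measurable borel" for n
    using C1_continuous[OF q] by (auto intro: borel_measurable_continuous_onI)
  have "(\<integral>\<^sup>+x. ennreal ((norm (q n (x + \<tau> x *\<^sub>R e')))\<^sup>2) * indicator (ball z \<delta>) x \<partial>lborel) \<le> I n" for n
  proof -
    let ?X = "(\<integral>\<^sup>+x. ennreal ((norm (q n (x + \<tau> x *\<^sub>R e')))\<^sup>2) * indicator (ball z \<delta>) x \<partial>lborel)"
    have "ennreal c * ?X \<le> L2_sq (surface_measure (frontier \<Omega>)) (q n)"
      unfolding L2_sq_def c_def
      by (rule surface_integral_ge_shadow_integral[OF e R _ \<tau>(1) \<tau>(2) hit, where f="\<lambda>y. ennreal ((norm (q n y))\<^sup>2)"])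
         (use qb in auto)
    then have "ennreal (1 / c) * (ennreal c * ?X) \<le> I n" unfolding I_def by (rule mult_left_mono) simp
    moreover have "ennreal (1 / c) * (ennreal c * ?X) = ?X"
      using c by (simp add: mult.assoc[symmetric] ennreal_mult[symmetric])
    ultimately show ?thesis by simp
  qed
  moreover have "I \<longlonglongrightarrow> ennreal (1 / c) * 0" unfolding I_def by (intro ennreal_tendsto_cmult tr) auto
  ultimately have "L2_sq (lebesgue_on (ball z \<delta>)) v \<le> 4 * (ennreal (1 / c) * 0)"
    by (intro moving_endpoint_bound[OF _ \<delta>(2) \<tau> seg, where I=I]) auto
  then show ?thesis using that \<delta> by simp
qed

lemma zero_if_zero_trace:
  assumes sm: "smooth_domain \<Omega>"
    and tr: "(\<lambda>n. L2_sq (surface_measure (frontier \<Omega>)) (q n)) \<longlonglongrightarrow> 0"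
  shows "AE x in lebesgue_on \<Omega>. v x = 0"
proof (cases "frontier \<Omega> = {}")
  case True
  then have "\<Omega> = UNIV" using sm by (auto simp: frontier_eq_empty smooth_domain_def)
  then show ?thesis
    using zero_from_ball[of 1 0] zero_on_whole_space sm by (simp add: smooth_domain_def)
next
  case False
  from zero_near_boundary[OF sm this tr] show ?thesis
    using zero_from_ball sm by (metis smooth_domain_def)
qed

end

section \<open>Nonnegativity of the minimizer\<close>

lemma L2_sq_diff_tendsto:
  assumes [measurable]: "\<And>n. f n \<in> borel_measurable M" "\<And>n. g n \<in> borel_measurable M" "f' \<in> borel_measurable M" "g' \<in> borel_measurable M"
    and lim: "(\<lambda>n. L2_sq M (\<lambda>x. f n x - f' x)) \<longlonglongrightarrow> 0" "(\<lambda>n. L2_sq M (\<lambda>x. g n x - g' x)) \<longlonglongrightarrow> 0"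
  shows "(\<lambda>n. L2_sq M (\<lambda>x. (f n x - g n x) - (f' x - g' x))) \<longlonglongrightarrow> 0"
proof (rule ennreal_squeeze_0)
  show "L2_sq M (\<lambda>x. (f n x - g n x) - (f' x - g' x)) \<le> 2 * L2_sq M (\<lambda>x. f n x - f' x) + 2 * L2_sq M (\<lambda>x. g n x - g' x)" for n
  proof -
    have eq: "(\<lambda>x. (f n x - g n x) - (f' x - g' x)) = (\<lambda>x. (f n x - f' x) - (g n x - g' x))" by (simp add: fun_eq_iff)
    show ?thesis unfolding eq by (rule L2_sq_diff_le) measurable
  qed
  have "(\<lambda>n. 2 * L2_sq M (\<lambda>x. f n x - f' x) + 2 * L2_sq M (\<lambda>x. g n x - g' x)) \<longlonglongrightarrow> 2 * 0 + 2 * 0"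
    by (intro tendsto_add ennreal_tendsto_cmult lim) auto
  then show "(\<lambda>n. 2 * L2_sq M (\<lambda>x. f n x - f' x) + 2 * L2_sq M (\<lambda>x. g n x - g' x)) \<longlonglongrightarrow> 0" by simp
qed

lemma C1_diff:
  fixes p q :: "real^'d \<Rightarrow> real^'m"
  assumes "Ck_on 1 p UNIV" "Ck_on 1 q UNIV"
  shows "Ck_on 1 (\<lambda>x. p x - q x) UNIV" and "classical_grad (\<lambda>x. p x - q x) = (\<lambda>x. classical_grad p x - classical_grad q x)"
proof -
  have "((\<lambda>x. p x - q x) has_derivative (\<lambda>v. (classical_grad p x - classical_grad q x) *v v)) (at x)" for x
    unfolding matrix_vector_mult_diff_rdistrib by (intro has_derivative_diff C1_has_derivative assms)
  moreover have "continuous_on UNIV (\<lambda>x. classical_grad p x - classical_grad q x)"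
    by (intro continuous_on_diff C1_continuous_grad assms)
  ultimately show "Ck_on 1 (\<lambda>x. p x - q x) UNIV" "classical_grad (\<lambda>x. p x - q x) = (\<lambda>x. classical_grad p x - classical_grad q x)"
    by (rule C1_I; assumption)+
qed

text \<open>Deleting rows is an orthogonal projection.\<close>

lemma norm_row_scale_pos_indicator:
  "(norm A)\<^sup>2 = (norm (row_scale (pos_indicator z) A))\<^sup>2 + (norm (row_scale (pos_indicator z) A - A))\<^sup>2"
  unfolding power2_norm_eq_inner inner_vec_def[where 'b="'n::finite" and 'a="real^'m"] sum.distrib[symmetric]
  by (rule sum.cong) (auto simp: row_scale_def pos_indicator_def)

lemma norm_vec_pos_le: "norm (vec_pos z) \<le> norm z"
  by (rule norm_le_componentwise_cart) (simp add: vec_pos_def)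

lemma ext_integral_mono:
  assumes "AE x in M. f x \<le> g x"
  shows "ext_integral M f \<le> ext_integral M g"
proof -
  have "(\<integral>\<^sup>+x. ennreal (f x) \<partial>M) \<le> (\<integral>\<^sup>+x. ennreal (g x) \<partial>M)"
    by (rule nn_integral_mono_AE) (use assms in \<open>eventually_elim, simp add: ennreal_leI\<close>)
  moreover have "(\<integral>\<^sup>+x. ennreal (- g x) \<partial>M) \<le> (\<integral>\<^sup>+x. ennreal (- f x) \<partial>M)"
    by (rule nn_integral_mono_AE) (use assms in \<open>eventually_elim, simp add: ennreal_leI\<close>)
  ultimately show ?thesis
    unfolding ext_integral_def by (intro ereal_minus_mono) (simp_all add: less_eq_ennreal.rep_eq)
qed

text \<open>Where \<open>z\<close> is componentwise nonnegative, increasing one component increases the norm, hence \<open>\<phi>\<close>.\<close>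

lemma radial_gradient_nonneg:
  fixes b :: "real^'m"
  assumes phi: "\<And>z :: real^'m. \<phi> z = \<Phi> (norm z)" and mono: "mono_on {0..} \<Phi>"
    and D: "GDERIV \<phi> z :> b" and z: "\<And>i. 0 \<le> z $ i"
  shows "0 \<le> b $ i"
proof (rule ccontr)
  assume neg: "\<not> 0 \<le> b $ i"
  have line: "((\<lambda>t. z + t *\<^sub>R axis i 1) has_derivative (\<lambda>h. h *\<^sub>R axis i 1)) (at 0)"
    by (auto intro!: derivative_eq_intros)
  have "(\<phi> has_derivative (\<lambda>h. h \<bullet> b)) (at (z + 0 *\<^sub>R axis i 1))" using D by (simp add: gderiv_def)
  from has_derivative_compose[OF line this]
  have "((\<lambda>t. \<phi> (z + t *\<^sub>R axis i 1)) has_real_derivative b $ i) (at 0)"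
    by (simp add: has_field_derivative_def inner_axis' mult.commute[of _ "b $ i"])
  then obtain d where d: "0 < d" "\<And>t. 0 < t \<Longrightarrow> t < d \<Longrightarrow> \<phi> (z + (0 + t) *\<^sub>R axis i 1) < \<phi> (z + 0 *\<^sub>R axis i 1)"
    using DERIV_neg_dec_right[of "\<lambda>t. \<phi> (z + t *\<^sub>R axis i 1)" "b $ i" 0] neg by auto
  have "norm z \<le> norm (z + (d / 2) *\<^sub>R axis i 1)"
    using z d(1) by (intro norm_le_componentwise_cart) (auto simp: axis_def)
  then have "\<phi> z \<le> \<phi> (z + (d / 2) *\<^sub>R axis i 1)"
    unfolding phi by (intro mono_onD[OF mono]) auto
  then show False using d(2)[of "d / 2"] d(1) by simp
qed

lemma measurable_surface_measure:
  fixes f :: "'a::euclidean_space \<Rightarrow> 'b::euclidean_space"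
  shows "continuous_on UNIV f \<Longrightarrow> f \<in> borel_measurable (surface_measure \<Gamma>)"
  unfolding surface_measure_def
  by (rule measurable_restrict_space1) (simp add: borel_measurable_continuous_onI cong: measurable_cong_sets)

text \<open>The comparison of \<open>u\<close> with its positive part. In the chain of inequalities for the energy the
first term may a priori be infinite for the competitor; finiteness for \<open>u\<close> suffices to cancel.\<close>

proposition radial_minimizer_nonneg:
  fixes \<Omega> :: "(real^'d) set" and \<phi> :: "real^'m \<Rightarrow> real" and b :: "real^'m \<Rightarrow> real^'m"
    and ubar w g u :: "real^'d \<Rightarrow> real^'m"
  assumes sm: "smooth_domain \<Omega>"
    and phi: "\<And>z. \<phi> z = \<Phi> (norm z)" and mono: "mono_on {0..} \<Phi>" and b: "\<And>z. GDERIV \<phi> z :> b z"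
    and h: "h > 0" and g: "g \<in> L2 (lebesgue_on \<Omega>)"
    and nonneg: "ae_nonneg (lebesgue_on \<Omega>) ubar" "ae_nonneg (lebesgue_on \<Omega>) g" "ae_nonneg (surface_measure (frontier \<Omega>)) w"
    and min: "is_minimizer \<Omega> \<phi> b h ubar g w u"
  shows "ae_nonneg (lebesgue_on \<Omega>) u"
proof -
  let ?M = "lebesgue_on \<Omega>" and ?N = "surface_measure (frontier \<Omega>)"
  have op: "open \<Omega>" using sm by (simp add: smooth_domain_def)
  have m: "\<Omega> \<in> sets lebesgue" using op by auto
  have u: "u \<in> H1 \<Omega>" "u \<in> L2 ?M" and tr: "has_trace \<Omega> u w" and fin: "\<bar>energy \<Omega> \<phi> b h ubar g u\<bar> \<noteq> \<infinity>"
    and minimal: "\<And>v. v \<in> H1 \<Omega> \<Longrightarrow> has_trace \<Omega> v w \<Longrightarrow> energy \<Omega> \<phi> b h ubar g u \<le> energy \<Omega> \<phi> b h ubar g v"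
    using min by (auto simp: is_minimizer_def H1_def)
  define G where "G = weak_grad \<Omega> u"
  have G: "G \<in> L2 ?M" "has_weak_gradient \<Omega> u G" using weak_grad_H1[OF u(1)] by (auto simp: G_def)
  have wL2: "w \<in> L2 ?N" using tr by (simp add: has_trace_def)
  obtain p where p: "\<And>n. Ck_on 1 (p n) UNIV" "\<And>n. p n \<in> H1 \<Omega>" "(\<lambda>n. H1_sq \<Omega> (p n - u)) \<longlonglongrightarrow> 0" "(\<lambda>n. L2_sq ?N (p n - w)) \<longlonglongrightarrow> 0"
    using tr unfolding has_trace_def by blast
  have pL2: "p n \<in> L2 ?M" "classical_grad (p n) \<in> L2 ?M" for n using C1_H1_iff[OF op p(1)] p(2) by auto
  have pN: "p n \<in> borel_measurable ?N" for n by (rule measurable_surface_measure[OF C1_continuous[OF p(1)]])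
  have plim: "(\<lambda>n. L2_sq ?M (\<lambda>x. p n x - u x)) \<longlonglongrightarrow> 0" "(\<lambda>n. L2_sq ?M (\<lambda>x. classical_grad (p n) x - G x)) \<longlonglongrightarrow> 0"
    by (rule ennreal_squeeze_0[OF _ p(3)], simp add: H1_sq_C1_diff[OF op p(1,2) u(2) G])+
  have plimN: "(\<lambda>n. L2_sq ?N (\<lambda>x. p n x - w x)) \<longlonglongrightarrow> 0" using p(4) by (simp add: fun_diff_def)
  obtain q where q: "\<And>n. Ck_on 1 (q n) UNIV" "\<And>n. q n \<in> L2 ?M" "\<And>n. classical_grad (q n) \<in> L2 ?M" "\<And>n. q n \<in> borel_measurable ?N"
    and qlim: "(\<lambda>n. L2_sq ?M (\<lambda>x. q n x - vec_pos (u x))) \<longlonglongrightarrow> 0"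
      "(\<lambda>n. L2_sq ?M (\<lambda>x. classical_grad (q n) x - row_scale (pos_indicator (u x)) (G x))) \<longlonglongrightarrow> 0"
      "(\<lambda>n. L2_sq ?N (\<lambda>x. q n x - vec_pos (w x))) \<longlonglongrightarrow> 0"
    by (rule smooth_positive_part_approximation[OF p(1) pL2 u(2) G(1) wL2 pN plim plimN]) (rule that, assumption+)
  define u' where "u' x = vec_pos (u x)" for x
  define G' where "G' x = row_scale (pos_indicator (u x)) (G x)" for x
  have meas: "u \<in> borel_measurable ?M" "G \<in> borel_measurable ?M" "w \<in> borel_measurable ?N" using u G wL2 by (auto simp: L2_def)
  have u'L2: "u' \<in> L2 ?M" unfolding u'_def
    by (rule L2_mono[OF u(2) measurable_vec_pos[OF meas(1)]]) (simp add: norm_vec_pos_le)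
  have G'L2: "G' \<in> L2 ?M" unfolding G'_def
    by (rule L2_mono[OF G(1) measurable_row_scale[OF measurable_pos_indicator[OF meas(1)] meas(2)]])
       (simp add: norm_row_scale_le pos_indicator_def)
  have wg: "has_weak_gradient \<Omega> u' G'"
    by (rule weak_gradient_limit[OF m q(2) u'L2 q(3) G'L2 weak_gradient_classical[OF op q(1)] qlim(1,2)[folded u'_def G'_def]])
  note u'H = H1_I[OF op u'L2 G'L2 wg]
  have wpos: "AE x in ?N. vec_pos (w x) = w x"
    using nonneg(3) unfolding ae_nonneg_def by eventually_elim (simp add: vec_pos_def vec_eq_iff)
  have tr': "has_trace \<Omega> u' w"
    unfolding has_trace_def
  proof (intro conjI exI[of _ q] allI)
    show "q n \<in> H1 \<Omega>" for n using C1_H1_iff[OF op q(1)] q(2,3) by simp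
    have "H1_sq \<Omega> (q n - u') = L2_sq ?M (\<lambda>x. q n x - u' x) + L2_sq ?M (\<lambda>x. classical_grad (q n) x - G' x)" for n
      using C1_H1_iff[OF op q(1)] q(2,3) by (intro H1_sq_C1_diff[OF op q(1) _ u'L2 G'L2 wg]) simp
    then show "(\<lambda>n. H1_sq \<Omega> (q n - u')) \<longlonglongrightarrow> 0"
      using tendsto_add[OF qlim(1,2)] by (simp add: u'_def G'_def)
    have "L2_sq ?N (q n - w) = L2_sq ?N (\<lambda>x. q n x - vec_pos (w x))" for n
      by (rule L2_sq_cong_AE) (use wpos in eventually_elim, simp)
    then show "(\<lambda>n. L2_sq ?N (q n - w)) \<longlonglongrightarrow> 0" using qlim(3) by simp
  qed (use u'H(1) wL2 q(1) in auto)
  define E where "E v = ext_integral ?M (\<lambda>x. (\<phi> (v x) - b (ubar x) \<bullet> v x) / h)" for v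
  have EL: "E u' \<le> E u"
    unfolding E_def
  proof (rule ext_integral_mono)
    show "AE x in ?M. (\<phi> (u' x) - b (ubar x) \<bullet> u' x) / h \<le> (\<phi> (u x) - b (ubar x) \<bullet> u x) / h"
      using nonneg(1) unfolding ae_nonneg_def
    proof eventually_elim
      case (elim x)
      have "\<phi> (u' x) \<le> \<phi> (u x)"
        unfolding phi u'_def by (intro mono_onD[OF mono] norm_vec_pos_le) auto
      moreover have "b (ubar x) \<bullet> u x \<le> b (ubar x) \<bullet> u' x"
        unfolding inner_vec_def u'_def vec_pos_def
        using radial_gradient_nonneg[OF phi mono b] elim by (intro sum_mono) (auto intro!: mult_left_mono)
      ultimately show ?case using h by (intro divide_right_mono) auto
    qed
  qed
  have gL: "(LINT x|?M. g x \<bullet> u x) \<le> (LINT x|?M. g x \<bullet> u' x)"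
  proof (rule integral_mono_AE[OF L2_integrable_inner[OF g u(2)] L2_integrable_inner[OF g u'L2]])
    show "AE x in ?M. g x \<bullet> u x \<le> g x \<bullet> u' x"
      using nonneg(2) unfolding ae_nonneg_def
      by eventually_elim (auto simp: inner_vec_def u'_def vec_pos_def intro!: sum_mono mult_left_mono)
  qed
  have D': "(LINT x|?M. (norm (weak_grad \<Omega> u' x))\<^sup>2) = (LINT x|?M. (norm (G' x))\<^sup>2)"
  proof (rule integral_cong_AE)
    show "AE x in ?M. (norm (weak_grad \<Omega> u' x))\<^sup>2 = (norm (G' x))\<^sup>2" using u'H(2) by eventually_elim simp
  qed (use weak_grad_H1(1)[OF u'H(1)] G'L2 in \<open>auto simp: L2_def\<close>)
  have DL: "(LINT x|?M. (norm (G x))\<^sup>2) \<le> (LINT x|?M. (norm (G' x))\<^sup>2)"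
  proof -
    have "\<bar>E u\<bar> \<noteq> \<infinity>" using fin unfolding energy_def E_def[symmetric] by (cases "E u") auto
    then obtain r where r: "E u = ereal r" by (cases "E u") auto
    have "E u + ereal (1 / 2 * (LINT x|?M. (norm (G x))\<^sup>2)) - ereal (LINT x|?M. g x \<bullet> u x)
      \<le> E u' + ereal (1 / 2 * (LINT x|?M. (norm (G' x))\<^sup>2)) - ereal (LINT x|?M. g x \<bullet> u' x)"
      using minimal[OF u'H(1) tr'] unfolding energy_def E_def[symmetric] D' G_def .
    also have "\<dots> \<le> E u + ereal (1 / 2 * (LINT x|?M. (norm (G' x))\<^sup>2)) - ereal (LINT x|?M. g x \<bullet> u' x)"
      by (intro ereal_minus_mono add_right_mono EL order_refl)
    finally show ?thesis using gL by (simp add: r)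
  qed
  \<comment> \<open>By orthogonality, \<open>\<bar>G' - G\<bar>\<^sup>2 = \<bar>G\<bar>\<^sup>2 - \<bar>G'\<bar>\<^sup>2\<close>, which by \<open>DL\<close> has nonpositive integral.\<close>
  have GG': "AE x in ?M. G' x - G x = 0"
  proof -
    have d: "(norm (G' x - G x))\<^sup>2 = (norm (G x))\<^sup>2 - (norm (G' x))\<^sup>2" for x
      using norm_row_scale_pos_indicator[of "G x" "u x"] by (simp add: G'_def)
    have i: "integrable ?M (\<lambda>x. (norm (G x))\<^sup>2)" "integrable ?M (\<lambda>x. (norm (G' x))\<^sup>2)" "integrable ?M (\<lambda>x. (norm (G' x - G x))\<^sup>2)"
      by (intro L2_integrable_norm_sq G G'L2 L2_diff)+
    have "(LINT x|?M. (norm (G' x - G x))\<^sup>2) = 0"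
    proof (rule antisym)
      show "(LINT x|?M. (norm (G' x - G x))\<^sup>2) \<le> 0" unfolding d using i DL by simp
    qed simp
    then have "AE x in ?M. (norm (G' x - G x))\<^sup>2 = 0"
      using integral_nonneg_eq_0_iff_AE[OF i(3)] by simp
    then show ?thesis by eventually_elim simp
  qed
  have meas': "q n \<in> borel_measurable ?M" "classical_grad (q n) \<in> borel_measurable ?M" "p n \<in> borel_measurable ?M" "classical_grad (p n) \<in> borel_measurable ?M"
    "u' \<in> borel_measurable ?M" "G' \<in> borel_measurable ?M" for n
    using q pL2 u'L2 G'L2 by (auto simp: L2_def)
  interpret V: vanishing_gradient_limit \<Omega> "\<lambda>n x. q n x - p n x" "\<lambda>x. u' x - u x"
  proof
    show "Ck_on 1 (\<lambda>x. q n x - p n x) UNIV" for n by (rule C1_diff(1)[OF q(1) p(1)])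
    show "(\<lambda>x. u' x - u x) \<in> L2 ?M" by (rule L2_diff[OF u'L2 u(2)])
    show "(\<lambda>n. L2_sq ?M (\<lambda>x. q n x - p n x - (u' x - u x))) \<longlonglongrightarrow> 0"
      by (rule L2_sq_diff_tendsto[OF meas'(1,3,5) meas(1) qlim(1)[folded u'_def] plim(1)])
    have "(\<lambda>n. L2_sq ?M (\<lambda>x. classical_grad (q n) x - classical_grad (p n) x - (G' x - G x))) \<longlonglongrightarrow> 0"
      by (rule L2_sq_diff_tendsto[OF meas'(2,4,6) meas(2) qlim(2)[folded G'_def] plim(2)])
    moreover have "L2_sq ?M (classical_grad (\<lambda>x. q n x - p n x)) = L2_sq ?M (\<lambda>x. classical_grad (q n) x - classical_grad (p n) x - (G' x - G x))" for n
      unfolding C1_diff(2)[OF q(1) p(1)] by (rule L2_sq_cong_AE) (use GG' in eventually_elim, simp)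
    ultimately show "(\<lambda>n. L2_sq ?M (classical_grad (\<lambda>x. q n x - p n x))) \<longlonglongrightarrow> 0" by simp
  qed (rule op)
  have "(\<lambda>n. L2_sq ?N (\<lambda>x. q n x - p n x - (vec_pos (w x) - w x))) \<longlonglongrightarrow> 0"
    by (rule L2_sq_diff_tendsto[OF q(4) pN measurable_vec_pos[OF meas(3)] meas(3) qlim(3) plimN])
  moreover have "L2_sq ?N (\<lambda>x. q n x - p n x) = L2_sq ?N (\<lambda>x. q n x - p n x - (vec_pos (w x) - w x))" for n
    by (rule L2_sq_cong_AE) (use wpos in eventually_elim, simp)
  ultimately have "(\<lambda>n. L2_sq ?N (\<lambda>x. q n x - p n x)) \<longlonglongrightarrow> 0" by simp
  from V.zero_if_zero_trace[OF sm this] have "AE x in ?M. u' x = u x" by simp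
  then show ?thesis unfolding ae_nonneg_def
  proof eventually_elim
    case (elim x)
    have "0 \<le> u' x $ i" for i by (simp add: u'_def vec_pos_def)
    then show ?case using elim by simp
  qed
qed

theorem theorem2:
  fixes \<Omega> :: "(real^'d) set"
    and \<phi> :: "real^'m \<Rightarrow> real" and b :: "real^'m \<Rightarrow> real^'m" and B :: "real^'m \<Rightarrow> real"
    and \<Phi> \<Phi>' :: "real \<Rightarrow> real"
    and T h C :: real
    and f :: "real \<Rightarrow> (real^'d \<Rightarrow> real^'m) \<Rightarrow> real"
    and ub :: "real \<Rightarrow> real^'d \<Rightarrow> real^'m"
    and b0 ubar w g u :: "real^'d \<Rightarrow> real^'m"
  assumes "smooth_domain \<Omega>" and "CARD('m) \<ge> 2" and "0 < T"
    and "\<And>z. \<phi> z \<ge> 0" and "convex_on UNIV \<phi>" and "\<phi> 0 = 0"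
    and "\<And>z. GDERIV \<phi> z :> b z" and "continuous_on UNIV b" and "b 0 = 0"
    and "\<And>z. B z = z \<bullet> b z - \<phi> z"
    and "C > 0"
    and "\<And>z. norm (b z) \<le> C * (norm z + 1)"
    and "\<And>z. (norm (b z))\<^sup>2 \<le> C * (B z + 1)"
    and "admissible_source \<Omega> T f"
    and "admissible_initial_data \<Omega> \<phi> b b0"
    and "admissible_boundary_data \<Omega> T ub"
    and "\<And>z. \<phi> z = \<Phi> (norm z)"
    and "convex_on {0..} \<Phi>" and "mono_on {0..} \<Phi>"
    and "\<And>s. s \<ge> 0 \<Longrightarrow> (\<Phi> has_real_derivative \<Phi>' s) (at s within {0..})"
    and "continuous_on {0..} \<Phi>'"
    and "\<Phi> 0 = 0" and "\<And>s. s \<ge> 0 \<Longrightarrow> \<Phi> s \<ge> 0"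
    and "h > 0"
    and "ubar \<in> L2 (lebesgue_on \<Omega>)" and "w \<in> Hhalf (frontier \<Omega>)" and "g \<in> L2 (lebesgue_on \<Omega>)"
    and "ae_nonneg (lebesgue_on \<Omega>) ubar" and "ae_nonneg (lebesgue_on \<Omega>) g"
    and "ae_nonneg (surface_measure (frontier \<Omega>)) w"
    and "is_minimizer \<Omega> \<phi> b h ubar g w u"
  shows "ae_nonneg (lebesgue_on \<Omega>) u"
proof (rule radial_minimizer_nonneg)
  show "smooth_domain \<Omega>" by fact
  show "\<And>z. \<phi> z = \<Phi> (norm z)" by fact
  show "mono_on {0..} \<Phi>" by fact
  show "\<And>z. GDERIV \<phi> z :> b z" by fact
  show "h > 0" by fact
  show "g \<in> L2 (lebesgue_on \<Omega>)" by fact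
  show "ae_nonneg (lebesgue_on \<Omega>) ubar" "ae_nonneg (lebesgue_on \<Omega>) g" by fact+
  show "ae_nonneg (surface_measure (frontier \<Omega>)) w" by fact
  show "is_minimizer \<Omega> \<phi> b h ubar g w u" by fact
qed

end
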